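(* Fix $\beta\in(0,\beta_0)$ and $u_0\in\operatorname{H}^1(0,\pi)$. Let $y\in\operatorname{BC}\bigl((0,\infty),\mathbb{R}\bigr)$ (bounded continuous) be a solution of the integral equation $$y(t)=f(t)+\int_0^t a(t-\tau)\,g_\beta\bigl(y(\tau)\bigr)\,d\tau,\quad t>0,$$ with $f$, $a$, $g_\beta$ as defined in the context ($f$ depends on $u_0$). Then $\lim_{t\to\infty}y(t)=0$.
   Context: $\operatorname{H}^1=\operatorname{H}^1(0,\pi)$, $\operatorname{H}^{-1}=(\operatorname{H}^1)'$; $A_N:\operatorname{H}^1\subset\operatorname{H}^{-1}\to\operatorname{H}^{-1}$ is given by $\langle A_Nu,v\rangle=\int_0^\pi u_xv_x\,dx$, and $e^{-tA_N}$ is the analytic semigroup on $\operatorname{H}^{-1}$ generated by $-A_N$. $\delta_0\in\operatorname{H}^{-1}$ is $\langle\delta_0,v\rangle=v(0)$. Set $$f(t)=\bigl(e^{-tA_N}u_0\bigr)(\pi)\ (t\ge0),\qquad a(t)=-\bigl(e^{-tA_N}\delta_0\bigr)(\pi)=-\tfrac1\pi+\tfrac2\pi\sum_{k=1}^\infty(-1)^{k+1}e^{-tk^2}\ (t>0),\qquad g_\beta(w)=\tanh(\beta w)\ (w\in\mathbb{R}).$$ The constant $\beta_0$: let $\omega_0=\min\{\omega>0 : \sqrt{i\omega}\,\sin(\sqrt{i\omega}\,\pi)\in(0,\infty)\}$ and $\beta_0=\sqrt{i\omega_0}\,\sin(\sqrt{i\omega_0}\,\pi)\approx5.6655$. *)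

theory Defs
  imports "HOL-Analysis.Analysis"
begin

section \<open>Square-integrable functions and weak derivatives on the interval\<close>

abbreviation Leb :: "real measure" where
  "Leb \<equiv> lebesgue_on {0..pi}"

definition square_integrable :: "(real \<Rightarrow> real) \<Rightarrow> bool" where
  "square_integrable f \<longleftrightarrow> f \<in> borel_measurable Leb \<and> integrable Leb (\<lambda>x. (f x)\<^sup>2)"

text \<open>
  Test functions are \<open>C\<^sup>1\<close> with compact support in \<open>(0,\<pi>)\<close>; the weak derivatives of square-integrable
  functions are the same as with smooth test functions. Integrals over \<open>(0,\<pi>)\<close> are
  written over \<open>[0,\<pi>]\<close>, which differs by a null set.
\<close>

definition test_function :: "(real \<Rightarrow> real) \<Rightarrow> bool" where
  "test_function \<phi> \<longleftrightarrow> \<phi> C1_differentiable_on UNIV \<and> closure {x. \<phi> x \<noteq> 0} \<subseteq> {0<..<pi}"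

definition weak_deriv :: "(real \<Rightarrow> real) \<Rightarrow> (real \<Rightarrow> real) \<Rightarrow> bool" where
  "weak_deriv u g \<longleftrightarrow>
     (\<forall>\<phi>. test_function \<phi> \<longrightarrow>
        (LINT x|Leb. u x * deriv \<phi> x) = - (LINT x|Leb. g x * \<phi> x))"

lemma finite_measure_Leb: "finite_measure Leb"
  by (rule finite_measure_lebesgue_on) auto

lemma square_integrable_mult:
  assumes "square_integrable f" "square_integrable g"
  shows "integrable Leb (\<lambda>x. f x * g x)"
proof (rule Bochner_Integration.integrable_bound)
  show "integrable Leb (\<lambda>x. (f x)\<^sup>2 + (g x)\<^sup>2)"
    using assms by (auto simp: square_integrable_def)
  show "(\<lambda>x. f x * g x) \<in> borel_measurable Leb"
    using assms by (auto simp: square_integrable_def)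
  have "\<bar>a * b\<bar> \<le> a\<^sup>2 + b\<^sup>2" for a b :: real
  proof -
    have "0 \<le> (\<bar>a\<bar> - \<bar>b\<bar>)\<^sup>2" by simp
    then have "2 * (\<bar>a\<bar> * \<bar>b\<bar>) \<le> a\<^sup>2 + b\<^sup>2" by (simp add: power2_diff)
    moreover have "0 \<le> \<bar>a\<bar> * \<bar>b\<bar>" by simp
    ultimately show ?thesis unfolding abs_mult by linarith
  qed
  then show "AE x in Leb. norm (f x * g x) \<le> norm ((f x)\<^sup>2 + (g x)\<^sup>2)"
    by simp
qed

lemma square_integrable_add:
  assumes "square_integrable f" "square_integrable g"
  shows "square_integrable (\<lambda>x. f x + g x)"
  using assms square_integrable_mult[OF assms]
  by (auto simp: square_integrable_def power2_sum mult.assoc)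

lemma square_integrable_cmult:
  "square_integrable f \<Longrightarrow> square_integrable (\<lambda>x. c * f x)"
  by (auto simp: square_integrable_def power_mult_distrib)

lemma square_integrable_continuous:
  assumes "continuous_on {0..pi} f"
  shows "square_integrable f"
  unfolding square_integrable_def
  using continuous_imp_integrable_real[OF assms]
    continuous_imp_integrable_real[OF continuous_on_power[OF assms, of 2]]
  by (auto intro: borel_measurable_integrable)

lemma square_integrable_const: "square_integrable (\<lambda>_. c)"
  by (rule square_integrable_continuous) auto

lemma square_integrable_imp_integrable: "square_integrable f \<Longrightarrow> integrable Leb f"
  using square_integrable_mult[OF _ square_integrable_const, of f 1] by simp

lemma integral_Cauchy_Schwarz:
  assumes f: "square_integrable f" and g: "square_integrable g"
  shows "\<bar>LINT x|Leb. f x * g x\<bar> \<le> sqrt (LINT x|Leb. (f x)\<^sup>2) * sqrt (LINT x|Leb. (g x)\<^sup>2)"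
proof -
  let ?F = "LINT x|Leb. (f x)\<^sup>2" and ?G = "LINT x|Leb. (g x)\<^sup>2" and ?P = "LINT x|Leb. f x * g x"
  have int: "integrable Leb (\<lambda>x. (f x)\<^sup>2)" "integrable Leb (\<lambda>x. (g x)\<^sup>2)"
      "integrable Leb (\<lambda>x. f x * g x)"
    using f g square_integrable_mult[OF f g] by (auto simp: square_integrable_def)
  have F: "?F \<ge> 0" and G: "?G \<ge> 0" by (auto intro: integral_nonneg_AE)
  have quad: "0 \<le> s\<^sup>2 * ?F - 2 * s * r * ?P + r\<^sup>2 * ?G" for r s
  proof -
    have "0 \<le> (LINT x|Leb. (s * f x - r * g x)\<^sup>2)"
      by (auto intro: integral_nonneg_AE)
    also have "\<dots> = (LINT x|Leb. s\<^sup>2 * (f x)\<^sup>2 - 2 * s * r * (f x * g x) + r\<^sup>2 * (g x)\<^sup>2)"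
      by (intro Bochner_Integration.integral_cong) (auto simp: power2_eq_square algebra_simps)
    also have "\<dots> = s\<^sup>2 * ?F - 2 * s * r * ?P + r\<^sup>2 * ?G"
      using int by simp
    finally show ?thesis .
  qed
  have "?P\<^sup>2 \<le> ?F * ?G"
  proof (cases "?G = 0")
    case True
    have "?P = 0"
    proof (rule ccontr)
      assume "?P \<noteq> 0"
      then show False
        using quad[of 1 "(?F + 1) / (2 * ?P)"] True by (simp add: field_simps)
    qed
    then show ?thesis using True by simp
  next
    case False
    then have "?G > 0" using G by linarith
    have "0 \<le> ?G * (?F * ?G - ?P\<^sup>2)"
      using quad[of ?G ?P] by (simp add: power2_eq_square algebra_simps)
    then show ?thesis using \<open>?G > 0\<close> by (simp add: zero_le_mult_iff)
  qed
  then have "sqrt (?P\<^sup>2) \<le> sqrt (?F * ?G)" by (rule real_sqrt_le_mono)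
  then show ?thesis by (simp add: real_sqrt_mult)
qed

subsection \<open>The fundamental theorem of calculus for weak derivatives\<close>

definition ramp :: "real \<Rightarrow> real" where
  "ramp t = 2 * (t * max 0 t) - 4 * ((t - 1/2) * max 0 (t - 1/2)) + 2 * ((t - 1) * max 0 (t - 1))"

definition hat :: "real \<Rightarrow> real" where
  "hat t = 4 * max 0 t - 8 * max 0 (t - 1/2) + 4 * max 0 (t - 1)"

lemma ramp_simps [simp]: "t \<le> 0 \<Longrightarrow> ramp t = 0" "t \<ge> 1 \<Longrightarrow> ramp t = 1"
  by (auto simp: ramp_def max_def field_simps)

lemma hat_outside [simp]: "t \<le> 0 \<Longrightarrow> hat t = 0" "t \<ge> 1 \<Longrightarrow> hat t = 0"
  by (auto simp: hat_def max_def field_simps)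

lemma hat_nonneg: "hat t \<ge> 0"
  by (auto simp: hat_def max_def field_simps)

lemma continuous_on_hat [continuous_intros]:
  "continuous_on A f \<Longrightarrow> continuous_on A (\<lambda>x. hat (f x))"
  unfolding hat_def by (intro continuous_intros)

lemma has_real_derivative_mult_max: "((\<lambda>t::real. t * max 0 t) has_real_derivative 2 * max 0 x) (at x)"
proof -
  consider "x < 0" | "x = 0" | "x > 0" by linarith
  then show ?thesis
  proof cases
    case 1
    have "((\<lambda>t::real. 0) has_real_derivative 2 * max 0 x) (at x)"
      using 1 by (simp add: max_def)
    then show ?thesis
      by (rule has_field_derivative_transform_within_open[where S = "{..<0}"]) (use 1 in auto)
  next
    case 2
    have "isCont (\<lambda>t::real. max 0 t) x" by (intro continuous_intros)
    then show ?thesis using 2 by (auto simp: CARAT_DERIV intro!: exI[of _ "\<lambda>t::real. max 0 t"])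
  next
    case 3
    have "((\<lambda>t::real. t * t) has_real_derivative 2 * max 0 x) (at x)"
      using 3 by (auto intro!: derivative_eq_intros)
    then show ?thesis
      by (rule has_field_derivative_transform_within_open[where S = "{0<..}"]) (use 3 in auto)
  qed
qed

lemma has_real_derivative_ramp: "(ramp has_real_derivative hat x) (at x)"
proof -
  note D = DERIV_chain2[OF has_real_derivative_mult_max]
  have 1: "((\<lambda>t::real. (t - c) * max 0 (t - c)) has_real_derivative 2 * max 0 (x - c)) (at x)" for c
    by (rule DERIV_cong[OF D[of "\<lambda>t. t - c" 1]]) (auto intro!: derivative_eq_intros)
  have "((\<lambda>t. 2 * (t * max 0 t) - 4 * ((t - 1/2) * max 0 (t - 1/2)) + 2 * ((t - 1) * max 0 (t - 1)))
      has_real_derivative (2 * (2 * max 0 x) - 4 * (2 * max 0 (x - 1/2)) + 2 * (2 * max 0 (x - 1)))) (at x)"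
    by (intro DERIV_add DERIV_diff DERIV_cmult 1 has_real_derivative_mult_max)
  then show ?thesis by (simp add: ramp_def[abs_def] hat_def)
qed

lemma ramp_bounded: "\<bar>ramp t\<bar> \<le> 8"
proof -
  consider "t \<le> 0" | "t \<ge> 1" | "0 < t" "t < 1" by linarith
  then show ?thesis
  proof cases
    case 3
    have b: "\<bar>(t - c) * max 0 (t - c)\<bar> \<le> 1" if "0 \<le> c" "c \<le> 1" for c
    proof -
      have "\<bar>t - c\<bar> \<le> 1" "\<bar>max 0 (t - c)\<bar> \<le> 1" using 3 that by auto
      then show ?thesis unfolding abs_mult by (metis abs_ge_zero mult_le_one)
    qed
    have "\<bar>2 * p - 4 * q + 2 * r\<bar> \<le> 8" if "\<bar>p\<bar> \<le> 1" "\<bar>q\<bar> \<le> 1" "\<bar>r\<bar> \<le> 1" for p q r :: real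
      using that by linarith
    from this[OF b[of 0] b[of "1/2"] b[of 1]] show ?thesis by (simp add: ramp_def)
  qed auto
qed

lemma has_real_derivative_ramp_scaled:
  "((\<lambda>x. ramp ((x - a) / e)) has_real_derivative hat ((x - a) / e) / e) (at x)"
  by (rule DERIV_cong[OF DERIV_chain2[OF has_real_derivative_ramp, of _ "1 / e"]])
     (auto intro!: derivative_eq_intros simp: divide_inverse)

lemma continuous_on_ramp_scaled: "continuous_on A (\<lambda>x. ramp ((x - a) / e))"
  by (rule DERIV_continuous_on[OF has_field_derivative_at_within[OF has_real_derivative_ramp_scaled]])

lemma hat_approximates_point:
  assumes u: "continuous_on {0..pi} u" and a: "0 \<le> a" "a < pi"
    and e: "e \<longlonglongrightarrow> 0" "\<And>n. 0 < e n" "\<And>n. e n \<le> pi - a"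
  shows "(\<lambda>n. LINT x|Leb. u x * (hat ((x - a) / e n) / e n)) \<longlonglongrightarrow> u a"
proof (rule LIMSEQ_I)
  fix r :: real assume "0 < r"
  define \<rho> where "\<rho> n x = hat ((x - a) / e n) / e n" for n x
  have \<rho>0: "\<rho> n x \<ge> 0" for n x using hat_nonneg e(2)[of n] by (simp add: \<rho>_def)
  have \<rho>c: "continuous_on {0..pi} (\<rho> n)" for n
    using e(2)[of n] unfolding \<rho>_def by (intro continuous_intros) auto
  have "((\<rho> n) has_integral (ramp ((pi - a) / e n) - ramp ((0 - a) / e n))) {0..pi}" for n
    unfolding \<rho>_def
    by (rule fundamental_theorem_of_calculus)
       (auto simp: has_real_derivative_iff_has_vector_derivative[symmetric]
         intro: has_field_derivative_at_within has_real_derivative_ramp_scaled)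
  moreover have "ramp ((pi - a) / e n) = 1" "ramp ((0 - a) / e n) = 0" for n
    using e(2)[of n] e(3)[of n] a by (auto simp: field_simps)
  ultimately have \<rho>1: "((\<rho> n) has_integral 1) {0..pi}" for n by simp
  obtain d where d: "d > 0" "\<And>x. x \<in> {0..pi} \<Longrightarrow> dist x a < d \<Longrightarrow> dist (u x) (u a) < r / 2"
    using u a \<open>0 < r\<close> unfolding continuous_on_iff by (metis atLeastAtMost_iff half_gt_zero less_imp_le)
  obtain N where N: "\<And>n. n \<ge> N \<Longrightarrow> e n < d"
    using LIMSEQ_D[OF e(1) d(1)] e(2) by fastforce
  show "\<exists>N. \<forall>n\<ge>N. norm ((LINT x|Leb. u x * (hat ((x - a) / e n) / e n)) - u a) < r"
  proof (intro exI allI impI)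
    fix n assume n: "n \<ge> N"
    have c: "continuous_on {0..pi} (\<lambda>x. u x * \<rho> n x)" using u \<rho>c by (intro continuous_intros)
    have i1: "((\<lambda>x. u x * \<rho> n x) has_integral (LINT x|Leb. u x * \<rho> n x)) {0..pi}"
      by (rule has_integral_integral_lebesgue_on[OF continuous_imp_integrable_real[OF c]]) auto
    have i2: "((\<lambda>x. u x * \<rho> n x - u a * \<rho> n x) has_integral
        ((LINT x|Leb. u x * \<rho> n x) - u a * 1)) {0..pi}"
      by (intro has_integral_diff i1 has_integral_mult_right \<rho>1)
    have i3: "((\<lambda>x. r / 2 * \<rho> n x) has_integral (r / 2 * 1)) {0..pi}"
      by (intro has_integral_mult_right \<rho>1)
    have "norm (u x * \<rho> n x - u a * \<rho> n x) \<le> r / 2 * \<rho> n x" if x: "x \<in> {0..pi}" for x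
    proof (cases "dist x a < d")
      case True
      then have "\<bar>u x - u a\<bar> \<le> r / 2" using d(2)[OF x] by (auto simp: dist_real_def)
      then have "\<bar>u x - u a\<bar> * \<rho> n x \<le> r / 2 * \<rho> n x" using \<rho>0 by (intro mult_right_mono)
      then show ?thesis using \<rho>0[of n x] by (simp add: left_diff_distrib[symmetric] abs_mult)
    next
      case False
      then have "(x - a) / e n \<le> 0 \<or> (x - a) / e n \<ge> 1"
        using N[OF n] e(2)[of n] by (auto simp: dist_real_def field_simps abs_if split: if_splits)
      then have "\<rho> n x = 0" by (auto simp: \<rho>_def)
      then show ?thesis by simp
    qed
    then have "norm (integral {0..pi} (\<lambda>x. u x * \<rho> n x - u a * \<rho> n x))
        \<le> integral {0..pi} (\<lambda>x. r / 2 * \<rho> n x)"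
      by (intro integral_norm_bound_integral) (use i2 i3 in auto)
    then have "norm ((LINT x|Leb. u x * \<rho> n x) - u a) \<le> r / 2"
      using integral_unique[OF i2] integral_unique[OF i3] by (simp only: mult_1_right)
    then show "norm ((LINT x|Leb. u x * (hat ((x - a) / e n) / e n)) - u a) < r"
      using \<open>0 < r\<close> unfolding \<rho>_def by linarith
  qed
qed

lemma weak_deriv_interior:
  assumes u: "continuous_on {0..pi} u" and g: "square_integrable g" and w: "weak_deriv u g"
    and ab: "0 < a" "a < b" "b < pi"
  shows "u b - u a = (LINT x|Leb. g x * indicator {a<..b} x)"
proof -
  define e where "e n = ((pi - b) / 2) / real (Suc n)" for n
  have e0: "e n > 0" for n using ab by (simp add: e_def)
  have e1: "e n \<le> (pi - b) / 2" for n
    proof -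
    have "(pi - b) / 2 / real (Suc n) \<le> (pi - b) / 2 / 1"
      using ab by (intro divide_left_mono) auto
    then show ?thesis by (simp add: e_def)
  qed
  have e2: "e n \<le> pi - b" "e n \<le> pi - a" for n
    using e1[of n] ab by (auto simp: field_simps)
  have elim: "e \<longlonglongrightarrow> 0"
    unfolding e_def by (rule LIMSEQ_Suc[OF lim_const_over_n])
  define \<phi> where "\<phi> n x = ramp ((x - a) / e n) - ramp ((x - b) / e n)" for n x
  define \<phi>' where "\<phi>' n x = hat ((x - a) / e n) / e n - hat ((x - b) / e n) / e n" for n x
  have D: "(\<phi> n has_real_derivative \<phi>' n x) (at x)" for n x
    unfolding \<phi>_def[abs_def] \<phi>'_def by (intro DERIV_diff has_real_derivative_ramp_scaled)
  have D': "deriv (\<phi> n) x = \<phi>' n x" for n x using D by (rule DERIV_imp_deriv)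
  have c': "continuous_on A (\<phi>' n)" for n A
    unfolding \<phi>'_def[abs_def] using e0[of n] by (intro continuous_intros) auto
  have zero: "\<phi> n x = 0" if "x \<notin> {a..b + e n}" for n x
  proof -
    have "x < a \<or> x > b + e n" using that by auto
    then show ?thesis
    proof
      assume "x < a"
      then have "(x - a) / e n \<le> 0" "(x - b) / e n \<le> 0" using e0[of n] ab by (auto simp: field_simps)
      then show ?thesis by (simp add: \<phi>_def)
    next
      assume "x > b + e n"
      then have "(x - a) / e n \<ge> 1" "(x - b) / e n \<ge> 1" using e0[of n] ab by (auto simp: field_simps)
      then show ?thesis by (simp add: \<phi>_def)
    qed
  qed
  have "closure {x. \<phi> n x \<noteq> 0} \<subseteq> {a..b + e n}" for n
    by (rule closure_minimal) (use zero in blast, simp)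
  moreover have "{a..b + e n} \<subseteq> {0<..<pi}" for n using e1[of n] ab by (auto simp: field_simps)
  ultimately have supp: "closure {x. \<phi> n x \<noteq> 0} \<subseteq> {0<..<pi}" for n by blast
  have test: "test_function (\<phi> n)" for n
    unfolding test_function_def C1_differentiable_on_def
    using D c' supp has_real_derivative_iff_has_vector_derivative by blast
  have eq: "(LINT x|Leb. u x * \<phi>' n x) = - (LINT x|Leb. g x * \<phi> n x)" for n
    using w[unfolded weak_deriv_def, rule_format, OF test[of n]] by (simp only: D')
  have "(\<lambda>n. LINT x|Leb. u x * (hat ((x - a) / e n) / e n)) \<longlonglongrightarrow> u a"
    by (rule hat_approximates_point[OF u _ _ elim e0]) (use ab e2 in auto)
  moreover have "(\<lambda>n. LINT x|Leb. u x * (hat ((x - b) / e n) / e n)) \<longlonglongrightarrow> u b"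
    by (rule hat_approximates_point[OF u _ _ elim e0]) (use ab e2 in auto)
  ultimately have "(\<lambda>n. (LINT x|Leb. u x * (hat ((x - a) / e n) / e n))
      - (LINT x|Leb. u x * (hat ((x - b) / e n) / e n))) \<longlonglongrightarrow> u a - u b"
    by (rule tendsto_diff)
  moreover have "(LINT x|Leb. u x * (hat ((x - a) / e n) / e n))
      - (LINT x|Leb. u x * (hat ((x - b) / e n) / e n)) = (LINT x|Leb. u x * \<phi>' n x)" for n
  proof -
    have "integrable Leb (\<lambda>x. u x * (hat ((x - c) / e n) / e n))" for c
      using e0[of n] by (intro continuous_imp_integrable_real continuous_intros u) auto
    from Bochner_Integration.integral_diff[OF this[of a] this[of b]]
    show ?thesis by (simp add: \<phi>'_def right_diff_distrib)
  qed
  ultimately have L: "(\<lambda>n. LINT x|Leb. u x * \<phi>' n x) \<longlonglongrightarrow> u a - u b" by simp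
  have R: "(\<lambda>n. LINT x|Leb. g x * \<phi> n x) \<longlonglongrightarrow> (LINT x|Leb. g x * indicator {a<..b} x)"
  proof (rule integral_dominated_convergence[where w = "\<lambda>x. 16 * \<bar>g x\<bar>"])
    have gm: "g \<in> borel_measurable Leb" using g by (simp add: square_integrable_def)
    show "(\<lambda>x. g x * indicator {a<..b} x) \<in> borel_measurable Leb"
    proof -
      have "(indicator {a<..b} :: real \<Rightarrow> real) \<in> borel_measurable Leb"
        by (rule measurable_restrict_space1) (auto intro: borel_measurable_indicator)
      then show ?thesis using gm by (rule borel_measurable_times[rotated])
    qed
    have "\<phi> n \<in> borel_measurable Leb" for n
      unfolding \<phi>_def[abs_def]
      by (intro continuous_imp_measurable_on_sets_lebesgue continuous_on_diff continuous_on_ramp_scaled) auto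
    then show "(\<lambda>x. g x * \<phi> n x) \<in> borel_measurable Leb" for n
      using gm by (intro borel_measurable_times) auto
    show "integrable Leb (\<lambda>x. 16 * \<bar>g x\<bar>)"
      using square_integrable_imp_integrable[OF g] by auto
    have "\<bar>\<phi> n x\<bar> \<le> 16" for n x
      using ramp_bounded[of "(x - a) / e n"] ramp_bounded[of "(x - b) / e n"]
      unfolding \<phi>_def by linarith
    then have "\<bar>g x\<bar> * \<bar>\<phi> n x\<bar> \<le> \<bar>g x\<bar> * 16" for n x by (intro mult_left_mono) auto
    then show "AE x in Leb. norm (g x * \<phi> n x) \<le> 16 * \<bar>g x\<bar>" for n
      by (simp add: abs_mult mult.commute)
    have lim: "(\<lambda>n. ramp ((x - c) / e n)) \<longlonglongrightarrow> (if x > c then 1 else 0)" for x c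
    proof (cases "x > c")
      case True
      then obtain N where N: "\<And>n. n \<ge> N \<Longrightarrow> e n < x - c"
        using LIMSEQ_D[OF elim, of "x - c"] e0 by fastforce
      have "ramp ((x - c) / e n) = 1" if "n \<ge> N" for n
        using N[OF that] e0[of n] by (intro ramp_simps) (simp add: field_simps)
      then have "\<forall>\<^sub>F n in sequentially. ramp ((x - c) / e n) = 1"
        unfolding eventually_sequentially by blast
      then show ?thesis using True by (simp add: tendsto_eventually)
    next
      case False
      then have "ramp ((x - c) / e n) = 0" for n
        using e0[of n] by (intro ramp_simps) (auto simp: field_simps)
      then show ?thesis using False by simp
    qed
    have "(\<lambda>n. \<phi> n x) \<longlonglongrightarrow> indicator {a<..b} x" for x
      using tendsto_diff[OF lim[of x a] lim[of x b]] ab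
      unfolding \<phi>_def by (auto simp: indicator_def split: if_splits)
    note [simp] = this
    show "AE x in Leb. (\<lambda>n. g x * \<phi> n x) \<longlonglongrightarrow> g x * indicator {a<..b} x"
      by (intro AE_I2 tendsto_mult tendsto_const) simp
  qed
  have "(\<lambda>n. - (LINT x|Leb. g x * \<phi> n x)) \<longlonglongrightarrow> u a - u b" using L by (simp add: eq)
  with tendsto_minus[OF R] have "u a - u b = - (LINT x|Leb. g x * indicator {a<..b} x)"
    using LIMSEQ_unique by blast
  then show ?thesis by simp
qed

lemma weak_deriv_integral:
  assumes u: "continuous_on {0..pi} u" and g: "square_integrable g" and w: "weak_deriv u g"
    and x: "x \<in> {0..pi}"
  shows "u x = u 0 + integral {0..x} g"
proof -
  have gi: "g integrable_on {0..pi}"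
    by (rule integrable_on_lebesgue_on[OF square_integrable_imp_integrable[OF g]]) auto
  define H where "H x = u x - integral {0..x} g" for x
  have cH: "continuous_on {0..pi} H"
    unfolding H_def by (intro continuous_intros u indefinite_integral_continuous_1 gi)
  have step: "H a = H b" if ab: "0 < a" "a < b" "b < pi" for a b
  proof -
    have "(LINT x|Leb. g x * indicator {a<..b} x) = (LINT x|Leb. (if x \<in> {a<..b} then g x else 0))"
      by (intro Bochner_Integration.integral_cong) auto
    also have "\<dots> = integral {0..pi} (\<lambda>x. if x \<in> {a<..b} then g x else 0)"
    proof (rule lebesgue_integral_eq_integral)
      have "integrable Leb (\<lambda>x. indicator {a<..b} x *\<^sub>R g x)"
        by (rule integrable_mult_indicator[OF _ square_integrable_imp_integrable[OF g]])
           (use ab in \<open>auto simp: sets_restrict_space_iff\<close>)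
      moreover have "(\<lambda>x. indicator {a<..b} x *\<^sub>R g x) = (\<lambda>x. if x \<in> {a<..b} then g x else 0)"
        by (auto simp: indicator_def)
      ultimately show "integrable Leb (\<lambda>x. if x \<in> {a<..b} then g x else 0)" by simp
    qed auto
    also have "\<dots> = integral {a<..b} g"
      using ab by (subst integral_restrict_Int) (auto intro!: arg_cong2[where f = integral])
    also have "\<dots> = integral {a..b} g"
      by (rule integral_spike_set) (auto intro: negligible_subset[of "{a}"])
    also have "\<dots> = integral {0..b} g - integral {0..a} g"
      using Henstock_Kurzweil_Integration.integral_combine[of 0 a b g] ab
        integrable_on_subinterval[OF gi, of 0 b] by simp
    finally show ?thesis
      using weak_deriv_interior[OF u g w ab] by (simp add: H_def)
  qed
  have const: "H y = H (pi / 2)" if "y \<in> {0<..<pi}" for y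
    using linorder_less_linear[of y "pi / 2"] step[of y "pi / 2"] step[of "pi / 2" y] that
    by (metis field_sum_of_halves greaterThanLessThan_iff half_gt_zero less_add_same_cancel1 pi_gt_zero)
  have "H x = H (pi / 2)" if "x \<in> {0..pi}" for x
  proof (rule continuous_constant_on_closure[of "{0<..<pi}" H "H (pi / 2)"])
    show "continuous_on (closure {0<..<pi}) H" "x \<in> closure {0<..<pi}"
      using cH that by auto
  qed (rule const)
  from this[of x] this[of 0] x show ?thesis by (simp add: H_def)
qed

lemma weak_deriv_diff_integral:
  assumes u: "continuous_on {0..pi} u" and g: "square_integrable g" and w: "weak_deriv u g"
    and xy: "0 \<le> x" "x \<le> y" "y \<le> pi"
  shows "u y - u x = integral {x..y} g"
proof -
  have gi: "g integrable_on {0..pi}"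
    by (rule integrable_on_lebesgue_on[OF square_integrable_imp_integrable[OF g]]) auto
  then have "g integrable_on {0..y}" by (rule integrable_on_subinterval) (use xy in auto)
  then have "integral {0..x} g + integral {x..y} g = integral {0..y} g"
    using xy by (intro Henstock_Kurzweil_Integration.integral_combine) auto
  then show ?thesis
    using weak_deriv_integral[OF u g w, of x] weak_deriv_integral[OF u g w, of y] xy by simp
qed

lemma weak_deriv_unique:
  assumes u: "continuous_on {0..pi} u"
    and f: "square_integrable f" "weak_deriv u f" and g: "square_integrable g" "weak_deriv u g"
  shows "AE x in Leb. f x = g x"
proof -
  have int: "h integrable_on {0..pi}" if "square_integrable h" for h
    by (rule integrable_on_lebesgue_on[OF square_integrable_imp_integrable[OF that]]) auto
  define k where "k x = (if x \<in> {0..pi} then f x - g x else 0)" for x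
  have "(\<lambda>x. f x - g x) integrable_on {0..pi}"
    by (intro integrable_diff int f g)
  then have "k integrable_on UNIV"
    unfolding k_def by (subst integrable_restrict_UNIV)
  then have "k integrable_on cbox a b" for a b
    by (rule integrable_on_subcbox) auto
  then obtain N where N: "negligible N"
      "\<And>x e. x \<notin> N \<Longrightarrow> 0 < e \<Longrightarrow> \<exists>d>0. \<forall>h. 0 < h \<and> h < d \<longrightarrow>
         norm (integral (cbox x (x + h *\<^sub>R One)) k /\<^sub>R h ^ DIM(real) - k x) < e"
    using integrable_ccontinuous_explicit[of k] by blast
  have zero: "integral {x..y} k = 0" if "0 \<le> x" "x \<le> y" "y \<le> pi" for x y
  proof -
    have sub: "h integrable_on {x..y}" if "square_integrable h" for h
      using int[OF that] \<open>0 \<le> x\<close> \<open>y \<le> pi\<close> by (auto intro: integrable_on_subinterval)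
    have "integral {x..y} k = integral {x..y} (\<lambda>x. f x - g x)"
      by (intro integral_cong) (use that in \<open>auto simp: k_def\<close>)
    also have "\<dots> = integral {x..y} f - integral {x..y} g"
      by (intro integral_diff sub f g)
    also have "\<dots> = 0"
      using weak_deriv_diff_integral[OF u f that] weak_deriv_diff_integral[OF u g that] by simp
    finally show ?thesis .
  qed
  have "f x = g x" if x: "x \<notin> N \<union> {pi}" "x \<in> {0..pi}" for x
  proof (rule ccontr)
    assume "f x \<noteq> g x"
    then have "\<bar>k x\<bar> > 0" using x by (simp add: k_def)
    have "\<exists>d>0. \<forall>h. 0 < h \<and> h < d \<longrightarrow>
         norm (integral (cbox x (x + h *\<^sub>R One)) k /\<^sub>R h ^ DIM(real) - k x) < \<bar>k x\<bar>"
      by (rule N(2)) (use x \<open>\<bar>k x\<bar> > 0\<close> in auto)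
    then obtain d where d: "d > 0"
      "\<And>h. 0 < h \<Longrightarrow> h < d \<Longrightarrow> norm (integral {x..x + h} k /\<^sub>R h - k x) < \<bar>k x\<bar>"
      by auto
    define h where "h = min (d / 2) (pi - x)"
    have "0 < h" "h < d" "x + h \<le> pi" using d(1) x by (auto simp: h_def)
    then show False using d(2)[of h] zero[of x "x + h"] x by auto
  qed
  then have "AE x in lebesgue. x \<in> {0..pi} \<longrightarrow> f x = g x"
    unfolding eventually_ae_filter_negligible
    by (intro exI[of _ "N \<union> {pi}"]) (use N(1) in auto)
  then show ?thesis
    by (subst AE_restrict_space_iff) auto
qed

section \<open>The Sobolev space \<open>H\<^sup>1(0,\<pi>)\<close>\<close>

text \<open>
  Elements of \<open>H\<^sup>1(0,\<pi>)\<close> are represented by their continuous representatives on \<open>[0,\<pi>]\<close>, so that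
  point values are meaningful. The value outside of the interval is fixed to be zero so that
  equality in the type is equality on \<open>[0,\<pi>]\<close>; it carries no boundary condition.
\<close>

typedef h1 = "{u :: real \<Rightarrow> real. continuous_on {0..pi} u \<and> (\<forall>x. x \<notin> {0..pi} \<longrightarrow> u x = 0) \<and>
                 (\<exists>g. square_integrable g \<and> weak_deriv u g)}"
  morphisms fn Abs_h1
proof
  show "(\<lambda>_. 0) \<in> {u :: real \<Rightarrow> real. continuous_on {0..pi} u \<and> (\<forall>x. x \<notin> {0..pi} \<longrightarrow> u x = 0) \<and>
                 (\<exists>g. square_integrable g \<and> weak_deriv u g)}"
    using square_integrable_const[of 0] by (auto simp: weak_deriv_def intro!: exI[of _ "\<lambda>_. 0"])
qed

setup_lifting type_definition_h1

text \<open>\<open>dx u\<close> is the weak derivative \<open>u\<^sub>x\<close>, which is unique up to null sets.\<close>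

definition dx :: "h1 \<Rightarrow> real \<Rightarrow> real" where
  "dx u = (SOME g. square_integrable g \<and> weak_deriv (fn u) g)"

lemma continuous_on_fn: "continuous_on {0..pi} (fn u)"
  using fn[of u] by simp

lemma fn_outside: "x \<notin> {0..pi} \<Longrightarrow> fn u x = 0"
  using fn[of u] by simp

lemma square_integrable_fn: "square_integrable (fn u)"
  by (rule square_integrable_continuous[OF continuous_on_fn])

lemma dx: "square_integrable (dx u)" "weak_deriv (fn u) (dx u)"
  using someI_ex[of "\<lambda>g. square_integrable g \<and> weak_deriv (fn u) g"] fn[of u]
  unfolding dx_def by auto

lemma AE_dx_eq:
  assumes "square_integrable g" "weak_deriv (fn u) g"
  shows "AE x in Leb. dx u x = g x"
  using weak_deriv_unique[OF continuous_on_fn dx assms] .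

lemma test_function_integrable:
  assumes "test_function \<phi>" "square_integrable f"
  shows "integrable Leb (\<lambda>x. f x * \<phi> x)" "integrable Leb (\<lambda>x. f x * deriv \<phi> x)"
proof -
  obtain D where D: "\<And>x. (\<phi> has_vector_derivative D x) (at x)" "continuous_on UNIV D"
    using assms(1) by (auto simp: test_function_def C1_differentiable_on_def)
  then have "deriv \<phi> = D"
    by (auto intro!: DERIV_imp_deriv simp: has_real_derivative_iff_has_vector_derivative)
  then have "continuous_on {0..pi} (deriv \<phi>)" using D(2) continuous_on_subset by blast
  moreover have "continuous_on {0..pi} \<phi>"
    using D(1) by (meson has_vector_derivative_continuous continuous_at_imp_continuous_on)
  ultimately show "integrable Leb (\<lambda>x. f x * \<phi> x)" "integrable Leb (\<lambda>x. f x * deriv \<phi> x)"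
    using assms(2) by (auto intro: square_integrable_mult square_integrable_continuous)
qed

lemma weak_deriv_add:
  assumes "weak_deriv u f" "weak_deriv v g"
    and "square_integrable u" "square_integrable v" "square_integrable f" "square_integrable g"
  shows "weak_deriv (\<lambda>x. u x + v x) (\<lambda>x. f x + g x)"
  unfolding weak_deriv_def
proof (intro allI impI)
  fix \<phi> assume t: "test_function \<phi>"
  note [simp] = test_function_integrable[OF t assms(3)] test_function_integrable[OF t assms(4)]
    test_function_integrable[OF t assms(5)] test_function_integrable[OF t assms(6)]
  show "(LINT x|Leb. (u x + v x) * deriv \<phi> x) = - (LINT x|Leb. (f x + g x) * \<phi> x)"
    using assms(1,2) t by (simp add: weak_deriv_def distrib_right)
qed

lemma weak_deriv_cmult:
  assumes "weak_deriv u f"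
  shows "weak_deriv (\<lambda>x. c * u x) (\<lambda>x. c * f x)"
  using assms by (simp add: weak_deriv_def mult.assoc)

instantiation h1 :: real_vector
begin

lift_definition zero_h1 :: h1 is "\<lambda>_. 0"
  using square_integrable_const[of 0] by (auto simp: weak_deriv_def intro!: exI[of _ "\<lambda>_. 0"])

lift_definition plus_h1 :: "h1 \<Rightarrow> h1 \<Rightarrow> h1" is "\<lambda>u v x. u x + v x"
proof safe
  fix u v f g :: "real \<Rightarrow> real"
  assume u: "continuous_on {0..pi} u" "square_integrable f" "weak_deriv u f"
    and v: "continuous_on {0..pi} v" "square_integrable g" "weak_deriv v g"
  show "continuous_on {0..pi} (\<lambda>x. u x + v x)" by (intro continuous_on_add u v)
  show "\<exists>h. square_integrable h \<and> weak_deriv (\<lambda>x. u x + v x) h"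
    by (intro exI[of _ "\<lambda>x. f x + g x"] conjI square_integrable_add weak_deriv_add
        square_integrable_continuous u v)
qed auto

lift_definition scaleR_h1 :: "real \<Rightarrow> h1 \<Rightarrow> h1" is "\<lambda>c u x. c * u x"
proof safe
  fix c and u f :: "real \<Rightarrow> real"
  assume u: "continuous_on {0..pi} u" "square_integrable f" "weak_deriv u f"
  show "continuous_on {0..pi} (\<lambda>x. c * u x)" by (intro continuous_on_mult_left u)
  show "\<exists>h. square_integrable h \<and> weak_deriv (\<lambda>x. c * u x) h"
    by (intro exI[of _ "\<lambda>x. c * f x"] conjI square_integrable_cmult weak_deriv_cmult u)
qed auto

definition "- u = (-1) *\<^sub>R (u :: h1)"
definition "u - v = u + - (v :: h1)"

instance
  by standard (simp_all add: fn_inject[symmetric] fun_eq_iff zero_h1.rep_eq plus_h1.rep_eq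
      scaleR_h1.rep_eq uminus_h1_def minus_h1_def algebra_simps)

end

lemma fn_zero [simp]: "fn 0 x = 0"
  and fn_add [simp]: "fn (u + v) x = fn u x + fn v x"
  and fn_scaleR [simp]: "fn (c *\<^sub>R u) x = c * fn u x"
  by (transfer; simp)+

lemma AE_dx_add: "AE x in Leb. dx (u + v) x = dx u x + dx v x"
proof (rule AE_dx_eq)
  show "square_integrable (\<lambda>x. dx u x + dx v x)" by (intro square_integrable_add dx)
  show "weak_deriv (fn (u + v)) (\<lambda>x. dx u x + dx v x)"
    using weak_deriv_add[OF dx(2) dx(2) square_integrable_fn square_integrable_fn dx(1) dx(1), of u v]
    by (simp add: weak_deriv_def)
qed

lemma AE_dx_scaleR: "AE x in Leb. dx (c *\<^sub>R u) x = c * dx u x"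
proof (rule AE_dx_eq)
  show "square_integrable (\<lambda>x. c * dx u x)" by (intro square_integrable_cmult dx)
  show "weak_deriv (fn (c *\<^sub>R u)) (\<lambda>x. c * dx u x)"
    using weak_deriv_cmult[OF dx(2), of c u] by (simp add: weak_deriv_def)
qed

definition l2_inner :: "(real \<Rightarrow> real) \<Rightarrow> (real \<Rightarrow> real) \<Rightarrow> real" where
  "l2_inner f g = (LINT x|Leb. f x * g x)"

lemma l2_inner_commute: "l2_inner f g = l2_inner g f"
  by (simp add: l2_inner_def mult.commute)

lemma l2_inner_fn:
  "l2_inner (fn (u + v)) (fn w) = l2_inner (fn u) (fn w) + l2_inner (fn v) (fn w)"
  "l2_inner (fn (c *\<^sub>R u)) (fn w) = c * l2_inner (fn u) (fn w)"
  by (simp_all add: l2_inner_def distrib_right mult.assoc square_integrable_mult square_integrable_fn)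

lemma l2_inner_dx:
  "l2_inner (dx (u + v)) (dx w) = l2_inner (dx u) (dx w) + l2_inner (dx v) (dx w)"
  "l2_inner (dx (c *\<^sub>R u)) (dx w) = c * l2_inner (dx u) (dx w)"
proof -
  note [simp] = square_integrable_mult[OF dx(1) dx(1)]
  have m: "integrable Leb f \<Longrightarrow> f \<in> borel_measurable Leb" for f :: "real \<Rightarrow> real"
    by (rule borel_measurable_integrable)
  have "l2_inner (dx (u + v)) (dx w) = (LINT x|Leb. dx u x * dx w x + dx v x * dx w x)"
    unfolding l2_inner_def
    by (rule integral_cong_AE)
       (use AE_dx_add[of u v] in \<open>auto intro!: m simp: distrib_right elim!: eventually_mono\<close>)
  then show "l2_inner (dx (u + v)) (dx w) = l2_inner (dx u) (dx w) + l2_inner (dx v) (dx w)"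
    by (simp add: l2_inner_def)
  have "l2_inner (dx (c *\<^sub>R u)) (dx w) = (LINT x|Leb. c * (dx u x * dx w x))"
    unfolding l2_inner_def
    by (rule integral_cong_AE)
       (use AE_dx_scaleR[of c u] in \<open>auto intro!: m simp: mult.assoc elim!: eventually_mono\<close>)
  then show "l2_inner (dx (c *\<^sub>R u)) (dx w) = c * l2_inner (dx u) (dx w)"
    by (simp add: l2_inner_def)
qed

lemma l2_inner_nonneg: "0 \<le> l2_inner f f"
  unfolding l2_inner_def by (auto intro: integral_nonneg_AE)

lemma fn_eq_zero:
  assumes "l2_inner (fn u) (fn u) = 0"
  shows "u = 0"
proof -
  have c: "continuous_on {0..pi} (\<lambda>x. fn u x * fn u x)"
    by (intro continuous_intros continuous_on_fn)
  have "((\<lambda>x. fn u x * fn u x) has_integral (LINT x|Leb. fn u x * fn u x)) {0..pi}"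
    by (rule has_integral_integral_lebesgue_on[OF continuous_imp_integrable_real[OF c]]) auto
  then have "((\<lambda>x. fn u x * fn u x) has_integral 0) (cbox 0 pi)"
    using assms by (simp add: l2_inner_def)
  moreover have "pi \<le> 0 \<Longrightarrow> False"
    using pi_gt_zero by linarith
  ultimately have "fn u x * fn u x = 0" if "x \<in> {0..pi}" for x
    by (intro has_integral_0_cbox_imp_0[of 0 pi "\<lambda>x. fn u x * fn u x"]) (use c that in auto)
  then have "fn u x = fn 0 x" for x
    using fn_outside[of x u] by (cases "x \<in> {0..pi}") auto
  then show ?thesis by (metis ext fn_inject)
qed

instantiation h1 :: real_inner
begin

definition inner_h1 :: "h1 \<Rightarrow> h1 \<Rightarrow> real" where
  "inner_h1 u v = l2_inner (fn u) (fn v) + l2_inner (dx u) (dx v)"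

definition norm_h1 :: "h1 \<Rightarrow> real" where
  "norm_h1 u = sqrt (inner u u)"

definition sgn_h1 :: "h1 \<Rightarrow> h1" where
  "sgn_h1 u = u /\<^sub>R norm u"

definition dist_h1 :: "h1 \<Rightarrow> h1 \<Rightarrow> real" where
  "dist_h1 u v = norm (u - v)"

definition uniformity_h1 :: "(h1 \<times> h1) filter" where
  "uniformity_h1 = (INF e\<in>{0<..}. principal {(u, v). dist u v < e})"

definition open_h1 :: "h1 set \<Rightarrow> bool" where
  "open_h1 U \<longleftrightarrow> (\<forall>u\<in>U. eventually (\<lambda>(u', v). u' = u \<longrightarrow> v \<in> U) uniformity)"

instance
proof
  fix u v w :: h1 and c :: real
  show "inner u v = inner v u" by (simp add: inner_h1_def l2_inner_commute)
  show "inner (u + v) w = inner u w + inner v w" by (simp add: inner_h1_def l2_inner_fn l2_inner_dx)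
  show "inner (c *\<^sub>R u) v = c * inner u v"
    by (simp add: inner_h1_def l2_inner_fn l2_inner_dx distrib_left)
  show "0 \<le> inner u u" by (simp add: inner_h1_def l2_inner_nonneg)
  show "inner u u = 0 \<longleftrightarrow> u = 0"
  proof
    assume "inner u u = 0"
    then show "u = 0"
      using l2_inner_nonneg[of "fn u"] l2_inner_nonneg[of "dx u"]
      by (intro fn_eq_zero) (simp add: inner_h1_def)
  next
    assume "u = 0"
    then show "inner u u = 0"
      using l2_inner_fn(2)[of 0 u u] l2_inner_dx(2)[of 0 u u] by (simp add: inner_h1_def)
  qed
qed (simp_all only: norm_h1_def sgn_h1_def dist_h1_def uniformity_h1_def open_h1_def)

end

lemma l2_inner_le_norm:
  "\<bar>l2_inner (fn u) (fn v)\<bar> \<le> norm u * norm v"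
  "\<bar>l2_inner (dx u) (dx v)\<bar> \<le> norm u * norm v"
proof -
  have 1: "sqrt (LINT x|Leb. (fn u x)\<^sup>2) \<le> norm u" "sqrt (LINT x|Leb. (dx u x)\<^sup>2) \<le> norm u" for u
    using l2_inner_nonneg[of "fn u"] l2_inner_nonneg[of "dx u"]
    by (auto simp: norm_h1_def inner_h1_def l2_inner_def power2_eq_square)
  have 2: "0 \<le> sqrt (LINT x|Leb. (f x)\<^sup>2)" for f :: "real \<Rightarrow> real"
    by (auto intro: integral_nonneg_AE)
  show "\<bar>l2_inner (fn u) (fn v)\<bar> \<le> norm u * norm v"
    unfolding l2_inner_def
    by (rule order_trans[OF integral_Cauchy_Schwarz]) (auto intro!: mult_mono 1 2 square_integrable_fn)
  show "\<bar>l2_inner (dx u) (dx v)\<bar> \<le> norm u * norm v"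
    unfolding l2_inner_def
    by (rule order_trans[OF integral_Cauchy_Schwarz]) (auto intro!: mult_mono 1 2 dx)
qed

lemma point_evaluation_bound:
  assumes y: "y \<in> {0..pi}"
  shows "\<bar>fn u y\<bar> \<le> (1 / sqrt pi + sqrt pi) * norm u"
proof -
  define G where "G = (LINT x|Leb. \<bar>dx u x\<bar>)"
  have abs: "square_integrable (\<lambda>x. \<bar>f x\<bar>)" if "square_integrable f" for f
    using that by (auto simp: square_integrable_def)
  have one: "(LINT x|Leb. (1::real)\<^sup>2) = pi"
    by (simp add: measure_restrict_space)
  have L1: "(LINT x|Leb. \<bar>f x\<bar>) \<le> sqrt (LINT x|Leb. (f x)\<^sup>2) * sqrt pi" if "square_integrable f" for f
    using integral_Cauchy_Schwarz[OF abs[OF that] square_integrable_const[of 1]] one by simp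
  have le: "sqrt (LINT x|Leb. (fn u x)\<^sup>2) \<le> norm u" "sqrt (LINT x|Leb. (dx u x)\<^sup>2) \<le> norm u"
    using l2_inner_nonneg[of "fn u"] l2_inner_nonneg[of "dx u"]
    by (auto simp: norm_h1_def inner_h1_def l2_inner_def power2_eq_square)
  have G: "G \<le> norm u * sqrt pi"
    unfolding G_def by (rule order_trans[OF L1[OF dx(1)]]) (use le in \<open>auto intro: mult_right_mono\<close>)
  have Gi: "\<bar>integral {s..t} (dx u)\<bar> \<le> G" if "0 \<le> s" "s \<le> t" "t \<le> pi" for s t
  proof -
    have i: "dx u integrable_on {0..pi}" "(\<lambda>x. \<bar>dx u x\<bar>) integrable_on {0..pi}"
      using square_integrable_imp_integrable[OF dx(1), of u]
      by (auto intro!: integrable_on_lebesgue_on)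
    have j: "dx u integrable_on {s..t}" "(\<lambda>x. \<bar>dx u x\<bar>) integrable_on {s..t}"
      using i that by (auto intro: integrable_on_subinterval)
    have "\<bar>integral {s..t} (dx u)\<bar> \<le> integral {s..t} (\<lambda>x. \<bar>dx u x\<bar>)"
      using integral_norm_bound_integral[OF j] by simp
    also have "\<dots> \<le> integral {0..pi} (\<lambda>x. \<bar>dx u x\<bar>)"
      by (rule integral_subset_le) (use i j that in auto)
    also have "\<dots> = G"
      unfolding G_def
      by (rule lebesgue_integral_eq_integral[symmetric])
         (use square_integrable_imp_integrable[OF dx(1), of u] in auto)
    finally show ?thesis .
  qed
  have "\<bar>fn u y\<bar> \<le> \<bar>fn u x\<bar> + G" if x: "x \<in> {0..pi}" for x
  proof (cases "x \<le> y")
    case True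
    then show ?thesis
      using weak_deriv_diff_integral[OF continuous_on_fn dx, of x y u] Gi[of x y] x y by auto
  next
    case False
    then show ?thesis
      using weak_deriv_diff_integral[OF continuous_on_fn dx, of y x u] Gi[of y x] x y by auto
  qed
  then have "(LINT x|Leb. \<bar>fn u y\<bar>) \<le> (LINT x|Leb. \<bar>fn u x\<bar> + G)"
    using finite_measure.integrable_const[OF finite_measure_Leb]
      square_integrable_imp_integrable[OF square_integrable_fn, of u]
    by (intro integral_mono) auto
  also have "\<dots> = (LINT x|Leb. \<bar>fn u x\<bar>) + pi * G"
    using finite_measure.integrable_const[OF finite_measure_Leb]
      square_integrable_imp_integrable[OF square_integrable_fn, of u] one
    by simp
  also have "\<dots> \<le> norm u * sqrt pi + pi * (norm u * sqrt pi)"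
    using order_trans[OF L1[OF square_integrable_fn] mult_right_mono[OF le(1)]] G
    by (intro add_mono mult_left_mono) auto
  finally have "pi * \<bar>fn u y\<bar> \<le> norm u * sqrt pi + pi * (norm u * sqrt pi)"
    using one by simp
  also have "norm u * sqrt pi + pi * (norm u * sqrt pi) = norm u * (pi / sqrt pi) + pi * (norm u * sqrt pi)"
    by (simp add: real_div_sqrt)
  also have "\<dots> = pi * ((1 / sqrt pi + sqrt pi) * norm u)"
    by (simp add: algebra_simps)
  finally have "pi * \<bar>fn u y\<bar> \<le> pi * ((1 / sqrt pi + sqrt pi) * norm u)" .
  then show ?thesis by simp
qed

section \<open>The dual space and the Neumann operator\<close>

type_synonym hm1 = "h1 \<Rightarrow>\<^sub>L real"

lemma bounded_linear_l2_inner: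
  "bounded_linear (\<lambda>v. l2_inner (fn u) (fn v))"
  "bounded_linear (\<lambda>v. l2_inner (dx u) (dx v))"
proof -
  show "bounded_linear (\<lambda>v. l2_inner (fn u) (fn v))"
    by (rule bounded_linear_intro[where K = "norm u"])
       (use l2_inner_le_norm(1)[of u] in \<open>auto simp: l2_inner_fn l2_inner_commute[of "fn u"] mult.commute\<close>)
  show "bounded_linear (\<lambda>v. l2_inner (dx u) (dx v))"
    by (rule bounded_linear_intro[where K = "norm u"])
       (use l2_inner_le_norm(2)[of u] in \<open>auto simp: l2_inner_dx l2_inner_commute[of "dx u"] mult.commute\<close>)
qed

text \<open>
  \<open>H\<^sup>1\<close> is a subspace of its dual via the pivot space \<open>L\<^sup>2(0,\<pi>)\<close>: \<open>u\<close> acts as \<open>v \<mapsto> \<integral> u v\<close>.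
\<close>

lift_definition embed :: "h1 \<Rightarrow> hm1" is "\<lambda>u v. LINT x|Leb. fn u x * fn v x"
  using bounded_linear_l2_inner(1) by (simp add: l2_inner_def)

lift_definition A_N :: "h1 \<Rightarrow> hm1" is "\<lambda>u v. LINT x|Leb. dx u x * dx v x"
  using bounded_linear_l2_inner(2) by (simp add: l2_inner_def)

lift_definition delta0 :: hm1 is "\<lambda>v. fn v 0"
  by (rule bounded_linear_intro[where K = "1 / sqrt pi + sqrt pi"])
     (use point_evaluation_bound[of 0] in \<open>auto simp: mult.commute\<close>)

lemma inj_embed: "inj embed"
proof (rule injI)
  fix u v assume "embed u = embed v"
  then have "blinfun_apply (embed u) (u - v) = blinfun_apply (embed v) (u - v)" by simp
  then have "l2_inner (fn u) (fn (u - v)) = l2_inner (fn v) (fn (u - v))"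
    by (simp add: embed.rep_eq l2_inner_def)
  then have "l2_inner (fn (u + (-1) *\<^sub>R v)) (fn (u - v)) = 0"
    by (simp only: l2_inner_fn)
  then have "u - v = 0" by (intro fn_eq_zero) simp
  then show "u = v" by simp
qed

text \<open>
  \<open>point_value \<psi> x\<close> is \<open>\<psi>(x)\<close> for \<open>\<psi>\<close> in the range of \<open>embed\<close>, that is for \<open>\<psi> \<in> H\<^sup>1\<close>, and
  unspecified for other functionals. For \<open>f_of\<close> and \<open>a_of\<close> below this means that \<open>f_of T u\<^sub>0 t\<close> is
  meaningful for \<open>t \<ge> 0\<close> and \<open>a_of T t\<close> only for \<open>t > 0\<close>, because \<open>\<delta>\<^sub>0 \<notin> H\<^sup>1\<close>.
\<close>

definition point_value :: "hm1 \<Rightarrow> real \<Rightarrow> real" where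
  "point_value \<psi> x = fn (inv embed \<psi>) x"

section \<open>Semigroups and their generators\<close>

definition strongly_continuous_semigroup :: "(real \<Rightarrow> 'a::banach \<Rightarrow>\<^sub>L 'a) \<Rightarrow> bool" where
  "strongly_continuous_semigroup T \<longleftrightarrow>
     T 0 = id_blinfun \<and>
     (\<forall>s\<ge>0. \<forall>t\<ge>0. T (s + t) = T s o\<^sub>L T t) \<and>
     (\<forall>x. ((\<lambda>t. T t x) \<longlongrightarrow> x) (at_right 0))"

text \<open>The generator as a graph: \<open>(x, y)\<close> belongs to it iff \<open>x\<close> is in the domain and is mapped to \<open>y\<close>.\<close>

definition generator :: "(real \<Rightarrow> 'a::banach \<Rightarrow>\<^sub>L 'a) \<Rightarrow> ('a \<times> 'a) set" where
  "generator T = {(x, y). ((\<lambda>h. (T h x - x) /\<^sub>R h) \<longlongrightarrow> y) (at_right 0)}"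

text \<open>
  A strongly continuous semigroup is determined by its generator, so \<open>generated_by_minus_A_N T\<close> says
  that \<open>T t\<close> is \<open>exp (- t A\<^sub>N)\<close> for all \<open>t \<ge> 0\<close>; the domain \<open>H\<^sup>1\<close> of \<open>A\<^sub>N\<close> is the range of \<open>embed\<close>.
\<close>

definition generated_by_minus_A_N :: "(real \<Rightarrow> hm1 \<Rightarrow>\<^sub>L hm1) \<Rightarrow> bool" where
  "generated_by_minus_A_N T \<longleftrightarrow>
     strongly_continuous_semigroup T \<and> generator T = {(embed u, - A_N u) | u. True}"

section \<open>The integral equation and the critical gain\<close>

definition f_of :: "(real \<Rightarrow> hm1 \<Rightarrow>\<^sub>L hm1) \<Rightarrow> h1 \<Rightarrow> real \<Rightarrow> real" where
  "f_of T u\<^sub>0 t = point_value (T t (embed u\<^sub>0)) pi"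

definition a_of :: "(real \<Rightarrow> hm1 \<Rightarrow>\<^sub>L hm1) \<Rightarrow> real \<Rightarrow> real" where
  "a_of T t = - point_value (T t delta0) pi"

definition g_of :: "real \<Rightarrow> real \<Rightarrow> real" where
  "g_of \<beta> w = tanh (\<beta> * w)"

definition char_fun :: "real \<Rightarrow> complex" where
  "char_fun \<omega> = csqrt (\<i> * \<omega>) * sin (csqrt (\<i> * \<omega>) * pi)"

text \<open>\<open>LEAST\<close> on the reals is the minimum, which is attained here.\<close>

definition omega0 :: real where
  "omega0 = (LEAST \<omega>. \<omega> > 0 \<and> char_fun \<omega> \<in> complex_of_real ` {0<..})"

definition beta0 :: real where
  "beta0 = Re (char_fun omega0)"

end

theory Submission
  imports Defs "HOL-Probability.Probability" "HOL-Real_Asymp.Real_Asymp"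
begin

text \<open>
  With \<open>w = tanh (\<beta> y)\<close> and \<open>k = - a\<close>, that is \<open>k(t) = (1/\<pi>) \<Sum>\<^sub>n (-1)\<^sup>n exp (- n\<^sup>2 t)\<close> with \<open>n\<close> ranging
  over the integers, the equation is \<open>y = f - k * w\<close>. The proof is Popov's stability criterion,
  carried out in the time domain.

  Since \<open>k\<close> tends to \<open>0\<close> at \<open>0\<close> and \<open>k'\<close> is integrable on \<open>(0,\<infinity>)\<close>, \<open>y\<close> is differentiable with
  \<open>y' = f' - k' * w\<close>. Multiplying \<open>y + q y'\<close> by \<open>w\<close> and integrating over \<open>(0,T)\<close> gives
  \<open>\<integral> w y + q \<integral> w y' + \<integral> w (k * w + q k' * w) = \<integral> w (f + q f')\<close>. Here \<open>w y \<ge> w\<^sup>2 / \<beta>\<close>, because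
  \<open>|tanh u| \<le> |u|\<close>, and \<open>\<integral> w y'\<close> is bounded below, because it is the increment of
  \<open>ln (cosh (\<beta> y)) / \<beta>\<close>, a nonnegative function of the bounded \<open>y\<close>. The quadratic form is at least
  \<open>(\<integral> w)\<^sup>2 / (2\<pi>) - (1 / \<beta>\<^sub>0) \<integral> w\<^sup>2\<close>, see \<open>popov_energy_inequality\<close>: the first term comes from
  the limit \<open>1/\<pi>\<close> of \<open>k\<close> at infinity, and the second one from the frequency condition
  \<open>Re ((1 + i\<omega>q) G(i\<omega>)) \<ge> - 1 / \<beta>\<^sub>0\<close> for the Laplace transform
  \<open>G(\<lambda>) = 1 / (\<surd>\<lambda> sinh (\<pi> \<surd>\<lambda>))\<close> of \<open>k\<close>. The right-hand side is \<open>b \<integral> w\<close> up to a bounded term,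
  where \<open>b\<close> is the limit of \<open>f\<close>, and \<open>b S - S\<^sup>2 / (2\<pi>)\<close> is bounded above. Hence
  \<open>(1/\<beta> - 1/\<beta>\<^sub>0) \<integral> w\<^sup>2\<close> is bounded uniformly in \<open>T\<close>. As \<open>w\<close> is Lipschitz continuous on \<open>[1,\<infinity>)\<close>, it
  tends to \<open>0\<close>, and so does \<open>y\<close>.

  The frequency condition is \<open>popov_inequality\<close>. In the variable \<open>z = \<pi> \<surd>(\<omega>/2)\<close> it says that a
  certain function is nonnegative, and this function is \<open>z\<^sup>3\<close> times a power series in \<open>x = z\<^sup>4\<close>. With
  the right \<open>q\<close> the series has a double zero at the point that belongs to \<open>\<omega>\<^sub>0\<close>, and all of its
  coefficients of order at least two are nonnegative. So it is convex for \<open>x \<ge> 0\<close> and lies above its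
  tangent at the double zero, which is the axis. This is why \<open>\<beta>\<^sub>0\<close>, the bound for the linear
  equation, also suffices for the nonlinear one.

  The semigroup enters only through \<open>a_of_series\<close> and \<open>f_of_series\<close>. The functions \<open>cos (n x)\<close> are
  eigenvectors of the generator, \<open>semigroup_eigenvector\<close> gives the action of the semigroup on them,
  and \<open>cosine_inversion\<close> together with Bessel's inequality expands \<open>\<delta>\<^sub>0\<close> and \<open>u\<^sub>0\<close> into series of
  them that converge in \<open>H\<^sup>-\<^sup>1\<close>. Applied to \<open>cosh (s x)\<close>, \<open>cosine_inversion\<close> also yields the
  partial fractions that identify \<open>G\<close>.
\<close>

section \<open>Two tools for integrals\<close>

lemma integrable_mult_bounded:
  fixes h g :: "'a \<Rightarrow> real"
  assumes h: "integrable M h" and g: "g \<in> borel_measurable M" and B: "\<And>x. x \<in> space M \<Longrightarrow> \<bar>g x\<bar> \<le> B"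
  shows "integrable M (\<lambda>x. h x * g x)"
proof (rule Bochner_Integration.integrable_bound)
  show "integrable M (\<lambda>x. B * h x)" using h by simp
  show "(\<lambda>x. h x * g x) \<in> borel_measurable M"
    using borel_measurable_integrable[OF h] g by (rule borel_measurable_times)
  show "AE x in M. norm (h x * g x) \<le> norm (B * h x)"
  proof (rule AE_I2)
    fix x assume "x \<in> space M"
    then have "\<bar>h x\<bar> * \<bar>g x\<bar> \<le> \<bar>h x\<bar> * \<bar>B\<bar>" using B[of x] by (intro mult_left_mono) auto
    then show "norm (h x * g x) \<le> norm (B * h x)" by (simp add: abs_mult mult.commute)
  qed
qed

text \<open>
  Several convolution identities below integrate a product of an integrable function of one variable
  and a bounded function of both, over a product of a finite and a \<open>\<sigma>\<close>-finite measure.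
\<close>

lemma Fubini_bounded_factor:
  fixes h :: "'b \<Rightarrow> real" and g :: "'a \<Rightarrow> 'b \<Rightarrow> real"
  assumes "finite_measure M" and "sigma_finite_measure N" and h: "integrable N h"
    and g: "(\<lambda>(x, r). g x r) \<in> borel_measurable (M \<Otimes>\<^sub>M N)" and B: "\<And>x r. \<bar>g x r\<bar> \<le> B"
  shows "(LINT x|M. LINT r|N. h r * g x r) = (LINT r|N. h r * (LINT x|M. g x r))"
proof -
  interpret M: finite_measure M by fact
  interpret N: sigma_finite_measure N by fact
  interpret pair_sigma_finite M N ..
  note [measurable] = g borel_measurable_integrable[OF h]
  have ir: "integrable N (\<lambda>r. h r * g x r)" if "x \<in> space M" for x
    by (rule integrable_mult_bounded[OF h _ B]) (use that in measurable)
  have "integrable (M \<Otimes>\<^sub>M N) (\<lambda>(x, r). h r * g x r)"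
  proof (rule Fubini_integrable)
    show "integrable M (\<lambda>x. LINT r|N. norm (case (x, r) of (x, r) \<Rightarrow> h r * g x r))"
    proof (rule M.integrable_const_bound)
      show "AE x in M. norm (LINT r|N. norm (case (x, r) of (x, r) \<Rightarrow> h r * g x r)) \<le> (LINT r|N. \<bar>B\<bar> * \<bar>h r\<bar>)"
      proof (rule AE_I2)
        fix x assume x: "x \<in> space M"
        have "norm (LINT r|N. \<bar>h r * g x r\<bar>) = (LINT r|N. \<bar>h r * g x r\<bar>)"
          by (simp add: integral_nonneg_AE)
        also have "\<dots> \<le> (LINT r|N. \<bar>B\<bar> * \<bar>h r\<bar>)"
        proof (rule integral_mono)
          fix r
          have "\<bar>h r\<bar> * \<bar>g x r\<bar> \<le> \<bar>h r\<bar> * \<bar>B\<bar>" using B[of x r] by (intro mult_left_mono) auto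
          then show "\<bar>h r * g x r\<bar> \<le> \<bar>B\<bar> * \<bar>h r\<bar>" by (simp add: abs_mult mult.commute)
        qed (use ir[OF x] h in auto)
        finally show "norm (LINT r|N. norm (case (x, r) of (x, r) \<Rightarrow> h r * g x r)) \<le> (LINT r|N. \<bar>B\<bar> * \<bar>h r\<bar>)" by simp
      qed
    qed measurable
    show "AE x in M. integrable N (\<lambda>y. case (x, y) of (x, r) \<Rightarrow> h r * g x r)"
      by (rule AE_I2) (use ir in simp)
  qed measurable
  then have "(LINT r|N. LINT x|M. h r * g x r) = (LINT x|M. LINT r|N. h r * g x r)"
    by (rule Fubini_integral)
  then show ?thesis by simp
qed

section \<open>Cosine series of continuous functions\<close>

text \<open>
  The reciprocals of the squared \<open>L\<^sup>2\<close> norms of \<open>cos (n x)\<close> on \<open>[0,\<pi>]\<close>.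
\<close>

definition cos_weight :: "nat \<Rightarrow> real" where
  "cos_weight n = (if n = 0 then 1 / pi else 2 / pi)"

definition cosine_coeff :: "(real \<Rightarrow> real) \<Rightarrow> nat \<Rightarrow> real" where
  "cosine_coeff v n = integral {0..pi} (\<lambda>x. v x * cos (real n * x))"

lemma cos_weight_pos: "cos_weight n > 0"
  by (simp add: cos_weight_def)

lemma cos_weight_le: "cos_weight n \<le> 1"
  using pi_ge_two by (simp add: cos_weight_def)

lemma has_integral_cos_int:
  "((\<lambda>x. cos (of_int j * x)) has_integral (if j = 0 then pi else 0)) {0..pi}"
proof (cases "j = 0")
  case True
  then show ?thesis
    using has_integral_const_real[of "1::real" 0 pi] by simp
next
  case False
  have "((\<lambda>x. cos (of_int j * x)) has_integral (sin (of_int j * pi) / of_int j - sin (of_int j * 0) / of_int j)) {0..pi}"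
    by (rule fundamental_theorem_of_calculus)
       (use False in \<open>auto simp: has_real_derivative_iff_has_vector_derivative[symmetric] intro!: derivative_eq_intros\<close>)
  moreover have "sin (of_int j * pi) = 0"
    by (metis sin_npi_int mult.commute)
  ultimately show ?thesis using False by simp
qed

lemma has_integral_cos_cos:
  "((\<lambda>x. cos (real n * x) * cos (real m * x)) has_integral (if n = m then 1 / cos_weight n else 0)) {0..pi}"
proof -
  have "((\<lambda>x. (cos (of_int (int n - int m) * x) + cos (of_int (int n + int m) * x)) / 2) has_integral
     ((if int n - int m = 0 then pi else 0) + (if int n + int m = 0 then pi else 0)) / 2) {0..pi}"
    by (intro has_integral_divide has_integral_add has_integral_cos_int)
  moreover have "(cos (of_int (int n - int m) * x) + cos (of_int (int n + int m) * x)) / 2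
      = cos (real n * x) * cos (real m * x)" for x
    using cos_times_cos[of "real n * x" "real m * x"] by (simp add: left_diff_distrib distrib_right)
  ultimately have "((\<lambda>x. cos (real n * x) * cos (real m * x)) has_integral
     ((if int n - int m = 0 then pi else 0) + (if int n + int m = 0 then pi else 0)) / 2) {0..pi}"
    by (simp only:)
  moreover have "((if int n - int m = 0 then pi else 0) + (if int n + int m = 0 then pi else 0)) / 2
      = (if n = m then 1 / cos_weight n else 0)"
    by (auto simp: cos_weight_def)
  ultimately show ?thesis by (simp only:)
qed

text \<open>
  Multiplication by \<open>cos x\<close> maps \<open>cos (n x)\<close> to the mean of its two neighbours, so orthogonality to
  all cosines is inherited by their products with powers of \<open>cos x\<close>.
\<close>

lemma cos_orthogonal_imp_power_orthogonal:
  assumes c: "continuous_on {0..pi} d" and z: "\<And>n. cosine_coeff d n = 0"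
  shows "integral {0..pi} (\<lambda>x. d x * cos (real n * x) * cos x ^ j) = 0"
proof (induction j arbitrary: n)
  case 0
  then show ?case using z[of n] by (simp add: cosine_coeff_def)
next
  case (Suc j)
  have i: "(\<lambda>x. d x * cos (real n * x) * cos x ^ j) integrable_on {0..pi}" for n
    by (intro integrable_continuous_real continuous_intros c)
  show ?case
  proof (cases n)
    case 0
    then show ?thesis using Suc[of 1] by (simp add: mult.assoc)
  next
    case (Suc m)
    have "d x * cos (real n * x) * cos x ^ Suc j =
       (d x * cos (real m * x) * cos x ^ j + d x * cos (real (Suc n) * x) * cos x ^ j) / 2" for x
    proof -
      have "cos (real n * x) * cos x = (cos (real n * x - x) + cos (real n * x + x)) / 2"
        by (rule cos_times_cos)
      also have "\<dots> = (cos (real m * x) + cos (real (Suc n) * x)) / 2"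
        using Suc by (simp add: algebra_simps)
      finally have *: "cos (real n * x) * cos x = (cos (real m * x) + cos (real (Suc n) * x)) / 2" .
      have "d x * cos (real n * x) * cos x ^ Suc j = d x * (cos (real n * x) * cos x) * cos x ^ j"
        by simp
      then show ?thesis unfolding * by (simp add: algebra_simps add_divide_distrib)
    qed
    then have "integral {0..pi} (\<lambda>x. d x * cos (real n * x) * cos x ^ Suc j) =
      (integral {0..pi} (\<lambda>x. d x * cos (real m * x) * cos x ^ j)
        + integral {0..pi} (\<lambda>x. d x * cos (real (Suc n) * x) * cos x ^ j)) / 2"
      by (simp only: integral_divide integral_add[OF i i])
    then show ?thesis by (simp only: Suc.IH add_0_left div_0)
  qed
qed

text \<open>
  Completeness of the cosines: by the Weierstrass theorem for \<open>d \<circ> arccos\<close>, \<open>d\<close> is a uniform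
  limit of polynomials in \<open>cos x\<close>, to all of which it is orthogonal.
\<close>

lemma cosine_coeff_zero_imp_zero:
  assumes c: "continuous_on {0..pi} d" and z: "\<And>n. cosine_coeff d n = 0" and x: "x \<in> {0..pi}"
  shows "d x = 0"
proof -
  have cc: "continuous_on {-1..1} (\<lambda>s. d (arccos s))"
    by (rule continuous_on_compose2[OF c continuous_on_arccos'])
       (auto intro: arccos_lbound arccos_ubound)
  define I where "I = integral {0..pi} (\<lambda>x. d x * d x)"
  define J where "J = integral {0..pi} (\<lambda>x. \<bar>d x\<bar>)"
  have J: "J \<ge> 0" unfolding J_def by (intro integral_nonneg integrable_continuous_real continuous_intros c) auto
  have bnd: "I \<le> e * J" if e: "e > 0" for e
  proof -
    obtain g where g: "real_polynomial_function g" "\<And>s. s \<in> {-1..1} \<Longrightarrow> \<bar>d (arccos s) - g s\<bar> < e"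
      using Stone_Weierstrass_real_polynomial_function[OF _ cc e] by auto
    then obtain a m where gs: "g = (\<lambda>s. \<Sum>i\<le>m. a i * s ^ i)"
      unfolding real_polynomial_function_iff_sum by auto
    have ig: "integral {0..pi} (\<lambda>x. d x * g (cos x)) = 0"
    proof -
      have "integral {0..pi} (\<lambda>x. d x * g (cos x)) = integral {0..pi} (\<lambda>x. \<Sum>i\<le>m. a i * (d x * cos (real 0 * x) * cos x ^ i))"
        by (simp add: gs sum_distrib_left algebra_simps)
      also have "\<dots> = (\<Sum>i\<le>m. integral {0..pi} (\<lambda>x. a i * (d x * cos (real 0 * x) * cos x ^ i)))"
        by (intro integral_sum integrable_continuous_real continuous_intros c) auto
      also have "\<dots> = (\<Sum>i\<le>m. a i * integral {0..pi} (\<lambda>x. d x * cos (real 0 * x) * cos x ^ i))"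
        by (intro sum.cong refl integral_mult_right)
      also have "\<dots> = 0"
        by (simp only: cos_orthogonal_imp_power_orthogonal[OF c z] mult_zero_right sum.neutral_const)
      finally show ?thesis .
    qed
    have cg: "continuous_on {0..pi} (\<lambda>x. g (cos x))"
      unfolding gs by (intro continuous_intros)
    have "I = integral {0..pi} (\<lambda>x. d x * d x - d x * g (cos x))"
      unfolding I_def
      by (subst integral_diff) (auto simp: ig intro!: integrable_continuous_real continuous_intros c cg)
    also have "\<dots> \<le> integral {0..pi} (\<lambda>x. e * \<bar>d x\<bar>)"
    proof (intro integral_le integrable_continuous_real continuous_intros c cg)
      fix x assume x: "x \<in> {0..pi}"
      have "\<bar>d x - g (cos x)\<bar> \<le> e"
        using g(2)[of "cos x"] x by (auto simp: arccos_cos)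
      then have "\<bar>d x\<bar> * \<bar>d x - g (cos x)\<bar> \<le> \<bar>d x\<bar> * e" by (intro mult_left_mono) auto
      then have "\<bar>d x * (d x - g (cos x))\<bar> \<le> e * \<bar>d x\<bar>" by (simp add: abs_mult mult.commute)
      then show "d x * d x - d x * g (cos x) \<le> e * \<bar>d x\<bar>" by (simp add: algebra_simps)
    qed
    also have "\<dots> = e * J" by (simp add: J_def)
    finally show ?thesis .
  qed
  have "I \<le> 0"
  proof (rule field_le_epsilon)
    fix e :: real assume "e > 0"
    then have "I \<le> e / (J + 1) * J" using J by (intro bnd) auto
    also have "\<dots> \<le> e" using \<open>e > 0\<close> J by (simp add: field_simps)
    finally show "I \<le> 0 + e" by simp
  qed
  moreover have "I \<ge> 0" unfolding I_def by (intro integral_nonneg integrable_continuous_real continuous_intros c) auto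
  ultimately have "I = 0" by simp
  have "((\<lambda>x. d x * d x) has_integral 0) (cbox 0 pi)"
    using integrable_integral[OF integrable_continuous_real, of 0 pi "\<lambda>x. d x * d x"] c \<open>I = 0\<close>
    unfolding I_def by (auto intro!: continuous_intros)
  moreover have "pi \<le> 0 \<Longrightarrow> False"
    using pi_gt_zero by linarith
  ultimately have "d x * d x = 0"
    by (intro has_integral_0_cbox_imp_0[of 0 pi "\<lambda>x. d x * d x"]) (use x c in \<open>auto intro!: continuous_intros\<close>)
  then show ?thesis by simp
qed

text \<open>
  The series converges uniformly to a continuous function with the same coefficients as \<open>v\<close>, and the
  difference vanishes by completeness.
\<close>

theorem cosine_inversion:
  assumes v: "continuous_on {0..pi} v" and s: "summable (\<lambda>n. \<bar>cosine_coeff v n\<bar>)" and x: "x \<in> {0..pi}"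
  shows "(\<lambda>n. cos_weight n * cosine_coeff v n * cos (real n * x)) sums v x"
proof -
  define t where "t n x = cos_weight n * cosine_coeff v n * cos (real n * x)" for n x
  define u where "u x = (\<Sum>n. t n x)" for x
  have tb: "norm (t n x) \<le> \<bar>cosine_coeff v n\<bar>" for n x
  proof -
    have "\<bar>cos_weight n\<bar> * \<bar>cosine_coeff v n\<bar> * \<bar>cos (real n * x)\<bar> \<le> 1 * \<bar>cosine_coeff v n\<bar> * 1"
      using cos_weight_pos[of n] cos_weight_le[of n] by (intro mult_mono) auto
    then show ?thesis by (simp add: t_def abs_mult)
  qed
  have ul: "uniform_limit S (\<lambda>n x. \<Sum>i<n. t i x) u sequentially" for S
    unfolding u_def by (rule Weierstrass_m_test[OF _ s]) (rule tb)
  have su: "(\<lambda>n. t n x) sums u x" for x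
    unfolding u_def by (intro summable_sums summable_comparison_test'[OF s]) (rule tb)
  have ct: "continuous_on S (t n)" for n S unfolding t_def by (intro continuous_intros)
  have cu: "continuous_on S u" for S
    by (rule uniform_limit_theorem[OF _ ul]) (auto intro!: always_eventually continuous_on_sum ct)
  have coeff: "cosine_coeff u m = cosine_coeff v m" for m
  proof -
    obtain I J where IJ: "\<And>n. ((\<lambda>x. (\<Sum>i<n. t i x) * cos (real m * x)) has_integral I n) {0..pi}"
      "((\<lambda>x. u x * cos (real m * x)) has_integral J) {0..pi}" "I \<longlonglongrightarrow> J"
    proof (rule uniform_limit_integral)
      show "uniform_limit {0..pi} (\<lambda>n x. (\<Sum>i<n. t i x) * cos (real m * x)) (\<lambda>x. u x * cos (real m * x)) sequentially"
      proof (rule uniform_lim_mult[OF ul uniform_limit_const])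
        have "compact (u ` {0..pi})" by (intro compact_continuous_image cu) auto
        then show "bounded (u ` {0..pi})" by (rule compact_imp_bounded)
        show "bounded ((\<lambda>x. cos (real m * x)) ` {0..pi})"
          by (auto simp: bounded_iff intro!: exI[of _ 1])
      qed
    qed (auto intro!: continuous_intros ct)
    then have "(\<lambda>n. integral {0..pi} (\<lambda>x. (\<Sum>i<n. t i x) * cos (real m * x))) \<longlonglongrightarrow> integral {0..pi} (\<lambda>x. u x * cos (real m * x))"
      by (simp only: integral_unique[OF IJ(1)] integral_unique[OF IJ(2)])
    moreover have "integral {0..pi} (\<lambda>x. (\<Sum>i<n. t i x) * cos (real m * x)) = cosine_coeff v m" if n: "n > m" for n
    proof -
      have "integral {0..pi} (\<lambda>x. (\<Sum>i<n. t i x) * cos (real m * x))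
        = integral {0..pi} (\<lambda>x. \<Sum>i<n. (cos_weight i * cosine_coeff v i) * (cos (real i * x) * cos (real m * x)))"
        by (simp add: t_def sum_distrib_right mult.assoc)
      also have "\<dots> = (\<Sum>i<n. (cos_weight i * cosine_coeff v i) * (if i = m then 1 / cos_weight i else 0))"
        by (intro integral_unique has_integral_sum has_integral_mult_right has_integral_cos_cos) auto
      also have "\<dots> = (\<Sum>i<n. if i = m then cosine_coeff v m else 0)"
        by (intro sum.cong refl) (use cos_weight_pos in \<open>simp add: less_imp_neq[symmetric]\<close>)
      also have "\<dots> = cosine_coeff v m" using n by simp
      finally show ?thesis .
    qed
    then have "(\<lambda>n. integral {0..pi} (\<lambda>x. (\<Sum>i<n. t i x) * cos (real m * x))) \<longlonglongrightarrow> cosine_coeff v m"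
      by (intro tendsto_eventually) (auto simp: eventually_sequentially intro!: exI[of _ "Suc m"])
    ultimately show ?thesis unfolding cosine_coeff_def by (rule LIMSEQ_unique)
  qed
  have "v x - u x = 0"
  proof (rule cosine_coeff_zero_imp_zero[OF _ _ x])
    show "continuous_on {0..pi} (\<lambda>x. v x - u x)" by (intro continuous_intros v cu)
    show "cosine_coeff (\<lambda>x. v x - u x) n = 0" for n
    proof -
      have "cosine_coeff (\<lambda>x. v x - u x) n = cosine_coeff v n - cosine_coeff u n"
        unfolding cosine_coeff_def
        by (subst integral_diff[symmetric]) (auto simp: algebra_simps intro!: integrable_continuous_real continuous_intros v cu)
      then show ?thesis by (simp add: coeff)
    qed
  qed
  then show ?thesis using su[of x] by (simp add: t_def)
qed

section \<open>Sobolev functions and cosine modes\<close>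

lemma LINT_eq_integral:
  fixes f :: "real \<Rightarrow> real"
  assumes "integrable Leb f"
  shows "(LINT x|Leb. f x) = integral {0..pi} f"
  by (rule lebesgue_integral_eq_integral[OF assms]) auto

lemma Leb_measurable_borel: "f \<in> borel_measurable borel \<Longrightarrow> f \<in> borel_measurable Leb"
  for f :: "real \<Rightarrow> real"
  by (intro measurable_restrict_space1 measurable_completion) simp

lemma continuous_imp_integrable_Leb: "continuous_on UNIV f \<Longrightarrow> integrable Leb f"
  for f :: "real \<Rightarrow> real"
  by (rule continuous_imp_integrable_real[OF continuous_on_subset]) auto

lemma sigma_finite_Leb: "sigma_finite_measure Leb"
proof -
  interpret finite_measure Leb by (rule finite_measure_Leb)
  show ?thesis by unfold_locales
qed

lemma integral_dx:
  assumes s: "s \<in> {0..pi}"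
  shows "(LINT x|Leb. dx v x * indicator {s..} x) = fn v pi - fn v s"
proof -
  have gi: "integrable Leb (dx v)" by (rule square_integrable_imp_integrable[OF dx(1)])
  have 1: "integrable Leb (\<lambda>x. dx v x * indicator {s..} x)"
    by (rule integrable_mult_bounded[OF gi, of _ 1]) (auto intro!: Leb_measurable_borel)
  have "(LINT x|Leb. dx v x * indicator {s..} x) = integral {0..pi} (\<lambda>x. if x \<in> {s..} then dx v x else 0)"
    unfolding LINT_eq_integral[OF 1] by (intro integral_cong) (auto simp: indicator_def)
  also have "\<dots> = integral ({s..} \<inter> {0..pi}) (dx v)" by (rule integral_restrict_Int)
  also have "{s..} \<inter> {0..pi} = {s..pi}" using s by auto
  also have "integral {s..pi} (dx v) = fn v pi - fn v s"
    using weak_deriv_diff_integral[OF continuous_on_fn dx, of s pi v] s by simp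
  finally show ?thesis .
qed

text \<open>
  The weak derivative is defined by test functions with compact support in \<open>(0,\<pi>)\<close>. Boundary terms
  are obtained by writing \<open>\<psi>\<close> as the integral of \<open>\<psi>'\<close>, exchanging the integrals, and using the
  fundamental theorem for \<open>dx v\<close>.
\<close>

lemma h1_integration_by_parts:
  assumes \<psi>: "\<And>x. (\<psi> has_real_derivative \<psi>' x) (at x)" and c: "continuous_on UNIV \<psi>'" and B: "\<And>x. \<bar>\<psi>' x\<bar> \<le> B"
  shows "(LINT x|Leb. dx v x * \<psi> x) = fn v pi * \<psi> pi - fn v 0 * \<psi> 0 - (LINT x|Leb. fn v x * \<psi>' x)"
proof -
  have gi: "integrable Leb (dx v)" by (rule square_integrable_imp_integrable[OF dx(1)])
  have m': "\<psi>' \<in> borel_measurable borel" using c by (rule borel_measurable_continuous_onI)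
  note ci = continuous_imp_integrable_Leb
  have c\<psi>: "continuous_on UNIV \<psi>" using \<psi> by (meson DERIV_continuous_on has_field_derivative_at_within)
  have cfn: "integrable Leb (\<lambda>x. fn v x * \<psi>' x)"
    by (intro continuous_imp_integrable_real continuous_intros continuous_on_fn continuous_on_subset[OF c]) auto
  have \<psi>_eq: "\<psi> x = \<psi> 0 + (LINT s|Leb. \<psi>' s * indicator {..x} s)" if x: "x \<in> {0..pi}" for x
  proof -
    have 1: "integrable Leb (\<lambda>s. \<psi>' s * indicator {..x} s)"
      by (rule integrable_mult_bounded[OF ci[OF c], of _ 1]) (auto intro!: Leb_measurable_borel)
    have "(LINT s|Leb. \<psi>' s * indicator {..x} s) = integral {0..pi} (\<lambda>s. if s \<in> {..x} then \<psi>' s else 0)"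
      unfolding LINT_eq_integral[OF 1] by (intro integral_cong) (auto simp: indicator_def)
    also have "\<dots> = integral ({..x} \<inter> {0..pi}) \<psi>'" by (rule integral_restrict_Int)
    also have "{..x} \<inter> {0..pi} = {0..x}" using x by auto
    also have "integral {0..x} \<psi>' = \<psi> x - \<psi> 0"
      by (intro integral_unique fundamental_theorem_of_calculus)
         (use x \<psi> in \<open>auto simp: has_real_derivative_iff_has_vector_derivative[symmetric] intro: has_field_derivative_at_within\<close>)
    finally show ?thesis by simp
  qed
  have mm: "(\<lambda>(s, x). \<psi>' s * indicator {..x} s) \<in> borel_measurable (Leb \<Otimes>\<^sub>M Leb)"
  proof -
    have 1: "(\<lambda>(s, x). \<psi>' s * indicator {..x} s) \<in> borel_measurable (borel \<Otimes>\<^sub>M borel)"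
    proof -
      have "(\<lambda>(s, x). \<psi>' s * indicator {..x} s) = (\<lambda>(s, x). \<psi>' s * (if s \<le> x then 1 else 0))"
        by (auto simp: indicator_def)
      moreover note m'[measurable]
      ultimately show ?thesis by simp
    qed
    have 2: "(\<lambda>p. p) \<in> Leb \<Otimes>\<^sub>M Leb \<rightarrow>\<^sub>M borel \<Otimes>\<^sub>M borel"
      using Leb_measurable_borel[of "\<lambda>x. x"]
      by (subst measurable_pair_iff) (auto simp: comp_def intro: measurable_compose[OF measurable_fst] measurable_compose[OF measurable_snd])
    show ?thesis by (rule measurable_compose[OF 2 1])
  qed
  have bb: "\<bar>\<psi>' s * indicator {..x} s\<bar> \<le> B" for s x
    using B[of s] by (cases "s \<le> x") auto
  have "(LINT x|Leb. dx v x * (\<psi> x - \<psi> 0)) = (LINT x|Leb. dx v x * (LINT s|Leb. \<psi>' s * indicator {..x} s))"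
  proof (intro Bochner_Integration.integral_cong refl)
    fix x assume "x \<in> space Leb"
    then have "x \<in> {0..pi}" by simp
    then have "\<psi> x - \<psi> 0 = (LINT s|Leb. \<psi>' s * indicator {..x} s)" by (subst \<psi>_eq) simp_all
    then show "dx v x * (\<psi> x - \<psi> 0) = dx v x * (LINT s|Leb. \<psi>' s * indicator {..x} s)" by (simp only:)
  qed
  also have "\<dots> = (LINT s|Leb. LINT x|Leb. dx v x * (\<psi>' s * indicator {..x} s))"
    by (rule Fubini_bounded_factor[OF finite_measure_Leb sigma_finite_Leb gi mm bb, symmetric])
  also have "\<dots> = (LINT s|Leb. \<psi>' s * (LINT x|Leb. dx v x * indicator {s..} x))"
  proof (intro Bochner_Integration.integral_cong refl)
    fix s
    have "(LINT x|Leb. dx v x * (\<psi>' s * indicator {..x} s)) = (LINT x|Leb. \<psi>' s * (dx v x * indicator {s..} x))"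
      by (intro Bochner_Integration.integral_cong refl) (auto simp: indicator_def)
    then show "(LINT x|Leb. dx v x * (\<psi>' s * indicator {..x} s)) = \<psi>' s * (LINT x|Leb. dx v x * indicator {s..} x)"
      by simp
  qed
  also have "\<dots> = (LINT s|Leb. fn v pi * \<psi>' s - fn v s * \<psi>' s)"
    by (intro Bochner_Integration.integral_cong refl) (auto simp: integral_dx algebra_simps)
  also have "\<dots> = fn v pi * (LINT s|Leb. \<psi>' s) - (LINT s|Leb. fn v s * \<psi>' s)"
    using ci[OF c] cfn by simp
  also have "(LINT s|Leb. \<psi>' s) = \<psi> pi - \<psi> 0"
  proof -
    have "(LINT s|Leb. \<psi>' s) = integral {0..pi} \<psi>'" by (rule LINT_eq_integral[OF ci[OF c]])
    also have "\<dots> = \<psi> pi - \<psi> 0"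
      by (intro integral_unique fundamental_theorem_of_calculus)
         (use \<psi> in \<open>auto simp: has_real_derivative_iff_has_vector_derivative[symmetric] intro: has_field_derivative_at_within\<close>)
    finally show ?thesis .
  qed
  finally have 1: "(LINT x|Leb. dx v x * (\<psi> x - \<psi> 0)) = fn v pi * (\<psi> pi - \<psi> 0) - (LINT s|Leb. fn v s * \<psi>' s)" .
  have I: "(LINT x|Leb. dx v x) = fn v pi - fn v 0"
    using weak_deriv_diff_integral[OF continuous_on_fn dx, of 0 pi v] LINT_eq_integral[OF gi] by simp
  have "integrable Leb (\<lambda>x. dx v x * \<psi> x)"
    by (rule square_integrable_mult[OF dx(1) square_integrable_continuous[OF continuous_on_subset[OF c\<psi>]]]) auto
  then have "(LINT x|Leb. dx v x * (\<psi> x - \<psi> 0)) = (LINT x|Leb. dx v x * \<psi> x) - (fn v pi - fn v 0) * \<psi> 0"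
    using gi by (simp add: right_diff_distrib I)
  with 1 show ?thesis by (simp add: algebra_simps)
qed

lemma weak_deriv_C1:
  assumes u: "\<And>x. (u has_real_derivative u' x) (at x)" and c: "continuous_on UNIV u'"
    and v: "\<And>x. x \<in> {0..pi} \<Longrightarrow> v x = u x"
  shows "weak_deriv v u'"
  unfolding weak_deriv_def
proof (intro allI impI)
  fix \<phi> assume t: "test_function \<phi>"
  obtain D where D: "\<And>x. (\<phi> has_vector_derivative D x) (at x)" "continuous_on UNIV D"
    using t by (auto simp: test_function_def C1_differentiable_on_def)
  then have dD: "deriv \<phi> = D" and hD: "\<And>x. (\<phi> has_real_derivative D x) (at x)"
    by (auto intro!: DERIV_imp_deriv simp: has_real_derivative_iff_has_vector_derivative)
  have "closure {x. \<phi> x \<noteq> 0} \<subseteq> {0<..<pi}" using t by (simp add: test_function_def)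
  then have "{x. \<phi> x \<noteq> 0} \<subseteq> {0<..<pi}" by (rule subset_trans[OF closure_subset])
  then have z: "\<phi> 0 = 0" "\<phi> pi = 0" by auto
  have cu: "continuous_on UNIV u" using u by (meson DERIV_continuous_on has_field_derivative_at_within)
  have cp: "continuous_on UNIV \<phi>" using hD by (meson DERIV_continuous_on has_field_derivative_at_within)
  have i: "integrable Leb (\<lambda>x. u x * D x)" "integrable Leb (\<lambda>x. u' x * \<phi> x)"
    by (intro continuous_imp_integrable_Leb continuous_on_mult cu c cp D(2))+
  have "(LINT x|Leb. u x * D x) + (LINT x|Leb. u' x * \<phi> x) = (LINT x|Leb. u x * D x + u' x * \<phi> x)"
    using i by simp
  also have "\<dots> = integral {0..pi} (\<lambda>x. u x * D x + u' x * \<phi> x)"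
    using i by (intro LINT_eq_integral) auto
  also have "\<dots> = u pi * \<phi> pi - u 0 * \<phi> 0"
  proof (intro integral_unique fundamental_theorem_of_calculus)
    fix x
    have "((\<lambda>x. u x * \<phi> x) has_real_derivative u x * D x + u' x * \<phi> x) (at x)"
      using DERIV_mult[OF u hD] by (simp add: algebra_simps)
    then show "((\<lambda>x. u x * \<phi> x) has_vector_derivative u x * D x + u' x * \<phi> x) (at x within {0..pi})"
      by (auto simp: has_real_derivative_iff_has_vector_derivative[symmetric] intro: has_field_derivative_at_within)
  qed simp
  finally have "(LINT x|Leb. u x * D x) = - (LINT x|Leb. u' x * \<phi> x)" using z by simp
  moreover have "(LINT x|Leb. v x * D x) = (LINT x|Leb. u x * D x)"
    by (intro Bochner_Integration.integral_cong refl) (use v in auto)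
  ultimately show "(LINT x|Leb. v x * deriv \<phi> x) = - (LINT x|Leb. u' x * \<phi> x)"
    by (simp add: dD)
qed

definition h1_of :: "(real \<Rightarrow> real) \<Rightarrow> h1" where
  "h1_of u = Abs_h1 (\<lambda>x. if x \<in> {0..pi} then u x else 0)"

lemma h1_of:
  assumes u: "\<And>x. (u has_real_derivative u' x) (at x)" and c: "continuous_on UNIV u'"
  shows "x \<in> {0..pi} \<Longrightarrow> fn (h1_of u) x = u x" and "AE x in Leb. dx (h1_of u) x = u' x"
proof -
  let ?u = "\<lambda>x. if x \<in> {0..pi} then u x else 0"
  have cu: "continuous_on UNIV u" using u by (meson DERIV_continuous_on has_field_derivative_at_within)
  have s: "square_integrable u'" by (rule square_integrable_continuous[OF continuous_on_subset[OF c]]) simp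
  have w: "weak_deriv ?u u'" by (rule weak_deriv_C1[OF u c]) auto
  have "continuous_on {0..pi} ?u"
    by (rule continuous_on_eq[OF continuous_on_subset[OF cu]]) auto
  then have fn: "fn (h1_of u) = ?u"
    unfolding h1_of_def using s w by (intro Abs_h1_inverse) auto
  then show "x \<in> {0..pi} \<Longrightarrow> fn (h1_of u) x = u x" by simp
  show "AE x in Leb. dx (h1_of u) x = u' x"
    by (rule AE_dx_eq[OF s]) (simp only: fn w)
qed

definition cos_mode :: "nat \<Rightarrow> h1" where
  "cos_mode n = h1_of (\<lambda>x. cos (real n * x))"

lemma cos_mode:
  "x \<in> {0..pi} \<Longrightarrow> fn (cos_mode n) x = cos (real n * x)"
  "AE x in Leb. dx (cos_mode n) x = - real n * sin (real n * x)"
proof -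
  have u: "((\<lambda>x. cos (real n * x)) has_real_derivative - real n * sin (real n * x)) (at x)" for x
    by (auto intro!: derivative_eq_intros)
  have c: "continuous_on UNIV (\<lambda>x. - real n * sin (real n * x))" by (intro continuous_intros)
  show "x \<in> {0..pi} \<Longrightarrow> fn (cos_mode n) x = cos (real n * x)"
    "AE x in Leb. dx (cos_mode n) x = - real n * sin (real n * x)"
    unfolding cos_mode_def using h1_of[OF u c] by blast+
qed

lemma LINT_fn_cos: "(LINT x|Leb. fn v x * cos (real n * x)) = cosine_coeff (fn v) n"
  unfolding cosine_coeff_def
  by (intro LINT_eq_integral continuous_imp_integrable_real continuous_intros continuous_on_fn)

lemma embed_cos_mode: "embed (cos_mode n) v = cosine_coeff (fn v) n"
proof -
  have "embed (cos_mode n) v = (LINT x|Leb. fn v x * cos (real n * x))"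
    unfolding embed.rep_eq by (intro Bochner_Integration.integral_cong refl) (auto simp: cos_mode(1))
  then show ?thesis by (simp only: LINT_fn_cos)
qed

lemma dx_sin_coeff: "(LINT x|Leb. dx v x * sin (real n * x)) = - real n * cosine_coeff (fn v) n"
proof -
  have "(LINT x|Leb. dx v x * sin (real n * x)) = fn v pi * sin (real n * pi) - fn v 0 * sin (real n * 0)
      - (LINT x|Leb. fn v x * (real n * cos (real n * x)))"
  proof (rule h1_integration_by_parts[of _ _ "real n"])
    show "((\<lambda>x. sin (real n * x)) has_real_derivative real n * cos (real n * x)) (at x)" for x
      by (auto intro!: derivative_eq_intros)
    show "continuous_on UNIV (\<lambda>x. real n * cos (real n * x))" by (intro continuous_intros)
    show "\<bar>real n * cos (real n * x)\<bar> \<le> real n" for x by (simp add: abs_mult mult_left_le)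
  qed
  also have "(LINT x|Leb. fn v x * (real n * cos (real n * x))) = real n * cosine_coeff (fn v) n"
    unfolding LINT_fn_cos[symmetric] integral_mult_right_zero[symmetric]
    by (intro Bochner_Integration.integral_cong refl) simp
  also have "sin (real n * pi) = 0" by (metis sin_npi mult.commute)
  finally show ?thesis by simp
qed

text \<open>
  The Neumann condition is hidden in the weak form: the boundary terms vanish because the derivative
  \<open>- n sin (n x)\<close> of the mode is zero at both ends.
\<close>

lemma A_N_cos_mode: "A_N (cos_mode n) = (real n)\<^sup>2 *\<^sub>R embed (cos_mode n)"
proof (rule blinfun_eqI)
  fix v
  have "A_N (cos_mode n) v = (LINT x|Leb. - real n * (dx v x * sin (real n * x)))"
    unfolding A_N.rep_eq
  proof (rule integral_cong_AE)
    have [measurable]: "dx u \<in> borel_measurable Leb" for u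
      using borel_measurable_integrable[OF square_integrable_imp_integrable[OF dx(1)]] .
    show "(\<lambda>x. dx (cos_mode n) x * dx v x) \<in> borel_measurable Leb" by measurable
    have [measurable]: "(\<lambda>x. sin (real n * x)) \<in> borel_measurable Leb"
      by (rule Leb_measurable_borel) measurable
    show "(\<lambda>x. - real n * (dx v x * sin (real n * x))) \<in> borel_measurable Leb" by measurable
    show "AE x in Leb. dx (cos_mode n) x * dx v x = - real n * (dx v x * sin (real n * x))"
      using cos_mode(2)[of n] by eventually_elim simp
  qed
  also have "\<dots> = - real n * (- real n * cosine_coeff (fn v) n)"
    by (simp only: integral_mult_right_zero dx_sin_coeff)
  finally show "A_N (cos_mode n) v = ((real n)\<^sup>2 *\<^sub>R embed (cos_mode n)) v"
    by (simp add: blinfun.scaleR_left embed_cos_mode power2_eq_square)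
qed

lemma LINT_sin_sin:
  assumes "n \<noteq> 0" "m \<noteq> 0"
  shows "(LINT x|Leb. sin (real n * x) * sin (real m * x)) = (if n = m then pi / 2 else 0)"
proof -
  have "((\<lambda>x. (cos (of_int (int n - int m) * x) - cos (of_int (int n + int m) * x)) / 2) has_integral
     ((if int n - int m = 0 then pi else 0) - (if int n + int m = 0 then pi else 0)) / 2) {0..pi}"
    by (intro has_integral_divide has_integral_diff has_integral_cos_int)
  moreover have "(cos (of_int (int n - int m) * x) - cos (of_int (int n + int m) * x)) / 2
      = sin (real n * x) * sin (real m * x)" for x
    using sin_times_sin[of "real n * x" "real m * x"] by (simp add: left_diff_distrib distrib_right)
  ultimately have "((\<lambda>x. sin (real n * x) * sin (real m * x)) has_integral
     ((if int n - int m = 0 then pi else 0) - (if int n + int m = 0 then pi else 0)) / 2) {0..pi}"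
    by (simp only:)
  moreover have "((if int n - int m = 0 then pi else 0) - (if int n + int m = 0 then pi else 0)) / 2
      = (if n = m then pi / 2 else 0)"
    using assms by auto
  ultimately have "((\<lambda>x. sin (real n * x) * sin (real m * x)) has_integral (if n = m then pi / 2 else 0)) {0..pi}"
    by (simp only:)
  then have "integral {0..pi} (\<lambda>x. sin (real n * x) * sin (real m * x)) = (if n = m then pi / 2 else 0)"
    by (rule integral_unique)
  moreover have "integrable Leb (\<lambda>x. sin (real n * x) * sin (real m * x))"
    by (intro continuous_imp_integrable_Leb continuous_intros)
  ultimately show ?thesis by (simp only: LINT_eq_integral)
qed

text \<open>
  The mean square distance of \<open>g\<close> from its partial sine series is nonnegative.
\<close>

lemma sine_Bessel:
  assumes g: "square_integrable g" and F: "finite F" "0 \<notin> F"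
  shows "(\<Sum>n\<in>F. (LINT x|Leb. g x * sin (real n * x))\<^sup>2) \<le> pi / 2 * (LINT x|Leb. (g x)\<^sup>2)"
proof -
  define s where "s n = (LINT x|Leb. g x * sin (real n * x))" for n
  define P where "P x = (\<Sum>n\<in>F. s n * sin (real n * x))" for x
  define S where "S = (\<Sum>n\<in>F. (s n)\<^sup>2)"
  have cs: "continuous_on A (\<lambda>x. sin (real n * x))" for n A by (intro continuous_intros)
  have si: "square_integrable (\<lambda>x. sin (real n * x))" for n
    by (rule square_integrable_continuous[OF cs])
  have gs: "integrable Leb (\<lambda>x. g x * sin (real n * x))" for n by (rule square_integrable_mult[OF g si])
  have cP: "continuous_on A P" for A unfolding P_def by (intro continuous_intros)
  have sP: "square_integrable P" by (rule square_integrable_continuous[OF cP])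
  have gP: "(LINT x|Leb. g x * P x) = S"
  proof -
    have "(LINT x|Leb. g x * P x) = (LINT x|Leb. (\<Sum>n\<in>F. s n * (g x * sin (real n * x))))"
      by (simp add: P_def sum_distrib_left mult_ac)
    also have "\<dots> = (\<Sum>n\<in>F. s n * (LINT x|Leb. g x * sin (real n * x)))"
      using gs by (subst Bochner_Integration.integral_sum) auto
    finally show ?thesis by (simp add: S_def s_def power2_eq_square)
  qed
  have sP2: "(LINT x|Leb. sin (real m * x) * P x) = pi / 2 * s m" if m: "m \<in> F" for m
  proof -
    have "(LINT x|Leb. sin (real m * x) * P x) = (LINT x|Leb. (\<Sum>n\<in>F. s n * (sin (real m * x) * sin (real n * x))))"
      by (simp add: P_def sum_distrib_left mult_ac)
    also have "\<dots> = (\<Sum>n\<in>F. s n * (LINT x|Leb. sin (real m * x) * sin (real n * x)))"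
      using square_integrable_mult[OF si si] by (subst Bochner_Integration.integral_sum) auto
    also have "\<dots> = (\<Sum>n\<in>F. s n * (if m = n then pi / 2 else 0))"
    proof (intro sum.cong refl)
      fix n assume "n \<in> F"
      then have "n \<noteq> 0" "m \<noteq> 0" using F m by metis+
      then show "s n * (LINT x|Leb. sin (real m * x) * sin (real n * x)) = s n * (if m = n then pi / 2 else 0)"
        using LINT_sin_sin[of m n] by simp
    qed
    also have "\<dots> = (\<Sum>n\<in>F. if m = n then pi / 2 * s m else 0)" by (intro sum.cong) auto
    also have "\<dots> = pi / 2 * s m" using F m by (simp add: sum.delta)
    finally show ?thesis .
  qed
  have PP: "(LINT x|Leb. (P x)\<^sup>2) = pi / 2 * S"
  proof -
    have "(LINT x|Leb. (P x)\<^sup>2) = (LINT x|Leb. (\<Sum>n\<in>F. s n * (sin (real n * x) * P x)))"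
      by (simp add: P_def power2_eq_square sum_distrib_right mult_ac)
    also have "\<dots> = (\<Sum>n\<in>F. s n * (LINT x|Leb. sin (real n * x) * P x))"
      using square_integrable_mult[OF si sP] by (subst Bochner_Integration.integral_sum) auto
    also have "\<dots> = (\<Sum>n\<in>F. pi / 2 * (s n)\<^sup>2)"
      by (intro sum.cong refl) (simp add: sP2 power2_eq_square)
    finally show ?thesis by (simp add: S_def sum_distrib_left)
  qed
  have "0 \<le> (LINT x|Leb. (g x - 2 / pi * P x)\<^sup>2)" by (auto intro: integral_nonneg_AE)
  also have "\<dots> = (LINT x|Leb. (g x)\<^sup>2 - 4 / pi * (g x * P x) + 4 / pi\<^sup>2 * (P x)\<^sup>2)"
    by (intro Bochner_Integration.integral_cong refl) (simp add: power2_eq_square algebra_simps)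
  also have "\<dots> = (LINT x|Leb. (g x)\<^sup>2) - 4 / pi * S + 4 / pi\<^sup>2 * (pi / 2 * S)"
    using g sP square_integrable_mult[OF g sP] by (simp add: square_integrable_def gP PP)
  also have "\<dots> = (LINT x|Leb. (g x)\<^sup>2) - 2 / pi * S" by (simp add: power2_eq_square field_simps)
  finally have "2 / pi * S \<le> (LINT x|Leb. (g x)\<^sup>2)" by simp
  then show ?thesis by (simp add: S_def s_def field_simps)
qed

text \<open>
  The cosine coefficients of \<open>v\<close> are, up to a factor \<open>- 1 / n\<close>, sine coefficients of the weak
  derivative, so Cauchy-Schwarz and Bessel's inequality apply. The bound is uniform in \<open>v\<close> on bounded
  sets, which gives convergence in the dual norm below.
\<close>

lemma sum_cosine_coeff_le:
  assumes F: "finite F" "0 \<notin> F"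
  shows "(\<Sum>n\<in>F. \<bar>cosine_coeff (fn v) n\<bar>) \<le> sqrt (\<Sum>n\<in>F. 1 / (real n)\<^sup>2) * (sqrt (pi / 2) * norm v)"
proof -
  define s where "s n = (LINT x|Leb. dx v x * sin (real n * x))" for n
  have "\<bar>cosine_coeff (fn v) n\<bar> = \<bar>1 / real n\<bar> * \<bar>s n\<bar>" if "n \<in> F" for n
  proof -
    have "n \<noteq> 0" using that F by metis
    then show ?thesis by (simp add: s_def dx_sin_coeff abs_mult)
  qed
  then have "(\<Sum>n\<in>F. \<bar>cosine_coeff (fn v) n\<bar>) = (\<Sum>n\<in>F. \<bar>1 / real n\<bar> * \<bar>s n\<bar>)" by simp
  also have "\<dots> \<le> L2_set (\<lambda>n. 1 / real n) F * L2_set s F" by (rule L2_set_mult_ineq)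
  also have "\<dots> = sqrt (\<Sum>n\<in>F. 1 / (real n)\<^sup>2) * sqrt (\<Sum>n\<in>F. (s n)\<^sup>2)"
    by (simp add: L2_set_def power_divide)
  also have "\<dots> \<le> sqrt (\<Sum>n\<in>F. 1 / (real n)\<^sup>2) * (sqrt (pi / 2) * norm v)"
  proof (rule mult_left_mono)
    have "sqrt (\<Sum>n\<in>F. (s n)\<^sup>2) \<le> sqrt (pi / 2 * (LINT x|Leb. (dx v x)\<^sup>2))"
      unfolding s_def by (intro real_sqrt_le_mono sine_Bessel dx F)
    also have "\<dots> = sqrt (pi / 2) * sqrt (LINT x|Leb. (dx v x)\<^sup>2)" by (rule real_sqrt_mult)
    also have "\<dots> \<le> sqrt (pi / 2) * norm v"
      using l2_inner_nonneg[of "fn v"]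
      by (intro mult_left_mono) (auto simp: norm_h1_def inner_h1_def l2_inner_def power2_eq_square)
    finally show "sqrt (\<Sum>n\<in>F. (s n)\<^sup>2) \<le> sqrt (pi / 2) * norm v" .
  qed (auto intro: sum_nonneg)
  finally show ?thesis .
qed

lemma summable_inverse_squares: "summable (\<lambda>n. 1 / (real n)\<^sup>2)"
  using inverse_power_summable[of 2, where 'a = real] by (simp add: divide_inverse power_inverse)

lemma summable_cosine_coeff: "summable (\<lambda>n. \<bar>cosine_coeff (fn v) n\<bar>)"
proof -
  have "summable (\<lambda>n. \<bar>cosine_coeff (fn v) (Suc n)\<bar>)"
  proof (rule summableI_nonneg_bounded)
    fix N
    have "(\<Sum>n<N. \<bar>cosine_coeff (fn v) (Suc n)\<bar>) = (\<Sum>n\<in>Suc ` {..<N}. \<bar>cosine_coeff (fn v) n\<bar>)"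
      by (simp add: sum.reindex)
    also have "\<dots> \<le> sqrt (\<Sum>n\<in>Suc ` {..<N}. 1 / (real n)\<^sup>2) * (sqrt (pi / 2) * norm v)"
      by (rule sum_cosine_coeff_le) auto
    also have "\<dots> \<le> sqrt (\<Sum>n. 1 / (real n)\<^sup>2) * (sqrt (pi / 2) * norm v)"
      by (intro mult_right_mono real_sqrt_le_mono sum_le_suminf summable_inverse_squares) auto
    finally show "(\<Sum>n<N. \<bar>cosine_coeff (fn v) (Suc n)\<bar>) \<le> sqrt (\<Sum>n. 1 / (real n)\<^sup>2) * (sqrt (pi / 2) * norm v)" .
  qed simp
  then show ?thesis by (subst (asm) summable_Suc_iff)
qed

lemma fn_cosine_series:
  "x \<in> {0..pi} \<Longrightarrow> (\<lambda>n. cos_weight n * cosine_coeff (fn v) n * cos (real n * x)) sums fn v x"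
  by (rule cosine_inversion[OF continuous_on_fn summable_cosine_coeff])

text \<open>
  Point evaluation at \<open>0\<close> is the pointwise sum by \<open>cosine_inversion\<close>. The convergence holds in the
  norm of \<open>H\<^sup>-\<^sup>1\<close>, which is needed for applying the semigroup term by term, because blocks of the
  series are bounded by tails of \<open>\<Sum> 1 / n\<^sup>2\<close>.
\<close>

theorem delta0_series: "(\<lambda>n. cos_weight n *\<^sub>R embed (cos_mode n)) sums delta0"
proof -
  let ?f = "\<lambda>n. cos_weight n *\<^sub>R embed (cos_mode n)"
  have bound: "norm (sum ?f {m..<k}) \<le> sqrt (\<Sum>n\<in>{m..<k}. 1 / (real n)\<^sup>2) * sqrt (pi / 2)" if "m \<ge> 1" for m k
  proof (rule norm_blinfun_bound)
    fix v
    have "norm ((sum ?f {m..<k}) v) = \<bar>\<Sum>n\<in>{m..<k}. cos_weight n * cosine_coeff (fn v) n\<bar>"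
      by (simp add: blinfun.sum_left blinfun.scaleR_left embed_cos_mode)
    also have "\<dots> \<le> (\<Sum>n\<in>{m..<k}. \<bar>cos_weight n * cosine_coeff (fn v) n\<bar>)" by (rule sum_abs)
    also have "\<dots> \<le> (\<Sum>n\<in>{m..<k}. \<bar>cosine_coeff (fn v) n\<bar>)"
    proof (rule sum_mono)
      fix n
      have "\<bar>cos_weight n\<bar> * \<bar>cosine_coeff (fn v) n\<bar> \<le> 1 * \<bar>cosine_coeff (fn v) n\<bar>"
        using cos_weight_pos[of n] cos_weight_le[of n] by (intro mult_right_mono) auto
      then show "\<bar>cos_weight n * cosine_coeff (fn v) n\<bar> \<le> \<bar>cosine_coeff (fn v) n\<bar>" by (simp add: abs_mult)
    qed
    also have "\<dots> \<le> sqrt (\<Sum>n\<in>{m..<k}. 1 / (real n)\<^sup>2) * (sqrt (pi / 2) * norm v)"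
      by (rule sum_cosine_coeff_le) (use that in auto)
    finally show "norm ((sum ?f {m..<k}) v) \<le> sqrt (\<Sum>n\<in>{m..<k}. 1 / (real n)\<^sup>2) * sqrt (pi / 2) * norm v"
      by (simp add: mult.assoc)
  qed (auto intro!: mult_nonneg_nonneg sum_nonneg)
  have "summable ?f"
    unfolding summable_Cauchy
  proof (intro allI impI)
    fix e :: real assume e: "e > 0"
    define e' where "e' = (e / sqrt (pi / 2))\<^sup>2"
    have e': "e' > 0" using e by (simp add: e'_def)
    obtain N where N: "\<And>m n. m \<ge> N \<Longrightarrow> norm (\<Sum>k\<in>{m..<n}. 1 / (real k)\<^sup>2) < e'"
      using summable_inverse_squares[unfolded summable_Cauchy, rule_format, OF e'] by blast
    show "\<exists>N. \<forall>m\<ge>N. \<forall>n. norm (sum ?f {m..<n}) < e"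
    proof (intro exI allI impI)
      fix m n assume m: "m \<ge> max 1 N"
      have "sqrt (\<Sum>k\<in>{m..<n}. 1 / (real k)\<^sup>2) < sqrt e'"
        using N[of m n] m by (intro real_sqrt_less_mono) auto
      also have "sqrt e' = e / sqrt (pi / 2)" using e by (simp add: e'_def)
      finally have "sqrt (\<Sum>k\<in>{m..<n}. 1 / (real k)\<^sup>2) * sqrt (pi / 2) < e" by (simp add: field_simps)
      then show "norm (sum ?f {m..<n}) < e" using bound[of m n] m by simp
    qed
  qed
  then have s: "?f sums suminf ?f" by (rule summable_sums)
  have "suminf ?f = delta0"
  proof (rule blinfun_eqI)
    fix v
    have "(\<lambda>n. ?f n v) sums (suminf ?f) v"
      by (rule bounded_linear.sums[OF blinfun.bounded_linear_left s])
    then have "(\<lambda>n. cos_weight n * cosine_coeff (fn v) n) sums (suminf ?f) v"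
      by (simp add: blinfun.scaleR_left embed_cos_mode)
    moreover have "(\<lambda>n. cos_weight n * cosine_coeff (fn v) n) sums fn v 0"
      using fn_cosine_series[of 0 v] by simp
    ultimately show "(suminf ?f) v = delta0 v" by (simp add: delta0.rep_eq sums_unique2)
  qed
  then show ?thesis using s by simp
qed

lemma norm_embed_le:
  assumes e: "\<And>x. x \<in> {0..pi} \<Longrightarrow> \<bar>fn w x\<bar> \<le> e"
  shows "norm (embed w) \<le> e * (pi * (1 / sqrt pi + sqrt pi))"
proof (rule norm_blinfun_bound)
  have e0: "e \<ge> 0" using e[of 0] by simp
  then show "0 \<le> e * (pi * (1 / sqrt pi + sqrt pi))" by simp
  fix v
  let ?C = "1 / sqrt pi + sqrt pi"
  have i: "integrable Leb (\<lambda>x. fn w x * fn v x)"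
    by (rule square_integrable_mult[OF square_integrable_fn square_integrable_fn])
  have "norm (embed w v) \<le> (LINT x|Leb. norm (fn w x * fn v x))"
    unfolding embed.rep_eq by (rule integral_norm_bound)
  also have "\<dots> \<le> (LINT x|Leb. e * (?C * norm v))"
  proof (rule integral_mono)
    fix x assume "x \<in> space Leb"
    then have x: "x \<in> {0..pi}" by simp
    show "norm (fn w x * fn v x) \<le> e * (?C * norm v)"
      unfolding real_norm_def abs_mult using e0
      by (intro mult_mono e x point_evaluation_bound) auto
  qed (use i finite_measure.integrable_const[OF finite_measure_Leb] in auto)
  also have "\<dots> = e * (pi * ?C) * norm v" by (simp add: measure_restrict_space)
  finally show "norm (embed w v) \<le> e * (pi * ?C) * norm v" .
qed

lemma embed_linear: "embed (u + v) = embed u + embed v" "embed (c *\<^sub>R u) = c *\<^sub>R embed u"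
  by (rule blinfun_eqI;
      simp only: embed.rep_eq blinfun.add_left blinfun.scaleR_left l2_inner_def[symmetric] l2_inner_fn real_scaleR_def)+

text \<open>
  Uniform convergence of a cosine series implies convergence of the embedded series.
\<close>

lemma sums_embed:
  assumes b: "summable (\<lambda>n. \<bar>b n\<bar>)" and w: "\<And>x. x \<in> {0..pi} \<Longrightarrow> (\<lambda>n. b n * cos (real n * x)) sums fn w x"
  shows "(\<lambda>n. b n *\<^sub>R embed (cos_mode n)) sums embed w"
proof -
  have part: "(\<Sum>n<N. b n *\<^sub>R embed (cos_mode n)) = embed (\<Sum>n<N. b n *\<^sub>R cos_mode n)" for N
  proof (induction N)
    case 0
    have "embed 0 = 0" using embed_linear(2)[of 0 0] by simp
    then show ?case by simp
  qed (simp add: embed_linear)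
  have fpart: "fn (\<Sum>n<N. b n *\<^sub>R cos_mode n) x = (\<Sum>n<N. b n * cos (real n * x))" if "x \<in> {0..pi}" for N x
    by (induction N) (use that in \<open>auto simp: cos_mode(1)\<close>)
  let ?C = "pi * (1 / sqrt pi + sqrt pi)"
  define tail where "tail N = (\<Sum>n. \<bar>b (n + N)\<bar>)" for N
  have "norm ((\<Sum>n<N. b n *\<^sub>R embed (cos_mode n)) - embed w) \<le> tail N * ?C" for N
  proof -
    \<comment> \<open>The difference of the partial sum and \<open>w\<close>, in a form to which the linearity rules apply.\<close>
    let ?d = "(\<Sum>n<N. b n *\<^sub>R cos_mode n) + (-1) *\<^sub>R w"
    have "(\<Sum>n<N. b n *\<^sub>R embed (cos_mode n)) - embed w = embed ?d"
    proof -
      have "embed ?d = (\<Sum>n<N. b n *\<^sub>R embed (cos_mode n)) + (-1) *\<^sub>R embed w"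
        unfolding part by (simp only: embed_linear)
      then show ?thesis by simp
    qed
    moreover have "norm (embed ?d) \<le> tail N * ?C"
    proof (rule norm_embed_le)
      fix x assume x: "x \<in> {0..pi}"
      have sb: "summable (\<lambda>n. \<bar>b (n + N) * cos (real (n + N) * x)\<bar>)"
        by (rule summable_comparison_test'[OF summable_ignore_initial_segment[OF b, of N]])
           (simp add: abs_mult mult_left_le)
      have "fn ?d x = (\<Sum>n<N. b n * cos (real n * x)) - fn w x"
        by (simp only: fn_add fn_scaleR fpart[OF x] mult_minus1 add_uminus_conv_diff)
      also have "fn w x = (\<Sum>n. b (n + N) * cos (real (n + N) * x)) + (\<Sum>n<N. b n * cos (real n * x))"
        using suminf_split_initial_segment[OF sums_summable[OF w[OF x]], of N] sums_unique[OF w[OF x]] by simp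
      finally have "\<bar>fn ?d x\<bar> = \<bar>\<Sum>n. b (n + N) * cos (real (n + N) * x)\<bar>" by simp
      also have "\<dots> \<le> (\<Sum>n. \<bar>b (n + N) * cos (real (n + N) * x)\<bar>)"
        by (rule summable_rabs[OF sb])
      also have "\<dots> \<le> tail N"
        unfolding tail_def
        by (intro suminf_le sb summable_ignore_initial_segment[OF b]) (simp add: abs_mult mult_left_le)
      finally show "\<bar>fn ?d x\<bar> \<le> tail N" .
    qed
    ultimately show ?thesis by simp
  qed
  then have le: "\<forall>\<^sub>F N in sequentially. norm ((\<Sum>n<N. b n *\<^sub>R embed (cos_mode n)) - embed w) \<le> tail N * ?C"
    by (rule always_eventually[OF allI])
  have "tail \<longlonglongrightarrow> 0"
    unfolding tail_def by (rule suminf_exist_split2[OF b])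
  then have "(\<lambda>N. tail N * ?C) \<longlonglongrightarrow> 0" by (rule tendsto_mult_left_zero)
  then have "(\<lambda>N. (\<Sum>n<N. b n *\<^sub>R embed (cos_mode n)) - embed w) \<longlonglongrightarrow> 0"
    by (rule Lim_null_comparison[OF le])
  then show ?thesis unfolding sums_def by (simp add: LIM_zero_iff)
qed

section \<open>Uniform boundedness and eigenvectors of a semigroup\<close>

text \<open>
  One of the points \<open>x + \<eta>\<close> and \<open>x - \<eta>\<close> has an image at least as large as that of \<open>\<eta>\<close>, by the triangle
  inequality. Any factor below \<open>1\<close> would do; \<open>2 / 3\<close> exceeds the \<open>1 / 2\<close> that is lost later.
\<close>

lemma blinfun_large_value_near:
  fixes F :: "'a::real_normed_vector \<Rightarrow>\<^sub>L 'b::real_normed_vector"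
  assumes "r > 0"
  shows "\<exists>x'. norm (x' - x) \<le> r \<and> 2 / 3 * r * norm F \<le> norm (F x')"
proof (cases "norm F = 0")
  case True
  then show ?thesis using assms by (intro exI[of _ x]) auto
next
  case False
  have "\<not> (\<forall>\<xi>. norm (F \<xi>) \<le> 2 / 3 * norm F * norm \<xi>)"
  proof
    assume "\<forall>\<xi>. norm (F \<xi>) \<le> 2 / 3 * norm F * norm \<xi>"
    then have "norm F \<le> 2 / 3 * norm F" by (intro norm_blinfun_bound) auto
    then show False using False by simp
  qed
  then obtain \<xi> where \<xi>: "norm (F \<xi>) > 2 / 3 * norm F * norm \<xi>" by (auto simp: not_le)
  then have n: "norm \<xi> > 0" by (cases "\<xi> = 0") auto
  define \<eta> where "\<eta> = (r / norm \<xi>) *\<^sub>R \<xi>"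
  have \<eta>: "norm \<eta> = r" using n assms by (simp add: \<eta>_def)
  have "norm (F \<eta>) = r / norm \<xi> * norm (F \<xi>)" using assms n by (simp add: \<eta>_def blinfun.scaleR_right)
  also have "\<dots> \<ge> r / norm \<xi> * (2 / 3 * norm F * norm \<xi>)"
    using \<xi> assms n by (intro mult_left_mono) auto
  finally have big: "norm (F \<eta>) \<ge> 2 / 3 * r * norm F" using n by simp
  have "2 * norm (F \<eta>) = norm (F (x + \<eta>) - F (x - \<eta>))"
    by (simp add: blinfun.add_right blinfun.diff_right scaleR_2[symmetric])
  also have "\<dots> \<le> norm (F (x + \<eta>)) + norm (F (x - \<eta>))" by (rule norm_triangle_ineq4)
  finally have "norm (F (x + \<eta>)) \<ge> norm (F \<eta>) \<or> norm (F (x - \<eta>)) \<ge> norm (F \<eta>)" by linarith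
  then show ?thesis
  proof
    assume "norm (F (x + \<eta>)) \<ge> norm (F \<eta>)"
    then show ?thesis using big \<eta> by (intro exI[of _ "x + \<eta>"]) auto
  next
    assume "norm (F (x - \<eta>)) \<ge> norm (F \<eta>)"
    then show ?thesis using big \<eta> by (intro exI[of _ "x - \<eta>"]) auto
  qed
qed

text \<open>
  Sokal's elementary proof. If the norms were unbounded, a sequence of points with steps
  \<open>3\<^sup>-\<^sup>k\<close> could be chosen that makes operators of norm above \<open>4\<^sup>k\<close> large at the \<open>k\<close>-th point, and
  they would be unbounded at the limit.
\<close>

theorem uniform_boundedness:
  fixes F :: "nat \<Rightarrow> 'a::banach \<Rightarrow>\<^sub>L 'b::real_normed_vector"
  assumes pw: "\<And>x. \<exists>C. \<forall>n. norm (F n x) \<le> C"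
  shows "\<exists>C. \<forall>n. norm (F n) \<le> C"
proof (rule ccontr)
  assume "\<not> ?thesis"
  then have "\<exists>n. norm (F n) > C" for C by (meson not_le)
  then have "\<forall>k::nat. \<exists>n. norm (F n) > 4 ^ k" by blast
  then obtain \<nu> where \<nu>: "\<And>k. norm (F (\<nu> k)) > 4 ^ k" by metis
  \<comment> \<open>All steps after the \<open>k\<close>-th one add up to at most half of \<open>3\<^sup>-\<^sup>k\<close>, which cannot undo the
    gain of \<open>2 / 3\<close> of \<open>3\<^sup>-\<^sup>k\<close> times the norm.\<close>
  have "\<exists>x. \<forall>k. (True \<and> norm (x (Suc k) - x k) \<le> (1 / 3) ^ Suc k \<and>
      2 / 3 * (1 / 3) ^ Suc k * norm (F (\<nu> (Suc k))) \<le> norm (F (\<nu> (Suc k)) (x (Suc k))))"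
    using dependent_nat_choice[of "\<lambda>_ _. True" "\<lambda>k x y. norm (y - x) \<le> (1 / 3) ^ Suc k \<and>
      2 / 3 * (1 / 3) ^ Suc k * norm (F (\<nu> (Suc k))) \<le> norm (F (\<nu> (Suc k)) y)"]
      blinfun_large_value_near[of "(1 / 3) ^ Suc _"] by (metis (no_types, lifting) zero_less_divide_1_iff zero_less_numeral zero_less_power)
  then obtain x where x: "\<And>k. norm (x (Suc k) - x k) \<le> (1 / 3) ^ Suc k"
      "\<And>k. 2 / 3 * (1 / 3) ^ Suc k * norm (F (\<nu> (Suc k))) \<le> norm (F (\<nu> (Suc k)) (x (Suc k)))"
    by blast
  have step: "norm (x (n + m) - x n) \<le> 1 / 2 * (1 / 3) ^ n - 1 / 2 * (1 / 3) ^ (n + m)" for n m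
  proof (induction m)
    case (Suc m)
    have "norm (x (n + Suc m) - x n) \<le> norm (x (Suc (n + m)) - x (n + m)) + norm (x (n + m) - x n)"
      using norm_triangle_ineq[of "x (Suc (n + m)) - x (n + m)" "x (n + m) - x n"] by simp
    also have "\<dots> \<le> (1 / 3) ^ Suc (n + m) + (1 / 2 * (1 / 3) ^ n - 1 / 2 * (1 / 3) ^ (n + m))"
      by (intro add_mono x Suc)
    also have "\<dots> = 1 / 2 * (1 / 3) ^ n - 1 / 2 * (1 / 3) ^ (n + Suc m)" by simp
    finally show ?case .
  qed simp
  have lt: "norm (x (n + m) - x n) \<le> 1 / 2 * (1 / 3) ^ n" for n m
    by (rule order_trans[OF step]) simp
  have "Cauchy x"
  proof (rule CauchyI')
    fix e :: real assume "e > 0"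
    have "(\<lambda>n. 1 / 2 * (1 / 3 :: real) ^ n) \<longlonglongrightarrow> 1 / 2 * 0" by (intro tendsto_intros LIMSEQ_power_zero) auto
    then obtain M where M: "\<And>n. n \<ge> M \<Longrightarrow> 1 / 2 * (1 / 3 :: real) ^ n < e"
      using LIMSEQ_D[of "\<lambda>n. 1 / 2 * (1 / 3 :: real) ^ n" 0 e] \<open>e > 0\<close> by force
    show "\<exists>M. \<forall>m\<ge>M. \<forall>n>m. dist (x m) (x n) < e"
    proof (intro exI allI impI)
      fix m n assume mn: "m \<ge> M" "n > m"
      then have "norm (x n - x m) \<le> 1 / 2 * (1 / 3) ^ m" using lt[of m "n - m"] by simp
      then show "dist (x m) (x n) < e" using M[OF mn(1)] by (simp add: dist_norm norm_minus_commute)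
    qed
  qed
  then obtain z where z: "x \<longlonglongrightarrow> z" using Cauchy_convergent convergent_def by blast
  have zx: "norm (z - x n) \<le> 1 / 2 * (1 / 3) ^ n" for n
  proof (rule LIMSEQ_le_const2)
    show "(\<lambda>m. norm (x (m + n) - x n)) \<longlonglongrightarrow> norm (z - x n)"
      by (intro tendsto_intros LIMSEQ_ignore_initial_segment[OF z])
    show "\<exists>N. \<forall>m\<ge>N. norm (x (m + n) - x n) \<le> 1 / 2 * (1 / 3) ^ n" using lt[of n] by (auto simp: add.commute)
  qed
  obtain C where C: "\<And>n. norm (F n z) \<le> C" using pw by blast
  have "1 / 6 * (4 / 3) ^ Suc k \<le> C" for k
  proof -
    let ?G = "F (\<nu> (Suc k))"
    have "2 / 3 * (1 / 3) ^ Suc k * norm ?G \<le> norm (?G (x (Suc k)))" by (rule x)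
    also have "\<dots> \<le> norm (?G z) + norm (?G (z - x (Suc k)))"
      using norm_triangle_ineq4[of "?G z" "?G (z - x (Suc k))"] by (simp add: blinfun.diff_right)
    also have "\<dots> \<le> C + norm ?G * (1 / 2 * (1 / 3) ^ Suc k)"
      by (intro add_mono C order_trans[OF norm_blinfun] mult_left_mono zx) auto
    finally have "2 / 3 * ((1 / 3) ^ Suc k * norm ?G) \<le> C + 1 / 2 * ((1 / 3) ^ Suc k * norm ?G)"
      by (simp only: mult_ac)
    then have "1 / 6 * (1 / 3) ^ Suc k * norm ?G \<le> C" by linarith
    moreover have "1 / 6 * (1 / 3) ^ Suc k * 4 ^ Suc k \<le> 1 / 6 * (1 / 3) ^ Suc k * norm ?G"
      using \<nu>[of "Suc k"] by (intro mult_left_mono) auto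
    moreover have "1 / 6 * (1 / 3) ^ Suc k * 4 ^ Suc k = 1 / 6 * (4 / 3 :: real) ^ Suc k"
      by (simp add: power_divide)
    ultimately show ?thesis by linarith
  qed
  then have "(4 / 3) ^ Suc k \<le> 6 * C" for k by (simp add: field_simps)
  moreover obtain n where "6 * C < (4 / 3) ^ n" using real_arch_pow[of "4 / 3" "6 * C"] by auto
  moreover have "(4 / 3 :: real) ^ n \<le> (4 / 3) ^ Suc n" by simp
  ultimately show False by (metis not_le order.strict_trans2)
qed

text \<open>
  Otherwise the semigroup would be unbounded in norm along a sequence of times decreasing to \<open>0\<close>, on
  which it converges pointwise.
\<close>

lemma semigroup_locally_bounded:
  assumes T: "strongly_continuous_semigroup T"
  shows "\<exists>d>0. \<exists>M. \<forall>t\<in>{0..d}. norm (T t) \<le> M"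
proof (rule ccontr)
  assume "\<not> ?thesis"
  then have H: "\<exists>t\<in>{0..d}. norm (T t) > M" if "d > 0" for d M using that by (meson not_le)
  have "\<forall>n::nat. \<exists>t. t \<in> {0..1 / real (Suc n)} \<and> norm (T t) > real n + 1"
    using H[of "1 / real (Suc _)"] by (meson of_nat_0_less_iff zero_less_Suc zero_less_divide_1_iff)
  then obtain t where t: "\<And>n. t n \<in> {0..1 / real (Suc n)}" "\<And>n. norm (T (t n)) > real n + 1" by metis
  have tpos: "t n > 0" for n
  proof (rule ccontr)
    assume "\<not> t n > 0"
    then have "t n = 0" using t(1)[of n] by simp
    then have "norm (T (t n)) \<le> 1"
      using T norm_blinfun_id_le by (simp add: strongly_continuous_semigroup_def)
    then show False using t(2)[of n] by simp
  qed
  have "t \<longlonglongrightarrow> 0"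
  proof (rule tendsto_sandwich[OF _ _ tendsto_const])
    show "(\<lambda>n. 1 / real (Suc n)) \<longlonglongrightarrow> 0" by (rule LIMSEQ_Suc[OF lim_const_over_n])
  qed (use t(1) in auto)
  then have tl: "filterlim t (at_right 0) sequentially"
    by (intro tendsto_imp_filterlim_at_right) (use tpos in auto)
  have "\<exists>C. \<forall>n. norm (T (t n)) \<le> C"
  proof (rule uniform_boundedness)
    fix x
    have "((\<lambda>h. T h x) \<longlongrightarrow> x) (at_right 0)" using T by (simp add: strongly_continuous_semigroup_def)
    then have "(\<lambda>n. T (t n) x) \<longlonglongrightarrow> x" by (rule filterlim_compose[OF _ tl])
    then have "Bseq (\<lambda>n. T (t n) x)" by (rule convergent_imp_Bseq[OF convergentI])
    then show "\<exists>C. \<forall>n. norm (T (t n) x) \<le> C" by (auto simp: Bseq_def)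
  qed
  then obtain C where "\<And>n. norm (T (t n)) \<le> C" by blast
  moreover obtain n where "real n > C" using reals_Archimedean2 by blast
  ultimately show False using t(2)[of n] by (meson add_increasing2 less_le_not_le order.trans zero_le_one less_imp_le)
qed

text \<open>
  The function \<open>exp (\<mu> t) T(t) x\<close> has right derivative \<open>0\<close> at \<open>0\<close>. By the semigroup law and local
  boundedness, its increments between any two nearby points are controlled by the increments from \<open>0\<close>,
  so that it has derivative \<open>0\<close> on a short interval and is constant there. The semigroup law extends
  the formula to all times.
\<close>

theorem semigroup_eigenvector:
  assumes T: "strongly_continuous_semigroup T" and gen: "(x, - (\<mu> *\<^sub>R x)) \<in> generator T" and t: "t \<ge> 0"
  shows "T t x = exp (- \<mu> * t) *\<^sub>R x"
proof -
  have T0: "T 0 = id_blinfun" and Tadd: "\<And>s t. s \<ge> 0 \<Longrightarrow> t \<ge> 0 \<Longrightarrow> T (s + t) = T s o\<^sub>L T t"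
    using T by (auto simp: strongly_continuous_semigroup_def)
  obtain d M where d: "d > 0" and M: "\<And>t. t \<in> {0..d} \<Longrightarrow> norm (T t) \<le> M"
    using semigroup_locally_bounded[OF T] by blast
  have M0: "M \<ge> 0" using M[of 0] d norm_ge_zero[of "T 0"] by (auto intro: order_trans[OF norm_ge_zero])
  define F where "F t = exp (\<mu> * t) *\<^sub>R T t x" for t
  have F0: "F 0 = x" by (simp add: F_def T0)
  have Fd: "((\<lambda>h. (F h - x) /\<^sub>R h) \<longlongrightarrow> 0) (at_right 0)"
  proof -
    have 1: "((\<lambda>h. (T h x - x) /\<^sub>R h) \<longlongrightarrow> - (\<mu> *\<^sub>R x)) (at_right 0)"
      using gen by (simp add: generator_def)
    have "((\<lambda>h. exp (\<mu> * h)) has_real_derivative \<mu>) (at 0)"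
      by (auto intro!: derivative_eq_intros)
    then have 2: "((\<lambda>h. (exp (\<mu> * h) - 1) / h) \<longlongrightarrow> \<mu>) (at_right 0)"
      by (auto simp: has_field_derivative_iff intro: tendsto_mono[OF at_le])
    have 3: "((\<lambda>h. exp (\<mu> * h)) \<longlongrightarrow> exp (\<mu> * 0)) (at_right 0)" by (intro tendsto_intros)
    have "((\<lambda>h. exp (\<mu> * h) *\<^sub>R ((T h x - x) /\<^sub>R h) + ((exp (\<mu> * h) - 1) / h) *\<^sub>R x)
        \<longlongrightarrow> exp (\<mu> * 0) *\<^sub>R (- (\<mu> *\<^sub>R x)) + \<mu> *\<^sub>R x) (at_right 0)"
      by (intro tendsto_intros 1 2 3)
    moreover have "exp (\<mu> * h) *\<^sub>R ((T h x - x) /\<^sub>R h) + ((exp (\<mu> * h) - 1) / h) *\<^sub>R x = (F h - x) /\<^sub>R h" for h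
      by (simp add: F_def algebra_simps divide_inverse)
    ultimately show ?thesis by simp
  qed
  define C where "C = exp (\<bar>\<mu>\<bar> * d) * M"
  have C0: "C \<ge> 0" using M0 by (simp add: C_def)
  have inc: "norm (F (s + h) - F s) \<le> C * norm (F h - x)" if "s \<in> {0..d}" "h \<ge> 0" for s h
  proof -
    have "T (s + h) = T s o\<^sub>L T h" using that by (intro Tadd) auto
    then have "F (s + h) - F s = exp (\<mu> * s) *\<^sub>R T s (F h - x)"
      by (simp add: F_def blinfun.diff_right blinfun.scaleR_right scaleR_diff_right exp_add[symmetric] algebra_simps)
    then have "norm (F (s + h) - F s) \<le> exp (\<mu> * s) * (norm (T s) * norm (F h - x))"
      by (simp add: norm_blinfun)
    also have "\<dots> \<le> exp (\<bar>\<mu>\<bar> * d) * (M * norm (F h - x))"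
    proof (intro mult_mono M that)
      have "\<mu> * s \<le> \<bar>\<mu>\<bar> * d" using that by (intro mult_mono) auto
      then show "exp (\<mu> * s) \<le> exp (\<bar>\<mu>\<bar> * d)" by simp
    qed (use M0 in auto)
    finally show ?thesis by (simp add: C_def mult.assoc)
  qed
  have const: "F t = x" if t: "t \<in> {0..d}" for t
  proof -
    have "(F has_vector_derivative 0) (at s within {0..d})" if s: "s \<in> {0..d}" for s
      unfolding has_vector_derivative_def has_derivative_within_alt2
    proof (intro conjI allI impI)
      show "bounded_linear (\<lambda>h. h *\<^sub>R (0::'a))" by simp
      fix e :: real assume e: "e > 0"
      have "e / (C + 1) > 0" using e C0 by simp
      then have "\<forall>\<^sub>F h in at_right 0. norm ((F h - x) /\<^sub>R h) < e / (C + 1)"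
        using tendstoD[OF Fd] by (simp add: dist_norm)
      then obtain b where b: "b > 0" "\<And>h. 0 < h \<Longrightarrow> h < b \<Longrightarrow> norm ((F h - x) /\<^sub>R h) < e / (C + 1)"
        unfolding eventually_at_right_field by blast
      have small: "C * norm (F h - x) \<le> e * h" if "0 \<le> h" "h < b" for h
      proof (cases "h = 0")
        case False
        then have "norm (F h - x) / h < e / (C + 1)" using b(2)[of h] that by (simp add: divide_inverse mult.commute)
        then have "norm (F h - x) \<le> e / (C + 1) * h" using False that by (simp add: field_simps)
        then have "C * norm (F h - x) \<le> C * (e / (C + 1) * h)" using C0 by (intro mult_left_mono)
        also have "\<dots> = (C / (C + 1)) * (e * h)" by simp
        also have "\<dots> \<le> 1 * (e * h)" using C0 e that by (intro mult_right_mono) auto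
        finally show ?thesis by simp
      qed (simp add: F0)
      have "norm (F y - F s) \<le> e * norm (y - s)" if y: "y \<in> {0..d}" "dist y s < b" for y
      proof (cases "y \<ge> s")
        case True
        then show ?thesis using inc[of s "y - s"] small[of "y - s"] s y by (auto simp: dist_real_def)
      next
        case False
        then have "norm (F s - F y) \<le> e * (s - y)" using inc[of y "s - y"] small[of "s - y"] s y by (auto simp: dist_real_def)
        then show ?thesis using False by (simp add: norm_minus_commute)
      qed
      then show "\<forall>\<^sub>F y in at s within {0..d}. norm (F y - F s - (y - s) *\<^sub>R 0) \<le> e * norm (y - s)"
        unfolding eventually_at using b(1) by auto
    qed
    then obtain c where "\<And>s. s \<in> {0..d} \<Longrightarrow> F s = c"
      using has_vector_derivative_zero_constant[of "{0..d}" F] by auto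
    then show ?thesis using F0 t d by (metis atLeastAtMost_iff less_imp_le order_refl)
  qed
  have loc: "T t x = exp (- \<mu> * t) *\<^sub>R x" if "t \<in> {0..d}" for t
  proof -
    have "T t x = exp (- \<mu> * t) *\<^sub>R F t" by (simp add: F_def exp_add[symmetric])
    then show ?thesis by (simp only: const[OF that])
  qed
  obtain n :: nat where n: "n > 0" "t / real n \<le> d"
  proof -
    obtain n :: nat where "real n > t / d" using reals_Archimedean2 by blast
    then have "t / real (Suc n) \<le> d" using d by (simp add: field_simps)
    then show thesis using that[of "Suc n"] by simp
  qed
  define s where "s = t / real n"
  have s: "s \<in> {0..d}" using n t by (simp add: s_def)
  have "T (real k * s) x = exp (- \<mu> * (real k * s)) *\<^sub>R x" for k
  proof (induction k)
    case (Suc k)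
    have "T (real (Suc k) * s) = T (real k * s) o\<^sub>L T s"
      using Tadd[of "real k * s" s] s by (simp add: algebra_simps)
    then have "T (real (Suc k) * s) x = exp (- \<mu> * s) *\<^sub>R T (real k * s) x"
      using loc[OF s] by (simp add: blinfun.scaleR_right)
    also have "\<dots> = exp (- \<mu> * (real (Suc k) * s)) *\<^sub>R x"
      unfolding Suc by (simp add: exp_add[symmetric] algebra_simps)
    finally show ?case .
  qed (simp add: T0)
  from this[of n] show ?thesis using n by (simp add: s_def)
qed

section \<open>The input terms as exponential series\<close>

lemma T_cos_mode:
  assumes T: "generated_by_minus_A_N T" and t: "t \<ge> 0"
  shows "T t (embed (cos_mode n)) = exp (- (real n)\<^sup>2 * t) *\<^sub>R embed (cos_mode n)"
proof (rule semigroup_eigenvector[OF _ _ t])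
  show "strongly_continuous_semigroup T" using T by (simp add: generated_by_minus_A_N_def)
  have "(embed (cos_mode n), - A_N (cos_mode n)) \<in> generator T"
    using T by (auto simp: generated_by_minus_A_N_def)
  then show "(embed (cos_mode n), - ((real n)\<^sup>2 *\<^sub>R embed (cos_mode n))) \<in> generator T"
    by (simp only: A_N_cos_mode)
qed

lemma summable_exp_squares:
  assumes "t > 0"
  shows "summable (\<lambda>n. exp (- (real n)\<^sup>2 * t))"
proof (rule summable_comparison_test')
  show "summable (\<lambda>n. exp (- t) ^ n)" using assms by (intro summable_geometric) simp
  fix n :: nat
  have "real n \<le> (real n)\<^sup>2" by (cases n) (auto simp: power2_eq_square)
  then have "real n * t \<le> (real n)\<^sup>2 * t" using assms by (intro mult_right_mono) auto
  then show "norm (exp (- (real n)\<^sup>2 * t)) \<le> exp (- t) ^ n"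
    by (simp add: exp_of_nat_mult[symmetric])
qed

lemma summable_square_exp_squares:
  assumes "t > 0"
  shows "summable (\<lambda>n. (real n)\<^sup>2 * exp (- (real n)\<^sup>2 * t))"
proof (rule summable_comparison_test')
  have "t / 2 > 0" using assms by simp
  then show "summable (\<lambda>n. 2 / t * exp (- (real n)\<^sup>2 * (t / 2)))"
    by (intro summable_mult summable_exp_squares)
  fix n :: nat
  define u where "u = (real n)\<^sup>2 * (t / 2)"
  have "u \<le> exp u" using exp_ge_add_one_self[of u] by linarith
  then have "u * exp (- (real n)\<^sup>2 * t) \<le> exp u * exp (- (real n)\<^sup>2 * t)" by (intro mult_right_mono) auto
  also have "\<dots> = exp (- (real n)\<^sup>2 * (t / 2))" by (simp add: u_def exp_add[symmetric] field_simps)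
  finally have "2 / t * (u * exp (- (real n)\<^sup>2 * t)) \<le> 2 / t * exp (- (real n)\<^sup>2 * (t / 2))"
    using assms by (intro mult_left_mono) auto
  moreover have "2 / t * (u * exp (- (real n)\<^sup>2 * t)) = (real n)\<^sup>2 * exp (- (real n)\<^sup>2 * t)"
    using assms by (simp add: u_def)
  ultimately show "norm ((real n)\<^sup>2 * exp (- (real n)\<^sup>2 * t)) \<le> 2 / t * exp (- (real n)\<^sup>2 * (t / 2))"
    by simp
qed

lemma cosine_series_C1:
  assumes 1: "summable (\<lambda>n. \<bar>b n\<bar>)" and 2: "summable (\<lambda>n. real n * \<bar>b n\<bar>)"
  shows "\<exists>\<psi>'. (\<forall>x. ((\<lambda>x. \<Sum>n. b n * cos (real n * x)) has_real_derivative \<psi>' x) (at x)) \<and> continuous_on UNIV \<psi>'"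
proof -
  define f' where "f' n x = - (b n * (real n * sin (real n * x)))" for n x
  have f'b: "norm (f' n x) \<le> real n * \<bar>b n\<bar>" for n x
  proof -
    have "\<bar>b n\<bar> * (real n * \<bar>sin (real n * x)\<bar>) \<le> \<bar>b n\<bar> * (real n * 1)" by (intro mult_left_mono) auto
    then show ?thesis by (simp add: f'_def abs_mult mult.commute)
  qed
  have ul: "uniform_limit UNIV (\<lambda>N x. \<Sum>n<N. f' n x) (\<lambda>x. \<Sum>n. f' n x) sequentially"
    by (rule Weierstrass_m_test[OF _ 2]) (rule f'b)
  have d: "((\<lambda>x. \<Sum>n. b n * cos (real n * x)) has_real_derivative (\<Sum>n. f' n x)) (at x)" for x
  proof -
    have 1: "((\<lambda>x. b n * cos (real n * x)) has_real_derivative f' n x) (at x within UNIV)" for n x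
      unfolding f'_def by (auto intro!: derivative_eq_intros)
    have 2: "uniformly_convergent_on UNIV (\<lambda>n x. \<Sum>i<n. f' i x)"
      using ul uniformly_convergent_on_def by blast
    have 3: "summable (\<lambda>n. b n * cos (real n * 0))" using summable_rabs_cancel[OF assms(1)] by simp
    show ?thesis
      by (rule has_field_derivative_series'(2)[OF convex_UNIV 1 2 UNIV_I 3]) simp
  qed
  have "continuous_on UNIV (\<lambda>x. \<Sum>n. f' n x)"
    by (rule uniform_limit_theorem[OF _ ul]) (auto intro!: always_eventually continuous_intros simp: f'_def)
  with d show ?thesis by (intro exI[of _ "\<lambda>x. \<Sum>n. f' n x"] conjI allI)
qed

text \<open>
  For \<open>t > 0\<close> the factors \<open>exp (- n\<^sup>2 t)\<close> turn any bounded coefficients into those of a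
  continuously differentiable function, so \<open>T(t) x\<close> lies in \<open>H\<^sup>1\<close> and its value at \<open>\<pi>\<close> is the value of
  the series, where \<open>cos (n \<pi>) = (-1)\<^sup>n\<close>.
\<close>

theorem semigroup_point_value_series:
  assumes T: "generated_by_minus_A_N T" and x: "(\<lambda>n. b n *\<^sub>R embed (cos_mode n)) sums x"
    and B: "\<And>n. \<bar>b n\<bar> \<le> B" and t: "t > 0"
  shows "(\<lambda>n. b n * (-1) ^ n * exp (- (real n)\<^sup>2 * t)) sums point_value (T t x) pi"
proof -
  define c where "c n = b n * exp (- (real n)\<^sup>2 * t)" for n
  define \<psi> where "\<psi> x = (\<Sum>n. c n * cos (real n * x))" for x
  have cb: "\<bar>c n\<bar> \<le> B * exp (- (real n)\<^sup>2 * t)" for n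
    using B[of n] by (simp add: c_def abs_mult mult_right_mono)
  have s1: "summable (\<lambda>n. \<bar>c n\<bar>)"
    by (rule summable_comparison_test'[OF summable_mult[OF summable_exp_squares[OF t]]]) (use cb in auto)
  have s2: "summable (\<lambda>n. real n * \<bar>c n\<bar>)"
  proof (rule summable_comparison_test'[OF summable_mult[OF summable_square_exp_squares[OF t], of B]])
    fix n :: nat
    have "real n \<le> (real n)\<^sup>2" by (cases n) (auto simp: power2_eq_square)
    then have "real n * \<bar>c n\<bar> \<le> (real n)\<^sup>2 * (B * exp (- (real n)\<^sup>2 * t))"
      using cb[of n] by (intro mult_mono) auto
    then show "norm (real n * \<bar>c n\<bar>) \<le> B * ((real n)\<^sup>2 * exp (- (real n)\<^sup>2 * t))"
      by (simp add: mult.left_commute)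
  qed
  obtain \<psi>' where \<psi>': "\<And>x. (\<psi> has_real_derivative \<psi>' x) (at x)" "continuous_on UNIV \<psi>'"
    using cosine_series_C1[OF s1 s2] unfolding \<psi>_def by blast
  have \<psi>s: "(\<lambda>n. c n * cos (real n * x)) sums \<psi> x" for x
    unfolding \<psi>_def
    by (intro summable_sums summable_comparison_test'[OF s1]) (simp add: abs_mult mult_left_le)
  have "(\<lambda>n. c n *\<^sub>R embed (cos_mode n)) sums embed (h1_of \<psi>)"
    by (rule sums_embed[OF s1]) (use h1_of(1)[OF \<psi>'] \<psi>s in simp)
  moreover have "(\<lambda>n. c n *\<^sub>R embed (cos_mode n)) sums T t x"
  proof -
    have "(\<lambda>n. T t (b n *\<^sub>R embed (cos_mode n))) sums T t x"
      by (rule bounded_linear.sums[OF blinfun.bounded_linear_right x])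
    then show ?thesis
      using T_cos_mode[OF T, of t] t by (simp add: blinfun.scaleR_right c_def)
  qed
  ultimately have "embed (h1_of \<psi>) = T t x" by (rule sums_unique2)
  then have "point_value (T t x) pi = \<psi> pi"
    by (simp add: point_value_def \<open>embed (h1_of \<psi>) = T t x\<close>[symmetric] inv_f_f[OF inj_embed] h1_of(1)[OF \<psi>'])
  moreover have "cos (real n * pi) = (-1) ^ n" for n by (rule cos_npi)
  ultimately show ?thesis using \<psi>s[of pi] by (simp add: c_def mult_ac)
qed

theorem a_of_series:
  assumes T: "generated_by_minus_A_N T" and t: "t > 0"
  shows "(\<lambda>n. cos_weight n * (-1) ^ n * exp (- (real n)\<^sup>2 * t)) sums (- a_of T t)"
proof -
  have "\<bar>cos_weight n\<bar> \<le> 1" for n using cos_weight_pos[of n] cos_weight_le[of n] by simp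
  then show ?thesis
    using semigroup_point_value_series[OF T delta0_series _ t, of 1] by (simp add: a_of_def)
qed

theorem f_of_series:
  assumes T: "generated_by_minus_A_N T"
  obtains b where "summable (\<lambda>n. \<bar>b n\<bar>)"
    and "\<And>t. t > 0 \<Longrightarrow> (\<lambda>n. b n * exp (- (real n)\<^sup>2 * t)) sums f_of T u t"
proof
  define c where "c n = cos_weight n * cosine_coeff (fn u) n" for n
  have cb: "\<bar>c n\<bar> \<le> \<bar>cosine_coeff (fn u) n\<bar>" for n
    using cos_weight_pos[of n] cos_weight_le[of n] mult_right_mono[of "cos_weight n" 1 "\<bar>cosine_coeff (fn u) n\<bar>"]
    by (simp add: c_def abs_mult)
  have s: "summable (\<lambda>n. \<bar>c n\<bar>)"
    by (rule summable_comparison_test'[OF summable_cosine_coeff]) (use cb in auto)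
  then show "summable (\<lambda>n. \<bar>c n * (-1) ^ n\<bar>)" by (simp add: abs_mult)
  have "(\<lambda>n. c n *\<^sub>R embed (cos_mode n)) sums embed u"
    by (rule sums_embed[OF s]) (use fn_cosine_series in \<open>simp add: c_def\<close>)
  moreover obtain B where "\<And>n. \<bar>c n\<bar> \<le> B"
    using summable_imp_Bseq[OF s] by (auto simp: Bseq_def)
  ultimately show "(\<lambda>n. c n * (-1) ^ n * exp (- (real n)\<^sup>2 * t)) sums f_of T u t" if "t > 0" for t
    unfolding f_of_def using semigroup_point_value_series[OF T _ _ that] by blast
qed

section \<open>The kernel near time zero\<close>

lemma exp_minus_le_inverse_cube:
  fixes u :: real
  assumes "u \<ge> 0"
  shows "exp (- u) \<le> 27 / (1 + u) ^ 3"
proof -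
  have "(1 + u) / 3 \<le> exp (u / 3)" 
    by (rule order_trans[OF _ exp_ge_add_one_self]) (simp add: field_simps)
  then have "((1 + u) / 3) ^ 3 \<le> exp (u / 3) ^ 3" using assms by (intro power_mono) auto
  also have "exp (u / 3) ^ 3 = exp u" using exp_of_nat_mult[of 3 "u / 3"] by simp
  finally have "(1 + u) ^ 3 \<le> 27 * exp u" by (simp add: power_divide)
  then show ?thesis using assms by (simp add: exp_minus field_simps)
qed

definition zeta32 :: real where
  "zeta32 = (\<Sum>n. real n powr (- 3 / 2))"

lemma zeta32: "summable (\<lambda>n. real n powr (- 3 / 2))" "zeta32 \<ge> 0"
proof -
  show "summable (\<lambda>n. real n powr (- 3 / 2))" by (subst summable_real_powr_iff) simp
  then show "zeta32 \<ge> 0" unfolding zeta32_def by (intro suminf_nonneg) auto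
qed

text \<open>
  The exponent \<open>3 / 4\<close> is one that makes \<open>\<Sum> m\<^sup>-\<^sup>2\<^sup>s\<close> converge and \<open>t\<^sup>-\<^sup>s\<close> integrable at \<open>0\<close>: any \<open>s\<close>
  between \<open>1 / 2\<close> and \<open>1\<close> has both properties.
\<close>

lemma sum_quadratic_decay:
  assumes t: "t > 0"
  shows "summable (\<lambda>m. 1 / (1 + t * (real m)\<^sup>2))" "(\<Sum>m. 1 / (1 + t * (real m)\<^sup>2)) \<le> 1 + zeta32 * t powr (- 3 / 4)"
proof -
  let ?g = "\<lambda>m. (if m = 0 then 1 else 0) + t powr (- 3 / 4) * real m powr (- 3 / 2)"
  have le: "1 / (1 + t * (real m)\<^sup>2) \<le> ?g m" for m
  proof (cases "m = 0")
    case False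
    define u where "u = t * (real m)\<^sup>2"
    have u: "u > 0" using t False by (simp add: u_def)
    have "u powr (3 / 4) \<le> (1 + u) powr (3 / 4)" using u by (intro powr_mono2) auto
    also have "\<dots> \<le> (1 + u) powr 1" using u by (intro powr_mono) auto
    finally have "u powr (3 / 4) \<le> 1 + u" using u by simp
    then have "1 / (1 + u) \<le> 1 / u powr (3 / 4)" using u by (intro divide_left_mono mult_pos_pos) auto
    also have "\<dots> = u powr (- 3 / 4)" by (simp add: powr_minus_divide)
    also have "u powr (- 3 / 4) = t powr (- 3 / 4) * (real m)\<^sup>2 powr (- 3 / 4)"
      using t False by (simp add: u_def powr_mult)
    also have "(real m)\<^sup>2 = real m powr 2" using False by simp
    also have "(real m powr 2) powr (- 3 / 4) = real m powr (- 3 / 2)" by (simp only: powr_powr) simp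
    finally show ?thesis using False by (simp add: u_def)
  qed simp
  have sg: "?g sums (1 + t powr (- 3 / 4) * zeta32)"
    unfolding zeta32_def by (intro sums_add sums_mult summable_sums zeta32(1) sums_single)
  show s: "summable (\<lambda>m. 1 / (1 + t * (real m)\<^sup>2))"
  proof (rule summable_comparison_test'[OF sums_summable[OF sg]])
    show "norm (1 / (1 + t * (real m)\<^sup>2)) \<le> ?g m" for m
      using le[of m] t by (subst real_norm_def, subst abs_of_nonneg) auto
  qed
  show "(\<Sum>m. 1 / (1 + t * (real m)\<^sup>2)) \<le> 1 + zeta32 * t powr (- 3 / 4)"
    using suminf_le[OF le s sums_summable[OF sg]] sums_unique[OF sg] by (simp add: mult.commute)
qed

lemma second_difference_le:
  fixes \<phi> \<phi>' \<phi>'' :: "real \<Rightarrow> real"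
  assumes d1: "\<And>x. (\<phi> has_real_derivative \<phi>' x) (at x)" and d2: "\<And>x. (\<phi>' has_real_derivative \<phi>'' x) (at x)"
    and M: "\<And>y. x - 1 \<le> y \<Longrightarrow> y \<le> x + 1 \<Longrightarrow> \<bar>\<phi>'' y\<bar> \<le> M"
  shows "\<bar>\<phi> (x + 1) - 2 * \<phi> x + \<phi> (x - 1)\<bar> \<le> 2 * M"
proof -
  have D: "((\<lambda>h. \<phi> (x + h) + \<phi> (x - h)) has_real_derivative (\<phi>' (x + h) - \<phi>' (x - h))) (at h)" for h
    by (auto intro!: derivative_eq_intros DERIV_chain2[OF d1])
  obtain h where h: "0 < h" "h < 1"
    "(\<phi> (x + 1) + \<phi> (x - 1)) - (\<phi> (x + 0) + \<phi> (x - 0)) = (1 - 0) * (\<phi>' (x + h) - \<phi>' (x - h))"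
    using MVT2[of 0 1 "\<lambda>h. \<phi> (x + h) + \<phi> (x - h)" "\<lambda>h. \<phi>' (x + h) - \<phi>' (x - h)"] D by auto
  obtain y where y: "x - h < y" "y < x + h" "\<phi>' (x + h) - \<phi>' (x - h) = ((x + h) - (x - h)) * \<phi>'' y"
    using MVT2[of "x - h" "x + h" \<phi>' \<phi>''] d2 h by auto
  have "\<phi> (x + 1) - 2 * \<phi> x + \<phi> (x - 1) = 2 * (h * \<phi>'' y)" using h(3) y(3) by simp
  then have "\<bar>\<phi> (x + 1) - 2 * \<phi> x + \<phi> (x - 1)\<bar> = 2 * (h * \<bar>\<phi>'' y\<bar>)"
    using h(1) by (simp add: abs_mult)
  also have "\<dots> \<le> 2 * (1 * M)" using M[of y] y h by (intro mult_left_mono mult_mono) auto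
  finally show ?thesis by simp
qed

text \<open>
  The weighted sum over \<open>n \<ge> 0\<close> is \<open>1 / \<pi>\<close> times the alternating sum of the even extension of \<open>\<phi>\<close> over
  all integers. Summation by parts, applied twice, replaces \<open>\<phi>\<close> by its second differences; this
  captures the cancellation that a bound by absolute values misses.
\<close>

lemma alternating_sum_second_difference:
  fixes \<phi> \<phi>' \<phi>'' :: "real \<Rightarrow> real"
  assumes d1: "\<And>x. (\<phi> has_real_derivative \<phi>' x) (at x)" and d2: "\<And>x. (\<phi>' has_real_derivative \<phi>'' x) (at x)"
    and B: "\<And>x. \<bar>\<phi>'' x\<bar> \<le> B / (1 + t * x\<^sup>2)" and t: "t > 0" and s: "summable (\<lambda>n. \<bar>\<phi> (real n)\<bar>)"
  shows "\<bar>\<Sum>n. cos_weight n * (-1) ^ n * \<phi> (real n)\<bar> \<le> \<bar>\<phi> 0 - \<phi> 1\<bar> + B * (1 + zeta32 * t powr (- 3 / 4))"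
proof -
  define a where "a n = (-1) ^ n * \<phi> (real n)" for n
  have "summable (\<lambda>n. \<bar>a n\<bar>)" using s by (simp add: a_def abs_mult)
  then have sa: "summable a" by (rule summable_rabs_cancel)
  define X where "X = suminf a"
  have aX: "a sums X" using sa by (simp add: X_def summable_sums)
  have a1: "(\<lambda>n. a (n + 1)) sums (X - \<phi> 0)" using sums_split_initial_segment[OF aX, of 1] by (simp add: a_def)
  have a2: "(\<lambda>n. a (n + 2)) sums (X - (\<phi> 0 - \<phi> 1))"
    using sums_split_initial_segment[OF aX, of 2] by (simp add: a_def numeral_2_eq_2)
  \<comment> \<open>The second difference centred at \<open>m + 1\<close>.\<close>
  define d where "d m = \<phi> (real m + 2) - 2 * \<phi> (real m + 1) + \<phi> (real m)" for m :: nat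
  have B0: "B \<ge> 0" using B[of 0] by simp
  have db: "\<bar>d m\<bar> \<le> 2 * B * (1 / (1 + t * (real m)\<^sup>2))" for m
  proof -
    have "\<bar>\<phi> ((real m + 1) + 1) - 2 * \<phi> (real m + 1) + \<phi> ((real m + 1) - 1)\<bar> \<le> 2 * (B / (1 + t * (real m)\<^sup>2))"
    proof (rule second_difference_le[OF d1 d2])
      fix y assume "real m + 1 - 1 \<le> y"
      then have "(real m)\<^sup>2 \<le> y\<^sup>2" by (intro power_mono) auto
      then have "B / (1 + t * y\<^sup>2) \<le> B / (1 + t * (real m)\<^sup>2)"
        using t B0 by (intro divide_left_mono add_left_mono mult_left_mono mult_pos_pos) (auto intro!: add_pos_nonneg)
      then show "\<bar>\<phi>'' y\<bar> \<le> B / (1 + t * (real m)\<^sup>2)" using B[of y] by linarith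
    qed
    then show ?thesis by (simp add: d_def add.assoc)
  qed
  note q = sum_quadratic_decay[OF t]
  have sd: "summable (\<lambda>m. \<bar>(-1) ^ m * d m\<bar>)"
    by (rule summable_comparison_test'[OF summable_mult[OF q(1)]]) (use db in \<open>auto simp: abs_mult\<close>)
  have "(\<lambda>m. a (m + 2) + 2 * a (m + 1) + a m) sums ((X - (\<phi> 0 - \<phi> 1)) + 2 * (X - \<phi> 0) + X)"
    by (intro sums_add sums_mult a1 a2 aX)
  moreover have "a (m + 2) + 2 * a (m + 1) + a m = (-1) ^ m * d m" for m
    by (simp add: a_def d_def algebra_simps)
  ultimately have ds: "(\<lambda>m. (-1) ^ m * d m) sums (4 * X - 3 * \<phi> 0 + \<phi> 1)" by (simp add: algebra_simps)
  have "\<bar>4 * X - 3 * \<phi> 0 + \<phi> 1\<bar> \<le> (\<Sum>m. \<bar>(-1) ^ m * d m\<bar>)"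
    using summable_rabs[OF sd] sums_unique[OF ds] by simp
  also have "\<dots> \<le> (\<Sum>m. 2 * B * (1 / (1 + t * (real m)\<^sup>2)))"
    by (intro suminf_le sd summable_mult q(1)) (use db in \<open>simp add: abs_mult\<close>)
  also have "\<dots> = 2 * B * (\<Sum>m. 1 / (1 + t * (real m)\<^sup>2))" by (rule suminf_mult[OF q(1)])
  also have "\<dots> \<le> 2 * B * (1 + zeta32 * t powr (- 3 / 4))" using q(2) B0 by (intro mult_left_mono) auto
  finally have main: "\<bar>4 * X - 3 * \<phi> 0 + \<phi> 1\<bar> \<le> 2 * (B * (1 + zeta32 * t powr (- 3 / 4)))" by simp
  have E: "(\<Sum>n. cos_weight n * (-1) ^ n * \<phi> (real n)) = (2 * X - \<phi> 0) / pi"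
  proof (rule sums_unique[symmetric])
    have "(\<lambda>n. 2 / pi * a n - (if n = 0 then \<phi> 0 / pi else 0)) sums (2 / pi * X - \<phi> 0 / pi)"
      by (intro sums_diff sums_mult aX sums_single)
    moreover have "2 / pi * a n - (if n = 0 then \<phi> 0 / pi else 0) = cos_weight n * (-1) ^ n * \<phi> (real n)" for n
      by (simp add: a_def cos_weight_def field_simps)
    ultimately show "(\<lambda>n. cos_weight n * (-1) ^ n * \<phi> (real n)) sums ((2 * X - \<phi> 0) / pi)"
      by (simp add: diff_divide_distrib)
  qed
  have "\<bar>2 * X - \<phi> 0\<bar> / pi \<le> \<bar>2 * X - \<phi> 0\<bar> / 1"
    using pi_ge_two by (intro divide_left_mono) auto
  then have "\<bar>(2 * X - \<phi> 0) / pi\<bar> \<le> \<bar>2 * X - \<phi> 0\<bar>" by (simp add: abs_divide)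
  then show ?thesis unfolding E using main by linarith
qed

text \<open>
  This is \<open>- a\<close> for \<open>t > 0\<close>, and \<open>dkern\<close> is its derivative.
\<close>

definition kern :: "real \<Rightarrow> real" where
  "kern t = (\<Sum>n. cos_weight n * (-1) ^ n * exp (- (real n)\<^sup>2 * t))"

definition dkern :: "real \<Rightarrow> real" where
  "dkern t = (\<Sum>n. - ((real n)\<^sup>2 * (cos_weight n * (-1) ^ n) * exp (- (real n)\<^sup>2 * t)))"

lemma kern_near_zero:
  assumes t: "t > 0"
  shows "\<bar>kern t\<bar> \<le> t + 108 * t * (1 + zeta32 * t powr (- 3 / 4))"
proof -
  let ?\<phi> = "\<lambda>x. exp (- x\<^sup>2 * t)"
  have "\<bar>\<Sum>n. cos_weight n * (-1) ^ n * ?\<phi> (real n)\<bar> \<le> \<bar>?\<phi> 0 - ?\<phi> 1\<bar> + (108 * t) * (1 + zeta32 * t powr (- 3 / 4))"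
  proof (rule alternating_sum_second_difference[OF _ _ _ t])
    show "(?\<phi> has_real_derivative - 2 * t * x * exp (- x\<^sup>2 * t)) (at x)" for x
      by (auto intro!: derivative_eq_intros)
    show "((\<lambda>x. - 2 * t * x * exp (- x\<^sup>2 * t)) has_real_derivative (4 * t\<^sup>2 * x\<^sup>2 - 2 * t) * exp (- x\<^sup>2 * t)) (at x)" for x
      by (auto intro!: derivative_eq_intros simp: power2_eq_square algebra_simps)
    show "\<bar>(4 * t\<^sup>2 * x\<^sup>2 - 2 * t) * exp (- x\<^sup>2 * t)\<bar> \<le> 108 * t / (1 + t * x\<^sup>2)" for x
    proof -
      define u where "u = t * x\<^sup>2"
      have u: "u \<ge> 0" using t by (simp add: u_def)
      have "4 * t\<^sup>2 * x\<^sup>2 - 2 * t = t * (4 * u - 2)" by (simp add: u_def power2_eq_square algebra_simps)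
      moreover have "\<bar>t * (4 * u - 2)\<bar> \<le> t * (4 * (1 + u))"
        unfolding abs_mult using t u by (intro mult_mono) auto
      ultimately have "\<bar>4 * t\<^sup>2 * x\<^sup>2 - 2 * t\<bar> * exp (- u) \<le> t * (4 * (1 + u)) * (27 / (1 + u) ^ 3)"
        using exp_minus_le_inverse_cube[OF u] t u by (intro mult_mono) auto
      also have "\<dots> = 108 * t / (1 + u) * (1 / (1 + u))"
      proof -
        have "t * (4 * v) * (27 / v ^ 3) = 108 * t / v * (1 / v)" if "v \<noteq> 0" for v
          using that by (simp add: power3_eq_cube)
        from this[of "1 + u"] show ?thesis using u by simp
      qed
      also have "\<dots> \<le> 108 * t / (1 + u) * 1" using u t by (intro mult_left_mono) auto
      finally show ?thesis by (simp add: abs_mult u_def mult.commute)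
    qed
    show "summable (\<lambda>n. \<bar>?\<phi> (real n)\<bar>)" using summable_exp_squares[OF t] by simp
  qed
  moreover have "\<bar>?\<phi> 0 - ?\<phi> 1\<bar> \<le> t" using exp_ge_add_one_self[of "- t"] t by simp
  ultimately show ?thesis by (simp add: kern_def)
qed

text \<open>
  The sum of the absolute values of the terms is of order \<open>t powr (- 3 / 2)\<close>, which is not integrable at
  \<open>0\<close>; the order \<open>t powr (- 3 / 4)\<close> is.
\<close>

lemma dkern_near_zero:
  assumes t: "t > 0"
  shows "\<bar>dkern t\<bar> \<le> 1 + 270 * (1 + zeta32 * t powr (- 3 / 4))"
proof -
  let ?\<phi> = "\<lambda>x. x\<^sup>2 * exp (- x\<^sup>2 * t)"
  have "\<bar>\<Sum>n. cos_weight n * (-1) ^ n * ?\<phi> (real n)\<bar> \<le> \<bar>?\<phi> 0 - ?\<phi> 1\<bar> + 270 * (1 + zeta32 * t powr (- 3 / 4))"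
  proof (rule alternating_sum_second_difference[OF _ _ _ t])
    show "(?\<phi> has_real_derivative (2 * x - 2 * t * x ^ 3) * exp (- x\<^sup>2 * t)) (at x)" for x
      by (auto intro!: derivative_eq_intros simp: power2_eq_square power3_eq_cube algebra_simps)
    show "((\<lambda>x. (2 * x - 2 * t * x ^ 3) * exp (- x\<^sup>2 * t)) has_real_derivative
        (2 - 10 * t * x\<^sup>2 + 4 * (t * x\<^sup>2)\<^sup>2) * exp (- x\<^sup>2 * t)) (at x)" for x
      by (auto intro!: derivative_eq_intros simp: power2_eq_square power3_eq_cube algebra_simps)
    show "\<bar>(2 - 10 * t * x\<^sup>2 + 4 * (t * x\<^sup>2)\<^sup>2) * exp (- x\<^sup>2 * t)\<bar> \<le> 270 / (1 + t * x\<^sup>2)" for x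
    proof -
      define u where "u = t * x\<^sup>2"
      have u: "u \<ge> 0" using t by (simp add: u_def)
      have "\<bar>2 - 10 * u + 4 * u\<^sup>2\<bar> \<le> 10 * (1 + u)\<^sup>2"
        using u by (simp add: abs_le_iff power2_eq_square algebra_simps)
      then have "\<bar>2 - 10 * u + 4 * u\<^sup>2\<bar> * exp (- u) \<le> 10 * (1 + u)\<^sup>2 * (27 / (1 + u) ^ 3)"
        using exp_minus_le_inverse_cube[OF u] u by (intro mult_mono) auto
      also have "\<dots> = 270 / (1 + u)" using u by (simp add: power3_eq_cube power2_eq_square)
      finally show ?thesis by (simp add: abs_mult u_def mult_ac)
    qed
    show "summable (\<lambda>n. \<bar>?\<phi> (real n)\<bar>)" using summable_square_exp_squares[OF t] by (simp add: abs_mult)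
  qed
  moreover have "\<bar>?\<phi> 0 - ?\<phi> 1\<bar> \<le> 1" using t by simp
  moreover have "dkern t = - (\<Sum>n. cos_weight n * (-1) ^ n * ?\<phi> (real n))"
  proof -
    have "summable (\<lambda>n. cos_weight n * (-1) ^ n * ?\<phi> (real n))"
    proof (rule summable_rabs_cancel, rule summable_comparison_test'[OF summable_square_exp_squares[OF t]])
      fix n
      show "norm \<bar>cos_weight n * (-1) ^ n * ?\<phi> (real n)\<bar> \<le> ?\<phi> (real n)"
        using cos_weight_pos[of n] cos_weight_le[of n] mult_right_mono[of "cos_weight n" 1 "?\<phi> (real n)"]
        by (simp add: abs_mult)
    qed
    then show ?thesis unfolding dkern_def by (subst suminf_minus[symmetric]) (auto simp: mult_ac)
  qed
  ultimately show ?thesis by linarith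
qed

text \<open>
  The diffusion started at \<open>0\<close> is not yet felt at the other end \<open>\<pi>\<close>. Termwise limits are of no use
  here, as they give a divergent series.
\<close>

lemma kern_tendsto_zero: "(kern \<longlongrightarrow> 0) (at_right 0)"
proof (rule Lim_null_comparison)
  show "\<forall>\<^sub>F t in at_right 0. norm (kern t) \<le> t + 108 * t + 108 * zeta32 * t powr (1 / 4)"
    unfolding eventually_at_filter
  proof (intro always_eventually allI impI)
    fix t :: real assume "t \<noteq> 0" "t \<in> {0<..}"
    then have t: "t > 0" by simp
    have "t * t powr (- 3 / 4) = t powr (1 / 4)" using t powr_add[of t 1 "- 3 / 4"] by simp
    moreover have "\<bar>kern t\<bar> \<le> t + 108 * t + 108 * zeta32 * (t * t powr (- 3 / 4))"
      using kern_near_zero[OF t] by (simp add: algebra_simps)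
    ultimately show "norm (kern t) \<le> t + 108 * t + 108 * zeta32 * t powr (1 / 4)"
      by (simp only: real_norm_def)
  qed
  have "((\<lambda>t. t powr (1 / 4)) \<longlongrightarrow> (0::real) powr (1 / 4)) (at_right 0)"
    by (intro tendsto_powr' tendsto_intros) (auto simp: eventually_at_filter)
  then have "((\<lambda>t. t + 108 * t + 108 * zeta32 * t powr (1 / 4)) \<longlongrightarrow> 0 + 108 * 0 + 108 * zeta32 * 0) (at_right 0)"
    by (intro tendsto_intros) simp
  then show "((\<lambda>t. t + 108 * t + 108 * zeta32 * t powr (1 / 4)) \<longlongrightarrow> 0) (at_right 0)" by simp
qed

section \<open>Exponential series on the half-line\<close>

text \<open>
  Transfers explicit gauge integrals over half-lines and intervals to Lebesgue integrals.
\<close>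

lemma nonneg_has_integral_imp_lborel:
  fixes f :: "real \<Rightarrow> real"
  assumes f: "(f has_integral I) S" and S: "S \<in> sets borel" and m: "f \<in> borel_measurable borel"
    and nn: "\<And>x. x \<in> S \<Longrightarrow> f x \<ge> 0"
  shows "integrable lborel (\<lambda>x. indicator S x * f x)" "(LINT x|lborel. indicator S x * f x) = I"
proof -
  have "f absolutely_integrable_on S"
    by (rule nonnegative_absolutely_integrable_1) (use f nn in auto)
  then have "integrable lebesgue (\<lambda>x. indicator S x * f x)" by (simp add: set_integrable_def)
  then show i: "integrable lborel (\<lambda>x. indicator S x * f x)"
    by (subst (asm) integrable_completion) (use S m in auto)
  then have "set_integrable lborel S f" by (simp add: set_integrable_def)
  then have "set_lebesgue_integral lborel S f = integral S f" by (rule set_borel_integral_eq_integral)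
  then show "(LINT x|lborel. indicator S x * f x) = I"
    using f by (simp add: set_lebesgue_integral_def integral_unique)
qed

lemma exp_halfline:
  fixes a :: real
  assumes a: "a > 0"
  shows "integrable lborel (\<lambda>t. indicator {0<..} t * exp (- a * t))"
    and "(LINT t|lborel. indicator {0<..} t * exp (- a * t)) = 1 / a"
proof -
  have "((\<lambda>t. exp (- a * t)) has_integral 1 / a) {0..}"
    using has_integral_exp_minus_to_infinity[OF a, of 0] by simp
  then have "((\<lambda>t. exp (- a * t)) has_integral 1 / a) {0<..}"
    by (subst has_integral_spike_set_eq[where T = "{0..}"]) (auto intro: negligible_subset[of "{0}"])
  from nonneg_has_integral_imp_lborel[OF this]
  show "integrable lborel (\<lambda>t. indicator {0<..} t * exp (- a * t))"
    "(LINT t|lborel. indicator {0<..} t * exp (- a * t)) = 1 / a" by auto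
qed

lemma FTC_halfline:
  fixes F f :: "real \<Rightarrow> real"
  assumes D: "\<And>t. t > 0 \<Longrightarrow> (F has_real_derivative f t) (at t)" and c: "\<And>t. t > 0 \<Longrightarrow> isCont f t"
    and i: "integrable lborel (\<lambda>t. indicator {0<..} t * f t)"
    and A: "(F \<longlongrightarrow> A) (at_right 0)" and B: "(F \<longlongrightarrow> B) at_top"
  shows "(LINT t|lborel. indicator {0<..} t * f t) = B - A"
proof -
  have e: "einterval 0 \<infinity> = {0::real<..}" using einterval_eq_Ici[of 0] by (simp add: zero_ereal_def)
  have "(LBINT t=0..\<infinity>. f t) = B - A"
  proof (rule interval_integral_FTC_integrable[where F = F])
    show "(F has_vector_derivative f x) (at x)" if "0 < ereal x" for x
      using D[of x] that by (simp add: has_real_derivative_iff_has_vector_derivative)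
    show "isCont f x" if "0 < ereal x" for x using c[of x] that by simp
    show "set_integrable lborel (einterval 0 \<infinity>) f" unfolding e using i by (simp add: set_integrable_def)
    show "((F \<circ> real_of_ereal) \<longlongrightarrow> A) (at_right 0)" using A by (simp add: zero_ereal_def ereal_tendsto_simps)
    show "((F \<circ> real_of_ereal) \<longlongrightarrow> B) (at_left \<infinity>)" using B by (simp add: ereal_tendsto_simps)
  qed simp
  then show ?thesis by (simp add: interval_lebesgue_integral_def e set_lebesgue_integral_def)
qed

lemma exp_tendsto_zero: "a > 0 \<Longrightarrow> ((\<lambda>t::real. exp (- a * t)) \<longlongrightarrow> 0) at_top"
  by real_asymp

lemma exp_trig_halfline:
  fixes a w :: real
  assumes a: "a > 0"
  shows "(LINT t|lborel. indicator {0<..} t * (exp (- a * t) * cos (w * t))) = a / (a\<^sup>2 + w\<^sup>2)"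
    and "(LINT t|lborel. indicator {0<..} t * (exp (- a * t) * sin (w * t))) = w / (a\<^sup>2 + w\<^sup>2)"
proof -
  have nz: "a\<^sup>2 + w\<^sup>2 \<noteq> 0" using a by (simp add: sum_power2_eq_zero_iff)
  have i: "integrable lborel (\<lambda>t. indicator {0<..} t * (exp (- a * t) * g t))"
    if "g \<in> borel_measurable borel" "\<And>t. \<bar>g t\<bar> \<le> 1" for g
    using integrable_mult_bounded[OF exp_halfline(1)[OF a], of g 1] that by (simp add: mult.assoc)
  have lim: "((\<lambda>t. exp (- a * t) * h t) \<longlongrightarrow> 0) at_top" if h: "\<And>t. \<bar>h t\<bar> \<le> M" for h and M :: real
  proof (rule Lim_null_comparison)
    show "\<forall>\<^sub>F t in at_top. norm (exp (- a * t) * h t) \<le> exp (- a * t) * M"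
      using h by (intro always_eventually allI) (simp add: abs_mult mult_left_mono)
    show "((\<lambda>t. exp (- a * t) * M) \<longlongrightarrow> 0) at_top" by (rule tendsto_mult_left_zero[OF exp_tendsto_zero[OF a]])
  qed
  let ?C = "\<lambda>t. (w * sin (w * t) - a * cos (w * t)) / (a\<^sup>2 + w\<^sup>2)"
  let ?S = "\<lambda>t. (- w * cos (w * t) - a * sin (w * t)) / (a\<^sup>2 + w\<^sup>2)"
  have bd: "\<bar>p * sin x + q * cos x\<bar> \<le> \<bar>p\<bar> + \<bar>q\<bar>" for p q x :: real
    by (rule order_trans[OF abs_triangle_ineq]) (auto simp: abs_mult intro!: add_mono mult_left_le)
  have "(LINT t|lborel. indicator {0<..} t * (exp (- a * t) * cos (w * t))) = 0 - exp (- a * 0) * ?C 0"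
  proof (rule FTC_halfline)
    show "((\<lambda>t. exp (- a * t) * ?C t) has_real_derivative exp (- a * t) * cos (w * t)) (at t)" for t
    proof -
      have "((\<lambda>t. exp (- a * t) * (w * sin (w * t) - a * cos (w * t)) / (a\<^sup>2 + w\<^sup>2)) has_real_derivative
        (exp (- a * t) * (a\<^sup>2 + w\<^sup>2) * cos (w * t)) / (a\<^sup>2 + w\<^sup>2)) (at t)"
        by (rule DERIV_cdivide) (auto intro!: derivative_eq_intros simp: power2_eq_square algebra_simps)
      then show ?thesis using a by simp
    qed
    show "((\<lambda>t. exp (- a * t) * ?C t) \<longlongrightarrow> exp (- a * 0) * ?C 0) (at_right 0)"
      by (intro tendsto_intros) (use nz in auto)
    have "\<bar>?C t\<bar> \<le> (\<bar>w\<bar> + \<bar>- a\<bar>) / \<bar>a\<^sup>2 + w\<^sup>2\<bar>" for t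
      using bd[of w "w * t" "- a"] unfolding abs_divide by (intro divide_right_mono) auto
    then show "((\<lambda>t. exp (- a * t) * ?C t) \<longlongrightarrow> 0) at_top" by (rule lim)
    show "integrable lborel (\<lambda>t. indicator {0<..} t * (exp (- a * t) * cos (w * t)))" by (rule i) auto
  qed auto
  then show "(LINT t|lborel. indicator {0<..} t * (exp (- a * t) * cos (w * t))) = a / (a\<^sup>2 + w\<^sup>2)" by simp
  have "(LINT t|lborel. indicator {0<..} t * (exp (- a * t) * sin (w * t))) = 0 - exp (- a * 0) * ?S 0"
  proof (rule FTC_halfline)
    show "((\<lambda>t. exp (- a * t) * ?S t) has_real_derivative exp (- a * t) * sin (w * t)) (at t)" for t
    proof -
      have "((\<lambda>t. exp (- a * t) * (- w * cos (w * t) - a * sin (w * t)) / (a\<^sup>2 + w\<^sup>2)) has_real_derivative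
        (exp (- a * t) * (a\<^sup>2 + w\<^sup>2) * sin (w * t)) / (a\<^sup>2 + w\<^sup>2)) (at t)"
        by (rule DERIV_cdivide) (auto intro!: derivative_eq_intros simp: power2_eq_square algebra_simps)
      then show ?thesis using a by simp
    qed
    show "((\<lambda>t. exp (- a * t) * ?S t) \<longlongrightarrow> exp (- a * 0) * ?S 0) (at_right 0)"
      by (intro tendsto_intros) (use nz in auto)
    have "\<bar>?S t\<bar> \<le> (\<bar>- a\<bar> + \<bar>- w\<bar>) / \<bar>a\<^sup>2 + w\<^sup>2\<bar>" for t
      using bd[of "- a" "w * t" "- w"] unfolding abs_divide by (intro divide_right_mono) auto
    then show "((\<lambda>t. exp (- a * t) * ?S t) \<longlongrightarrow> 0) at_top" by (rule lim)
    show "integrable lborel (\<lambda>t. indicator {0<..} t * (exp (- a * t) * sin (w * t)))" by (rule i) auto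
  qed auto
  then show "(LINT t|lborel. indicator {0<..} t * (exp (- a * t) * sin (w * t))) = w / (a\<^sup>2 + w\<^sup>2)" by simp
qed

text \<open>
  Since \<open>exp (- n\<^sup>2 t)\<close> has integral \<open>1 / n\<^sup>2\<close> for \<open>n \<ge> 1\<close>, the hypothesis on \<open>c\<close> is absolute convergence of the series
  in \<open>L\<^sup>1\<close>, and integration term by term is justified.
\<close>

lemma exp_squares_series_halfline:
  fixes c :: "nat \<Rightarrow> real"
  assumes c0: "c 0 = 0" and s: "summable (\<lambda>n. \<bar>c n\<bar> / (real n)\<^sup>2)"
    and p: "\<And>t. t > 0 \<Longrightarrow> summable (\<lambda>n. \<bar>c n\<bar> * exp (- (real n)\<^sup>2 * t))"
    and g[measurable]: "g \<in> borel_measurable borel" and g1: "\<And>t. \<bar>g t\<bar> \<le> 1"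
  shows "integrable lborel (\<lambda>t. indicator {0<..} t * ((\<Sum>n. c n * exp (- (real n)\<^sup>2 * t)) * g t))"
    and "(\<lambda>n. c n * (LINT t|lborel. indicator {0<..} t * (exp (- (real n)\<^sup>2 * t) * g t))) sums
      (LINT t|lborel. indicator {0<..} t * ((\<Sum>n. c n * exp (- (real n)\<^sup>2 * t)) * g t))"
proof -
  define h where "h n t = c n * (indicator {0<..} t * (exp (- (real n)\<^sup>2 * t) * g t))" for n t
  have hb: "\<bar>h n t\<bar> \<le> \<bar>c n\<bar> * (indicator {0<..} t * exp (- (real n)\<^sup>2 * t))" for n t
  proof -
    have "indicator {0<..} t * exp (- (real n)\<^sup>2 * t) * \<bar>g t\<bar> \<le> indicator {0<..} t * exp (- (real n)\<^sup>2 * t) * 1"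
      using g1 by (intro mult_left_mono) auto
    then show ?thesis unfolding h_def by (simp add: abs_mult mult.assoc mult_left_mono)
  qed
  have e: "integrable lborel (\<lambda>t. indicator {0<..} t * exp (- (real n)\<^sup>2 * t))"
    "(LINT t|lborel. indicator {0<..} t * exp (- (real n)\<^sup>2 * t)) = 1 / (real n)\<^sup>2" if "n \<noteq> 0" for n
    using exp_halfline[of "(real n)\<^sup>2"] that by auto
  have hi: "integrable lborel (h n)" for n
  proof (cases "n = 0")
    case True then show ?thesis by (simp add: h_def[abs_def] c0)
  next
    case False
    show ?thesis unfolding h_def[abs_def]
      using integrable_mult_bounded[OF e(1)[OF False], of g 1] g1 by (simp add: mult.assoc)
  qed
  have hn: "(LINT t|lborel. norm (h n t)) \<le> \<bar>c n\<bar> / (real n)\<^sup>2" for n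
  proof (cases "n = 0")
    case True then show ?thesis by (simp add: h_def c0)
  next
    case False
    have "(LINT t|lborel. norm (h n t)) \<le> (LINT t|lborel. \<bar>c n\<bar> * (indicator {0<..} t * exp (- (real n)\<^sup>2 * t)))"
      by (rule integral_mono) (use hi e(1)[OF False] hb in auto)
    then show ?thesis using e(2)[OF False] by simp
  qed
  have ps: "summable (\<lambda>n. norm (h n t))" for t
  proof (cases "t > 0")
    case True
    show ?thesis by (rule summable_comparison_test'[OF p[OF True]]) (use hb[of _ t] True in simp)
  qed (simp add: h_def)
  have ss: "summable (\<lambda>n. LINT t|lborel. norm (h n t))"
    by (rule summable_comparison_test'[OF s]) (use hn in \<open>simp add: integral_nonneg_AE\<close>)
  have sum: "(\<Sum>n. h n t) = indicator {0<..} t * ((\<Sum>n. c n * exp (- (real n)\<^sup>2 * t)) * g t)" for t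
  proof (cases "t > 0")
    case True
    have "summable (\<lambda>n. c n * exp (- (real n)\<^sup>2 * t))"
      by (rule summable_rabs_cancel) (use p[OF True] in \<open>simp add: abs_mult\<close>)
    from suminf_mult2[OF this, of "g t"] show ?thesis using True by (simp add: h_def mult.assoc)
  qed (simp add: h_def)
  note * = integrable_suminf[OF hi always_eventually[OF allI[OF ps]] ss] sums_integral[OF hi always_eventually[OF allI[OF ps]] ss]
  show "integrable lborel (\<lambda>t. indicator {0<..} t * ((\<Sum>n. c n * exp (- (real n)\<^sup>2 * t)) * g t))"
    using *(1) by (simp only: sum)
  show "(\<lambda>n. c n * (LINT t|lborel. indicator {0<..} t * (exp (- (real n)\<^sup>2 * t) * g t))) sums
      (LINT t|lborel. indicator {0<..} t * ((\<Sum>n. c n * exp (- (real n)\<^sup>2 * t)) * g t))"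
    using *(2) unfolding sum by (simp add: h_def)
qed

lemma exp_squares_series_C1:
  assumes b: "\<And>n. \<bar>b n\<bar> \<le> B" and t: "t > 0"
  shows "((\<lambda>t. \<Sum>n. b n * exp (- (real n)\<^sup>2 * t)) has_real_derivative
      (\<Sum>n. - ((real n)\<^sup>2 * b n * exp (- (real n)\<^sup>2 * t)))) (at t)"
    and "isCont (\<lambda>t. \<Sum>n. - ((real n)\<^sup>2 * b n * exp (- (real n)\<^sup>2 * t))) t"
proof -
  define f' where "f' n s = - ((real n)\<^sup>2 * b n * exp (- (real n)\<^sup>2 * s))" for n s
  let ?S = "{t / 2<..}"
  have t2: "t / 2 > 0" using t by simp
  have bd: "norm (f' n s) \<le> B * ((real n)\<^sup>2 * exp (- (real n)\<^sup>2 * (t / 2)))" if "s \<in> ?S" for n s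
  proof -
    have "(real n)\<^sup>2 * (t / 2) \<le> (real n)\<^sup>2 * s" using that by (intro mult_left_mono) auto
    then have "exp (- (real n)\<^sup>2 * s) \<le> exp (- (real n)\<^sup>2 * (t / 2))"
      by (simp only: exp_le_cancel_iff minus_mult_left[symmetric] neg_le_iff_le)
    then have "(real n)\<^sup>2 * exp (- (real n)\<^sup>2 * s) \<le> (real n)\<^sup>2 * exp (- (real n)\<^sup>2 * (t / 2))"
      by (rule mult_left_mono) simp
    from mult_mono[OF b this, of n]
    have "\<bar>b n\<bar> * ((real n)\<^sup>2 * exp (- (real n)\<^sup>2 * s)) \<le> B * ((real n)\<^sup>2 * exp (- (real n)\<^sup>2 * (t / 2)))"
      using order_trans[OF abs_ge_zero b[of n]] by simp
    then show ?thesis by (simp add: f'_def abs_mult mult_ac)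
  qed
  have ul: "uniform_limit ?S (\<lambda>N x. \<Sum>n<N. f' n x) (\<lambda>x. \<Sum>n. f' n x) sequentially"
    by (rule Weierstrass_m_test[OF bd summable_mult[OF summable_square_exp_squares[OF t2]]])
  have 1: "((\<lambda>s. b n * exp (- (real n)\<^sup>2 * s)) has_real_derivative f' n s) (at s within ?S)" for n s
    unfolding f'_def by (auto intro!: derivative_eq_intros)
  have 2: "uniformly_convergent_on ?S (\<lambda>n x. \<Sum>i<n. f' i x)"
    using ul uniformly_convergent_on_def by blast
  have 3: "summable (\<lambda>n. b n * exp (- (real n)\<^sup>2 * t))"
    by (rule summable_comparison_test'[OF summable_mult[OF summable_exp_squares[OF t], of B]])
       (use b in \<open>simp add: abs_mult mult_right_mono\<close>)
  have 4: "t \<in> ?S" using t by simp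
  show "((\<lambda>t. \<Sum>n. b n * exp (- (real n)\<^sup>2 * t)) has_real_derivative
      (\<Sum>n. - ((real n)\<^sup>2 * b n * exp (- (real n)\<^sup>2 * t)))) (at t)"
    using has_field_derivative_series'(2)[OF _ 1 2 4 3, of t] t by (simp add: f'_def interior_open)
  have "continuous_on ?S (\<lambda>s. \<Sum>n. f' n s)"
    by (rule uniform_limit_theorem[OF _ ul]) (auto intro!: always_eventually continuous_intros simp: f'_def)
  then show "isCont (\<lambda>t. \<Sum>n. - ((real n)\<^sup>2 * b n * exp (- (real n)\<^sup>2 * t))) t"
    using 4 by (simp add: continuous_on_eq_continuous_at f'_def)
qed

text \<open>
  For \<open>t \<ge> 1\<close> every term with \<open>n \<ge> 1\<close> is at most \<open>exp (1 - t)\<close> times its value at \<open>t = 1\<close>.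
\<close>

lemma exp_squares_series_decay:
  assumes b: "\<And>n. \<bar>b n\<bar> \<le> B"
  shows "\<exists>C. \<forall>t\<ge>1. \<bar>\<Sum>n. - ((real n)\<^sup>2 * b n * exp (- (real n)\<^sup>2 * t))\<bar> \<le> C * exp (- t)
     \<and> \<bar>(\<Sum>n. b n * exp (- (real n)\<^sup>2 * t)) - b 0\<bar> \<le> C * exp (- t)"
proof -
  define q where "q n = (real n)\<^sup>2 * exp (- (real n)\<^sup>2 * 1)" for n
  have q: "summable q" unfolding q_def by (rule summable_square_exp_squares) simp
  have B0: "B \<ge> 0" using b[of 0] by simp
  define C where "C = B * exp 1 * suminf q"
  have e: "(real n)\<^sup>2 * exp (- (real n)\<^sup>2 * t) \<le> exp (1 - t) * q n" if t: "t \<ge> 1" for n t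
  proof (cases "n = 0")
    case False
    then have "(real n)\<^sup>2 \<ge> 1" by simp
    then have "(real n)\<^sup>2 * (t - 1) \<ge> 1 * (t - 1)" using t by (intro mult_right_mono) auto
    then have "exp (- (real n)\<^sup>2 * t) \<le> exp ((1 - t) + (- (real n)\<^sup>2 * 1))" by (simp add: algebra_simps)
    then have "exp (- (real n)\<^sup>2 * t) \<le> exp (1 - t) * exp (- (real n)\<^sup>2 * 1)" unfolding exp_add .
    then have "(real n)\<^sup>2 * exp (- (real n)\<^sup>2 * t) \<le> (real n)\<^sup>2 * (exp (1 - t) * exp (- (real n)\<^sup>2 * 1))"
      by (intro mult_left_mono) auto
    then show ?thesis by (simp only: q_def mult_ac)
  qed (simp add: q_def)
  show ?thesis
  proof (intro exI allI impI conjI)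
    fix t :: real assume t: "t \<ge> 1"
    have tq: "summable (\<lambda>n. B * (exp (1 - t) * q n))" by (intro summable_mult q)
    have tot: "(\<Sum>n. B * (exp (1 - t) * q n)) = C * exp (- t)"
    proof -
      have "exp (1 - t) = exp 1 * exp (- t)" by (simp add: exp_add[symmetric])
      then have "C * exp (- t) = B * (exp (1 - t) * suminf q)" by (simp only: C_def mult_ac)
      then show ?thesis by (simp only: suminf_mult[OF q] suminf_mult[OF summable_mult[OF q]])
    qed
    have b1: "\<bar>- ((real n)\<^sup>2 * b n * exp (- (real n)\<^sup>2 * t))\<bar> \<le> B * (exp (1 - t) * q n)" for n
    proof -
      have "\<bar>b n\<bar> * ((real n)\<^sup>2 * exp (- (real n)\<^sup>2 * t)) \<le> B * (exp (1 - t) * q n)"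
        by (rule mult_mono[OF b e[OF t]]) (use B0 in auto)
      then show ?thesis by (simp add: abs_mult mult_ac)
    qed
    have s1: "summable (\<lambda>n. \<bar>- ((real n)\<^sup>2 * b n * exp (- (real n)\<^sup>2 * t))\<bar>)"
      by (rule summable_comparison_test'[OF tq]) (use b1 in auto)
    show "\<bar>\<Sum>n. - ((real n)\<^sup>2 * b n * exp (- (real n)\<^sup>2 * t))\<bar> \<le> C * exp (- t)"
      using summable_rabs[OF s1] suminf_le[OF b1 s1 tq] tot by linarith
    define c where "c n = (if n = 0 then 0 else b n * exp (- (real n)\<^sup>2 * t))" for n
    have b2: "\<bar>c n\<bar> \<le> B * (exp (1 - t) * q n)" for n
    proof (cases "n = 0")
      case False
      have "\<bar>b n\<bar> * exp (- (real n)\<^sup>2 * t) * 1 \<le> \<bar>b n\<bar> * exp (- (real n)\<^sup>2 * t) * (real n)\<^sup>2"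
        using False by (intro mult_left_mono) auto
      then have "\<bar>c n\<bar> \<le> \<bar>- ((real n)\<^sup>2 * b n * exp (- (real n)\<^sup>2 * t))\<bar>"
        using False by (simp add: c_def abs_mult mult_ac)
      then show ?thesis using b1[of n] by linarith
    qed (use B0 in \<open>simp add: c_def q_def\<close>)
    have s2: "summable (\<lambda>n. \<bar>c n\<bar>)"
      by (rule summable_comparison_test'[OF tq]) (use b2 in auto)
    have "(\<lambda>n. c n + (if n = 0 then b 0 else 0)) sums (suminf c + b 0)"
      by (intro sums_add summable_sums summable_rabs_cancel[OF s2] sums_single)
    moreover have "c n + (if n = 0 then b 0 else 0) = b n * exp (- (real n)\<^sup>2 * t)" for n
      by (simp add: c_def)
    ultimately have "(\<Sum>n. b n * exp (- (real n)\<^sup>2 * t)) = suminf c + b 0" by (simp add: sums_iff)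
    then show "\<bar>(\<Sum>n. b n * exp (- (real n)\<^sup>2 * t)) - b 0\<bar> \<le> C * exp (- t)"
      using summable_rabs[OF s2] suminf_le[OF b2 s2 tq] tot by simp
  qed
qed

section \<open>The Laplace transform of the kernel on the imaginary axis\<close>

text \<open>
  This is the cosine expansion of \<open>cosh (s x)\<close> evaluated at \<open>x = 0\<close>, divided by \<open>s sinh (s \<pi>)\<close>. With
  \<open>s\<^sup>2 = \<lambda>\<close> the left-hand side is the termwise Laplace transform of \<open>kern\<close>.
\<close>

lemma sinh_partial_fractions:
  fixes s :: complex
  assumes nz: "\<And>n. (of_nat n)\<^sup>2 + s\<^sup>2 \<noteq> 0" and sh: "s * sinh (s * pi) \<noteq> 0"
  shows "(\<lambda>n. complex_of_real (cos_weight n * (-1) ^ n) / ((of_nat n)\<^sup>2 + s\<^sup>2)) sums (1 / (s * sinh (s * pi)))"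
proof -
  define C where "C n = (-1) ^ n * (s * sinh (s * pi)) / ((of_nat n)\<^sup>2 + s\<^sup>2)" for n
  let ?v = "\<lambda>x::real. cosh (s * of_real x)"
  have hi: "((\<lambda>x. ?v x * cos (real n * x)) has_integral C n) {0..pi}" for n
  proof -
    define F where "F x = (s * sinh (s * x) * cos (of_nat n * x) + of_nat n * cosh (s * x) * sin (of_nat n * x)) / ((of_nat n)\<^sup>2 + s\<^sup>2)" for x
    have D: "(F has_field_derivative cosh (s * x) * cos (of_nat n * x)) (at x)" for x
    proof -
      have "((\<lambda>x. s * sinh (s * x) * cos (of_nat n * x) + of_nat n * cosh (s * x) * sin (of_nat n * x)) has_field_derivative
        ((of_nat n)\<^sup>2 + s\<^sup>2) * (cosh (s * x) * cos (of_nat n * x))) (at x)"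
        by (auto intro!: derivative_eq_intros simp: power2_eq_square algebra_simps)
      from DERIV_cdivide[OF this, of "(of_nat n)\<^sup>2 + s\<^sup>2"] show ?thesis
        unfolding F_def using nz[of n] by simp
    qed
    have "((\<lambda>x. cosh (s * of_real x) * cos (of_nat n * of_real x)) has_integral (F (of_real pi) - F (of_real 0))) {0..pi}"
    proof (rule fundamental_theorem_of_calculus)
      show "((\<lambda>x. F (of_real x)) has_vector_derivative cosh (s * of_real x) * cos (of_nat n * of_real x)) (at x within {0..pi})" for x :: real
        by (rule has_vector_derivative_real_field[OF has_field_derivative_at_within[OF D]])
    qed simp
    moreover have "cos (of_nat n * of_real x :: complex) = of_real (cos (real n * x))"
      "sin (of_nat n * of_real x :: complex) = of_real (sin (real n * x))" for x
      by (simp_all add: cos_of_real[symmetric] sin_of_real[symmetric])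
    moreover have "sin (real n * pi) = 0" "cos (real n * pi) = (-1) ^ n"
      by (simp_all add: sin_npi cos_npi)
    ultimately show ?thesis by (simp add: F_def C_def mult_ac)
  qed
  have coeff: "cosine_coeff (\<lambda>x. Re (?v x)) n = Re (C n)" "cosine_coeff (\<lambda>x. Im (?v x)) n = Im (C n)" for n
    using has_integral_linear[OF hi[of n] bounded_linear_Re] has_integral_linear[OF hi[of n] bounded_linear_Im]
    by (auto simp: cosine_coeff_def comp_def intro!: integral_unique)
  have cv: "continuous_on {0..pi} ?v" by (intro continuous_intros)
  have cR: "continuous_on {0..pi} (\<lambda>x. Re (?v x))" "continuous_on {0..pi} (\<lambda>x. Im (?v x))"
    using cv by (auto intro: continuous_on_Re continuous_on_Im)
  have sC: "summable (\<lambda>n. norm (C n))"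
  proof -
    obtain N :: nat where N: "real N > 2 * norm (s\<^sup>2) + 1" using reals_Archimedean2 by blast
    show ?thesis
    proof (rule summable_comparison_test_ev)
      show "summable (\<lambda>n. 2 * norm (s * sinh (s * pi)) * (1 / (real n)\<^sup>2))"
        by (intro summable_mult summable_inverse_squares)
      show "\<forall>\<^sub>F n in sequentially. norm (norm (C n)) \<le> 2 * norm (s * sinh (s * pi)) * (1 / (real n)\<^sup>2)"
        unfolding eventually_sequentially
      proof (intro exI allI impI)
        fix n assume n: "n \<ge> N"
        have n1: "real n > 2 * norm (s\<^sup>2) + 1" using N n by linarith
        then have "real n \<ge> 1" using norm_ge_zero[of "s\<^sup>2"] by linarith
        then have "real n \<le> (real n)\<^sup>2" by (simp add: power2_eq_square)
        then have big: "2 * norm (s\<^sup>2) \<le> (real n)\<^sup>2" using n1 by linarith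
        have "(real n)\<^sup>2 / 2 \<le> (real n)\<^sup>2 - norm (s\<^sup>2)" using big by linarith
        also have "\<dots> = norm ((of_nat n)\<^sup>2 :: complex) - norm (s\<^sup>2)" by (simp add: norm_power)
        also have "\<dots> \<le> norm ((of_nat n)\<^sup>2 + s\<^sup>2)" by (rule norm_diff_ineq)
        finally have den: "(real n)\<^sup>2 / 2 \<le> norm ((of_nat n)\<^sup>2 + s\<^sup>2)" .
        have "norm (C n) = norm (s * sinh (s * pi)) / norm ((of_nat n)\<^sup>2 + s\<^sup>2)"
          by (simp add: C_def norm_mult norm_divide norm_power)
        also have "\<dots> \<le> norm (s * sinh (s * pi)) / ((real n)\<^sup>2 / 2)"
          using den \<open>real n \<ge> 1\<close> nz[of n] by (intro divide_left_mono mult_pos_pos) auto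
        finally show "norm (norm (C n)) \<le> 2 * norm (s * sinh (s * pi)) * (1 / (real n)\<^sup>2)"
          by (simp add: mult.commute)
      qed
    qed
  qed
  have "summable (\<lambda>n. \<bar>Re (C n)\<bar>)" "summable (\<lambda>n. \<bar>Im (C n)\<bar>)"
    by (rule summable_comparison_test'[OF sC]; simp add: abs_Re_le_cmod abs_Im_le_cmod)+
  then have "(\<lambda>n. cos_weight n * Re (C n) * cos (real n * 0)) sums Re (?v 0)"
    "(\<lambda>n. cos_weight n * Im (C n) * cos (real n * 0)) sums Im (?v 0)"
    using cosine_inversion[OF cR(1), of 0] cosine_inversion[OF cR(2), of 0] by (simp_all add: coeff)
  then have "(\<lambda>n. of_real (cos_weight n) * C n) sums 1"
    by (simp add: sums_complex_iff)
  then have "(\<lambda>n. of_real (cos_weight n) * C n / (s * sinh (s * pi))) sums (1 / (s * sinh (s * pi)))"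
    by (rule sums_divide)
  moreover have "of_real (cos_weight n) * C n / (s * sinh (s * pi)) = complex_of_real (cos_weight n * (-1) ^ n) / ((of_nat n)\<^sup>2 + s\<^sup>2)" for n
    using sh by (simp add: C_def)
  ultimately show ?thesis by simp
qed

definition kern_coeff :: "nat \<Rightarrow> real" where
  "kern_coeff n = cos_weight n * (-1) ^ n"

lemma kern_coeff_le: "\<bar>kern_coeff n\<bar> \<le> 1"
  using cos_weight_pos[of n] cos_weight_le[of n] by (simp add: kern_coeff_def abs_mult)

lemma kern_series:
  "kern t = (\<Sum>n. kern_coeff n * exp (- (real n)\<^sup>2 * t))"
  "dkern t = (\<Sum>n. - ((real n)\<^sup>2 * kern_coeff n * exp (- (real n)\<^sup>2 * t)))"
  by (simp_all add: kern_def dkern_def kern_coeff_def)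

lemma kern_deriv: "t > 0 \<Longrightarrow> (kern has_real_derivative dkern t) (at t)"
  and dkern_cont: "t > 0 \<Longrightarrow> isCont dkern t"
  using exp_squares_series_C1[of kern_coeff 1 t, OF kern_coeff_le] unfolding kern_series[abs_def] by auto

lemma kern_decay: "\<exists>C. \<forall>t\<ge>1. \<bar>dkern t\<bar> \<le> C * exp (- t) \<and> \<bar>kern t - 1 / pi\<bar> \<le> C * exp (- t)"
  using exp_squares_series_decay[of kern_coeff 1, OF kern_coeff_le]
  unfolding kern_series[symmetric] by (simp add: kern_coeff_def cos_weight_def)

lemma borel_measurable_halfline:
  fixes f :: "real \<Rightarrow> real"
  assumes "\<And>t. t > 0 \<Longrightarrow> isCont f t"
  shows "(\<lambda>t. indicator {0<..} t * f t) \<in> borel_measurable borel"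
proof -
  have "continuous_on {0<..} f" using assms by (intro continuous_at_imp_continuous_on) auto
  then have "(\<lambda>t. indicator {0<..} t *\<^sub>R f t) \<in> borel_measurable borel"
    by (intro borel_measurable_continuous_on_indicator) auto
  then show ?thesis by simp
qed

text \<open>
  Near \<open>0\<close> this rests on the estimate by \<open>t powr (- 3 / 4)\<close>, far from \<open>0\<close> on exponential decay.
\<close>

lemma dkern_integrable: "integrable lborel (\<lambda>t. indicator {0<..} t * dkern t)"
proof -
  obtain C where C: "\<And>t. t \<ge> 1 \<Longrightarrow> \<bar>dkern t\<bar> \<le> C * exp (- t)" using kern_decay by blast
  have "((\<lambda>t::real. t powr (- 3 / 4)) has_integral (1 powr (- 3 / 4 + 1) / (- 3 / 4 + 1))) {0..1}"
    by (rule has_integral_powr_from_0) auto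
  from nonneg_has_integral_imp_lborel(1)[OF this]
  have p: "integrable lborel (\<lambda>t. indicator {0..1} t * t powr (- 3 / 4) :: real)" by auto
  have o: "integrable lborel (\<lambda>t::real. indicator {0..1} t :: real)"
    by (rule integrable_real_indicator) (auto simp: emeasure_lborel_Icc_eq)
  show ?thesis
  proof (rule Bochner_Integration.integrable_bound)
    show "integrable lborel (\<lambda>t. 271 * indicator {0..1} t + 270 * zeta32 * (indicator {0..1} t * t powr (- 3 / 4))
        + \<bar>C\<bar> * (indicator {0<..} t * exp (- 1 * t)) :: real)"
      by (intro Bochner_Integration.integrable_add integrable_mult_right o p exp_halfline) auto
    show "(\<lambda>t. indicator {0<..} t * dkern t) \<in> borel_measurable lborel"
      using borel_measurable_halfline[OF dkern_cont] by simp
    show "AE t in lborel. norm (indicator {0<..} t * dkern t) \<le> norm (271 * indicator {0..1} t + 270 * zeta32 * (indicator {0..1} t * t powr (- 3 / 4))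
        + \<bar>C\<bar> * (indicator {0<..} t * exp (- 1 * t)))"
    proof (rule AE_I2)
      fix t :: real
      let ?b = "271 * indicator {0..1} t + 270 * zeta32 * (indicator {0..1} t * t powr (- 3 / 4)) + \<bar>C\<bar> * (indicator {0<..} t * exp (- 1 * t))"
      have b0: "?b \<ge> 0" using zeta32(2) by (intro add_nonneg_nonneg mult_nonneg_nonneg) auto
      have "\<bar>indicator {0<..} t * dkern t\<bar> \<le> ?b"
      proof (cases "t > 0")
        case t: True
        show ?thesis
        proof (cases "t \<le> 1")
          case True
          have "\<bar>dkern t\<bar> \<le> 271 + 270 * zeta32 * t powr (- 3 / 4)"
            using dkern_near_zero[OF t] by (simp add: algebra_simps)
          also have "\<dots> \<le> ?b" using t True by simp
          finally show ?thesis using t by simp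
        next
          case False
          have "\<bar>dkern t\<bar> \<le> C * exp (- t)" using C False by simp
          also have "\<dots> \<le> \<bar>C\<bar> * exp (- t)" by (intro mult_right_mono) auto
          finally show ?thesis using t False by (simp add: abs_mult)
        qed
      qed (use b0 in simp)
      then show "norm (indicator {0<..} t * dkern t) \<le> norm ?b" using b0 by simp
    qed
  qed
qed

lemma kern_eq_integral:
  assumes t: "t > 0"
  shows "kern t = (LINT r|lborel. indicator {0<..<t} r * dkern r)"
proof -
  have i: "set_integrable lborel {0<..<t} dkern"
  proof -
    have "integrable lborel (\<lambda>r. indicator {0<..} r * dkern r * indicator {0<..<t} r)"
      by (rule integrable_mult_bounded[OF dkern_integrable, of _ 1]) auto
    moreover have "indicator {0<..} r * dkern r * indicator {0<..<t} r = indicator {0<..<t} r * dkern r" for r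
      by (auto simp: indicator_def)
    ultimately show ?thesis by (simp add: set_integrable_def)
  qed
  have e: "einterval 0 (ereal t) = {0<..<t}" using einterval_eq_Icc[of 0 t] by (simp add: zero_ereal_def)
  have "(LBINT r=0..ereal t. dkern r) = kern t - 0"
  proof (rule interval_integral_FTC_integrable[where F = kern])
    show "(0::ereal) < ereal t" using t by simp
    show "(kern has_vector_derivative dkern x) (at x)" if "0 < ereal x" for x
      using kern_deriv[of x] that by (simp add: has_real_derivative_iff_has_vector_derivative)
    show "isCont dkern x" if "0 < ereal x" for x using dkern_cont[of x] that by simp
    show "set_integrable lborel (einterval 0 (ereal t)) dkern" unfolding e by (rule i)
    show "((kern \<circ> real_of_ereal) \<longlongrightarrow> 0) (at_right 0)"
      using kern_tendsto_zero by (simp add: zero_ereal_def ereal_tendsto_simps)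
    have "(kern \<longlongrightarrow> kern t) (at_left t)"
      using DERIV_isCont[OF kern_deriv[OF t]] by (auto simp: isCont_def intro: tendsto_mono[OF at_le])
    then show "((kern \<circ> real_of_ereal) \<longlongrightarrow> kern t) (at_left (ereal t))"
      by (simp add: ereal_tendsto_simps)
  qed
  then show ?thesis using t by (simp add: interval_lebesgue_integral_def e set_lebesgue_integral_def)
qed

text \<open>
  The constant \<open>1 / \<pi>\<close>, the term with \<open>n = 0\<close>, is removed because it is not integrable on the
  half-line.
\<close>

lemma kern_transform:
  "integrable lborel (\<lambda>t. indicator {0<..} t * (kern t - 1 / pi))"
  "(\<lambda>n. kern_coeff (Suc n) * ((real (Suc n))\<^sup>2 / (((real (Suc n))\<^sup>2)\<^sup>2 + w\<^sup>2))) sums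
     (LINT t|lborel. indicator {0<..} t * ((kern t - 1 / pi) * cos (w * t)))"
  "(\<lambda>n. kern_coeff (Suc n) * (w / (((real (Suc n))\<^sup>2)\<^sup>2 + w\<^sup>2))) sums
     (LINT t|lborel. indicator {0<..} t * ((kern t - 1 / pi) * sin (w * t)))"
  "integrable lborel (\<lambda>t. indicator {0<..} t * ((kern t - 1 / pi) * sin (w * t)))"
proof -
  define c where "c n = (if n = 0 then 0 else kern_coeff n)" for n
  have c: "c 0 = 0" "\<bar>c n\<bar> \<le> 1" for n using kern_coeff_le[of n] by (auto simp: c_def)
  have s1: "summable (\<lambda>n. \<bar>c n\<bar> / (real n)\<^sup>2)"
    by (rule summable_comparison_test'[OF summable_inverse_squares]) (use c in \<open>simp add: divide_right_mono\<close>)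
  have s2: "summable (\<lambda>n. \<bar>c n\<bar> * exp (- (real n)\<^sup>2 * t))" if "t > 0" for t
    by (rule summable_comparison_test'[OF summable_exp_squares[OF that]]) (use c in \<open>simp add: mult_left_le_one_le\<close>)
  have k: "(\<Sum>n. c n * exp (- (real n)\<^sup>2 * t)) = kern t - 1 / pi" if "t > 0" for t
  proof -
    have "summable (\<lambda>n. c n * exp (- (real n)\<^sup>2 * t))"
      by (rule summable_rabs_cancel) (use s2[OF that] in \<open>simp add: abs_mult\<close>)
    then have "(\<lambda>n. c n * exp (- (real n)\<^sup>2 * t) + (if n = 0 then 1 / pi else 0)) sums
        ((\<Sum>n. c n * exp (- (real n)\<^sup>2 * t)) + 1 / pi)"
      by (intro sums_add summable_sums sums_single)
    moreover have "c n * exp (- (real n)\<^sup>2 * t) + (if n = 0 then 1 / pi else 0) = kern_coeff n * exp (- (real n)\<^sup>2 * t)" for n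
      by (simp add: c_def kern_coeff_def cos_weight_def)
    ultimately show ?thesis by (simp add: kern_series(1) sums_iff)
  qed
  have k': "indicator {0<..} t * ((\<Sum>n. c n * exp (- (real n)\<^sup>2 * t)) * g t) = indicator {0<..} t * ((kern t - 1 / pi) * g t)" for g t
    using k[of t] by (cases "t > 0") auto
  show "integrable lborel (\<lambda>t. indicator {0<..} t * (kern t - 1 / pi))"
    using exp_squares_series_halfline(1)[OF c(1) s1 s2, of "\<lambda>_. 1"] unfolding k'[where g = "\<lambda>_. 1"] by simp
  show "integrable lborel (\<lambda>t. indicator {0<..} t * ((kern t - 1 / pi) * sin (w * t)))"
    using exp_squares_series_halfline(1)[OF c(1) s1 s2, of "\<lambda>t. sin (w * t)"]
    unfolding k'[where g = "\<lambda>t. sin (w * t)"] by simp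
  have shift: "(\<lambda>n. h (Suc n)) sums l" if "h sums l" "h 0 = 0" for h :: "nat \<Rightarrow> real" and l
    using that by (simp add: sums_Suc_iff)
  have "(\<lambda>n. c (Suc n) * (LINT t|lborel. indicator {0<..} t * (exp (- (real (Suc n))\<^sup>2 * t) * cos (w * t)))) sums
     (LINT t|lborel. indicator {0<..} t * ((kern t - 1 / pi) * cos (w * t)))"
    using exp_squares_series_halfline(2)[OF c(1) s1 s2, of "\<lambda>t. cos (w * t)"] unfolding k'[where g = "\<lambda>t. cos (w * t)"]
    by (intro shift) (auto simp: c(1))
  then show "(\<lambda>n. kern_coeff (Suc n) * ((real (Suc n))\<^sup>2 / (((real (Suc n))\<^sup>2)\<^sup>2 + w\<^sup>2))) sums
     (LINT t|lborel. indicator {0<..} t * ((kern t - 1 / pi) * cos (w * t)))"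
    by (subst (asm) exp_trig_halfline) (auto simp: c_def)
  have "(\<lambda>n. c (Suc n) * (LINT t|lborel. indicator {0<..} t * (exp (- (real (Suc n))\<^sup>2 * t) * sin (w * t)))) sums
     (LINT t|lborel. indicator {0<..} t * ((kern t - 1 / pi) * sin (w * t)))"
    using exp_squares_series_halfline(2)[OF c(1) s1 s2, of "\<lambda>t. sin (w * t)"] unfolding k'[where g = "\<lambda>t. sin (w * t)"]
    by (intro shift) (auto simp: c(1))
  then show "(\<lambda>n. kern_coeff (Suc n) * (w / (((real (Suc n))\<^sup>2)\<^sup>2 + w\<^sup>2))) sums
     (LINT t|lborel. indicator {0<..} t * ((kern t - 1 / pi) * sin (w * t)))"
    by (subst (asm) exp_trig_halfline) (auto simp: c_def)
qed

text \<open>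
  Integration by parts; termwise integration of the cosine transform of \<open>dkern\<close> would give a series that does
  not converge absolutely. The boundary value at \<open>0\<close> is \<open>- 1 / \<pi>\<close> because \<open>kern\<close> vanishes there.
\<close>

lemma dkern_cos_transform:
  "(LINT t|lborel. indicator {0<..} t * (dkern t * cos (w * t)))
     = 1 / pi + w * (LINT t|lborel. indicator {0<..} t * ((kern t - 1 / pi) * sin (w * t)))"
proof -
  let ?F = "\<lambda>t. (kern t - 1 / pi) * cos (w * t)"
  have i1: "integrable lborel (\<lambda>t. indicator {0<..} t * (dkern t * cos (w * t)))"
    using integrable_mult_bounded[OF dkern_integrable, of "\<lambda>t. cos (w * t)" 1] by (simp add: mult.assoc)
  note i2 = kern_transform(4)[of w]
  have eq: "indicator {0<..} t * (dkern t * cos (w * t) - w * ((kern t - 1 / pi) * sin (w * t)))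
     = indicator {0<..} t * (dkern t * cos (w * t)) - w * (indicator {0<..} t * ((kern t - 1 / pi) * sin (w * t)))" for t
    by (simp add: algebra_simps)
  have "(LINT t|lborel. indicator {0<..} t * (dkern t * cos (w * t) - w * ((kern t - 1 / pi) * sin (w * t)))) = 0 - (0 - 1 / pi) * cos (w * 0)"
  proof (rule FTC_halfline)
    fix t :: real assume t: "t > 0"
    show "(?F has_real_derivative dkern t * cos (w * t) - w * ((kern t - 1 / pi) * sin (w * t))) (at t)"
      by (auto intro!: derivative_eq_intros kern_deriv[OF t] simp: algebra_simps)
    show "isCont (\<lambda>t. dkern t * cos (w * t) - w * ((kern t - 1 / pi) * sin (w * t))) t"
      by (intro continuous_intros dkern_cont[OF t] DERIV_isCont[OF kern_deriv[OF t]])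
  next
    show "integrable lborel (\<lambda>t. indicator {0<..} t * (dkern t * cos (w * t) - w * ((kern t - 1 / pi) * sin (w * t))))"
      unfolding eq by (intro Bochner_Integration.integrable_diff integrable_mult_right i1 i2)
    show "(?F \<longlongrightarrow> (0 - 1 / pi) * cos (w * 0)) (at_right 0)"
      by (intro tendsto_intros kern_tendsto_zero)
    obtain C where C: "\<And>t. t \<ge> 1 \<Longrightarrow> \<bar>kern t - 1 / pi\<bar> \<le> C * exp (- t)" using kern_decay by blast
    show "(?F \<longlongrightarrow> 0) at_top"
    proof (rule Lim_null_comparison)
      show "\<forall>\<^sub>F t in at_top. norm (?F t) \<le> C * exp (- 1 * t)"
        using eventually_ge_at_top[of 1]
      proof eventually_elim
        case (elim t)
        have "norm (?F t) \<le> \<bar>kern t - 1 / pi\<bar>" by (simp add: abs_mult mult_left_le)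
        also have "\<dots> \<le> C * exp (- 1 * t)" using C[OF elim] by simp
        finally show ?case .
      qed
      show "((\<lambda>t. C * exp (- 1 * t)) \<longlongrightarrow> 0) at_top"
        by (rule tendsto_mult_right_zero[OF exp_tendsto_zero]) simp
    qed
  qed
  then show ?thesis unfolding eq using i1 i2 by simp
qed

section \<open>The Popov inequality\<close>

text \<open>
  With \<open>s = (1 + i) z\<close> one has \<open>s sinh s = z (- diagR z + i diagS z)\<close>, so these two functions
  describe the reciprocal of the transfer function on the imaginary axis.
\<close>

definition diagR :: "real \<Rightarrow> real" where
  "diagR z = cosh z * sin z - sinh z * cos z"

definition diagS :: "real \<Rightarrow> real" where
  "diagS z = cosh z * sin z + sinh z * cos z"

lemma diagR_deriv: "(diagR has_real_derivative 2 * sin z * sinh z) (at z)"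
  unfolding diagR_def by (auto intro!: derivative_eq_intros)

lemma diagS_deriv: "(diagS has_real_derivative 2 * cos z * cosh z) (at z)"
  unfolding diagS_def by (auto intro!: derivative_eq_intros)

lemma diagR_diagS_squares: "(diagR z)\<^sup>2 + (diagS z)\<^sup>2 = cosh (2 * z) - cos (2 * z)"
proof -
  have "(diagR z)\<^sup>2 + (diagS z)\<^sup>2 = 2 * ((cosh z)\<^sup>2 * (sin z)\<^sup>2 + (sinh z)\<^sup>2 * (cos z)\<^sup>2)"
    by (simp add: diagR_def diagS_def power2_eq_square algebra_simps)
  also have "\<dots> = 2 * ((sinh z)\<^sup>2 + (sin z)\<^sup>2)"
    unfolding cosh_square_eq cos_squared_eq by (simp add: algebra_simps)
  also have "\<dots> = cosh (2 * z) - cos (2 * z)"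
    unfolding cosh_double cos_double cosh_square_eq cos_squared_eq by simp
  finally show ?thesis .
qed

lemma diag_mult_sinh:
  fixes z :: real
  defines "s \<equiv> Complex z z"
  shows "s * sinh s = Complex (- z * diagR z) (z * diagS z)"
proof -
  have "sinh s = Complex (sinh z * cos z) (cosh z * sin z)"
    by (simp add: complex_eq_iff s_def sinh_def cosh_def Re_exp Im_exp algebra_simps)
  then show ?thesis by (simp add: s_def complex_eq_iff diagR_def diagS_def algebra_simps)
qed

lemma sums_residue_mod_4:
  fixes f :: "nat \<Rightarrow> real"
  assumes "f sums l" "\<And>n. n mod 4 \<noteq> r \<Longrightarrow> f n = 0" "r < 4"
  shows "(\<lambda>n. f (4 * n + r)) sums l"
proof -
  have "strict_mono (\<lambda>n. 4 * n + r)" by (auto simp: strict_mono_def)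
  moreover have "f n = 0" if "n \<notin> range (\<lambda>n. 4 * n + r)" for n
  proof (rule assms(2), rule notI)
    assume "n mod 4 = r"
    then have "n = 4 * (n div 4) + r" by (metis mult_div_mod_eq)
    then show False using that by blast
  qed
  ultimately show ?thesis using sums_mono_reindex[of "\<lambda>n. 4 * n + r" f l] assms(1) by blast
qed

lemma diag_power: "(Complex z z) ^ (4 * n) = of_real ((-4) ^ n * z ^ (4 * n))"
proof -
  have "(Complex z z) ^ 4 = of_real (-4 * z ^ 4)"
    by (simp add: eval_nat_numeral complex_eq_iff algebra_simps)
  then have "(Complex z z) ^ (4 * n) = of_real ((-4 * z ^ 4) ^ n)"
    by (simp only: power_mult of_real_power)
  then show ?thesis by (simp only: power_mult power_mult_distrib)
qed

text \<open>
  In \<open>s sinh s = \<Sum> s\<^sup>2\<^sup>m\<^sup>+\<^sup>2 / (2m+1)!\<close> the powers of \<open>s\<^sup>2 = 2 i z\<^sup>2\<close> are alternately imaginary and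
  real. So each of the two series contains only every fourth power of \<open>z\<close>.
\<close>

lemma diagRS_sums:
  "(\<lambda>n. 2 * (-4) ^ n * z ^ (4 * n + 2) / fact (4 * n + 1)) sums (z * diagS z)"
  "(\<lambda>n. 4 * (-4) ^ n * z ^ (4 * n + 4) / fact (4 * n + 3)) sums (z * diagR z)"
proof -
  define s where "s = Complex z z"
  define a where "a n = s * (if even n then 0 else s ^ n /\<^sub>R fact n)" for n
  have a: "a sums (s * sinh s)" unfolding a_def by (intro sums_mult sinh_converges)
  have a': "(\<lambda>n. Re (a n)) sums (- z * diagR z)" "(\<lambda>n. Im (a n)) sums (z * diagS z)"
    using sums_Re[OF a] sums_Im[OF a] diag_mult_sinh[of z] by (auto simp: s_def)
  have pw: "s ^ (4 * n + r) = of_real ((-4) ^ n * z ^ (4 * n)) * s ^ r" for n r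
    by (simp add: power_add s_def diag_power)
  have a4: "a (4 * n + r) = (if even r then 0 else of_real ((-4) ^ n * z ^ (4 * n) / fact (4 * n + r)) * s ^ Suc r)" for n r
    unfolding a_def pw by (auto simp: scaleR_conv_of_real divide_inverse)
  have ReIm: "Re (a (4 * n + r)) = (if even r then 0 else (-4) ^ n * z ^ (4 * n) / fact (4 * n + r) * Re (s ^ Suc r))"
     "Im (a (4 * n + r)) = (if even r then 0 else (-4) ^ n * z ^ (4 * n) / fact (4 * n + r) * Im (s ^ Suc r))" for n r
  proof -
    have "Re (complex_of_real c * w) = c * Re w" "Im (complex_of_real c * w) = c * Im w" for c w
      by simp_all
    then show "Re (a (4 * n + r)) = (if even r then 0 else (-4) ^ n * z ^ (4 * n) / fact (4 * n + r) * Re (s ^ Suc r))"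
     "Im (a (4 * n + r)) = (if even r then 0 else (-4) ^ n * z ^ (4 * n) / fact (4 * n + r) * Im (s ^ Suc r))"
      unfolding a4 by (simp_all only: if_distrib[of Re] if_distrib[of Im] zero_complex.sel)
  qed
  have s2: "Re (s ^ Suc 1) = 0" "Im (s ^ Suc 1) = 2 * z ^ 2" "Re (s ^ Suc 3) = -4 * z ^ 4" "Im (s ^ Suc 3) = 0"
    by (simp_all add: s_def eval_nat_numeral algebra_simps)
  have re: "Re (a n) = 0" if "n mod 4 \<noteq> 3" for n
  proof -
    have "n mod 4 \<in> {0,1,2}" using that by auto
    then have "Re (a (4 * (n div 4) + n mod 4)) = 0"
      unfolding ReIm by (elim insertE emptyE) (simp_all only: s2, simp_all)
    then show ?thesis by simp
  qed
  have im: "Im (a n) = 0" if "n mod 4 \<noteq> 1" for n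
  proof -
    have "n mod 4 \<in> {0,2,3}" using that by auto
    then have "Im (a (4 * (n div 4) + n mod 4)) = 0"
      unfolding ReIm by (elim insertE emptyE) (simp_all only: s2, simp_all)
    then show ?thesis by simp
  qed
  have "(\<lambda>n. Im (a (4 * n + 1))) sums (z * diagS z)"
    by (rule sums_residue_mod_4[OF a'(2) im]) auto
  moreover have "Im (a (4 * n + 1)) = 2 * (-4) ^ n * z ^ (4 * n + 2) / fact (4 * n + 1)" for n
    unfolding ReIm s2 by (simp add: power_add power2_eq_square)
  ultimately show "(\<lambda>n. 2 * (-4) ^ n * z ^ (4 * n + 2) / fact (4 * n + 1)) sums (z * diagS z)"
    by (simp only:)
  have "(\<lambda>n. - Re (a (4 * n + 3))) sums (- (- z * diagR z))"
    by (rule sums_minus[OF sums_residue_mod_4[OF a'(1) re]]) auto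
  moreover have "Re (a (4 * n + 3)) = - (4 * (-4) ^ n * z ^ (4 * n + 4) / fact (4 * n + 3))" for n
    unfolding ReIm s2 by (simp add: power_add)
  ultimately show "(\<lambda>n. 4 * (-4) ^ n * z ^ (4 * n + 4) / fact (4 * n + 3)) sums (z * diagR z)"
    by (simp only: minus_minus mult_minus_left)
qed

lemma diag_norm_sums:
  fixes z :: real
  shows
  "(\<lambda>n. 2 * 2 ^ (4 * n + 2) * z ^ (4 * n + 2) / fact (4 * n + 2)) sums (cosh (2 * z) - cos (2 * z))"
proof -
  define a where "a n = (if even n then (2 * z) ^ n /\<^sub>R fact n else 0) - cos_coeff n *\<^sub>R (2 * z) ^ n" for n
  have "a sums (cosh (2 * z) - cos (2 * z))"
    unfolding a_def by (intro sums_diff cosh_converges cos_converges)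
  moreover have "a n = 0" if "n mod 4 \<noteq> 2" for n
  proof (cases "even n")
    case True
    then obtain k where k: "n = 2 * k" by blast
    have "even k" using that k by (metis mod_mult_mult1 mult_2_right numeral_Bit0 odd_iff_mod_2_eq_one mult.right_neutral mult_numeral_1_right)
    then show ?thesis by (simp add: a_def k cos_coeff_def divide_inverse)
  qed (simp add: a_def cos_coeff_def)
  ultimately have "(\<lambda>n. a (4 * n + 2)) sums (cosh (2 * z) - cos (2 * z))"
    by (rule sums_residue_mod_4) auto
  moreover have "a (4 * n + 2) = 2 * 2 ^ (4 * n + 2) * z ^ (4 * n + 2) / fact (4 * n + 2)" for n
  proof -
    have "(4 * n + 2) div 2 = Suc (2 * n)" by simp
    then show ?thesis by (simp add: a_def cos_coeff_def power_mult_distrib divide_inverse)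
  qed
  ultimately show ?thesis by simp
qed


text \<open>
  The coefficients of \<open>popov_defect p c z / z\<^sup>3\<close> as a power series in \<open>z\<^sup>4\<close>.
\<close>

definition defect_coeff :: "real \<Rightarrow> real \<Rightarrow> nat \<Rightarrow> real" where
  "defect_coeff p c n = 2 * p * (-4) ^ n / fact (4 * n + 1) + 8 * c * 16 ^ n / fact (4 * n + 2)
     - 4 * (-4) ^ n / fact (4 * n + 3)"

text \<open>
  The inequality \<open>Re ((1 + i\<omega>q) G(i\<omega>)) \<ge> - 1 / \<beta>\<^sub>0\<close> multiplied by the positive denominator, with
  \<open>\<omega> = 2 z\<^sup>2 / \<pi>\<^sup>2\<close>, \<open>p = 2 q / \<pi>\<^sup>2\<close> and \<open>c = 1 / (\<pi> \<beta>\<^sub>0)\<close>.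
\<close>

definition popov_defect :: "real \<Rightarrow> real \<Rightarrow> real \<Rightarrow> real" where
  "popov_defect p c z = p * z\<^sup>2 * diagS z + c * z * ((diagR z)\<^sup>2 + (diagS z)\<^sup>2) - diagR z"

lemma popov_defect_sums: "(\<lambda>n. z ^ 4 * (defect_coeff p c n * (z ^ 4) ^ n)) sums (z * popov_defect p c z)"
proof -
  have "(\<lambda>n. p * z\<^sup>2 * (2 * (-4) ^ n * z ^ (4 * n + 2) / fact (4 * n + 1))
     + c * z\<^sup>2 * (2 * 2 ^ (4 * n + 2) * z ^ (4 * n + 2) / fact (4 * n + 2))
     - 4 * (-4) ^ n * z ^ (4 * n + 4) / fact (4 * n + 3)) sums
     (p * z\<^sup>2 * (z * diagS z) + c * z\<^sup>2 * (cosh (2 * z) - cos (2 * z)) - z * diagR z)"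
    by (intro sums_add sums_diff sums_mult diagRS_sums diag_norm_sums)
  also have "(p * z\<^sup>2 * (z * diagS z) + c * z\<^sup>2 * (cosh (2 * z) - cos (2 * z)) - z * diagR z) = z * popov_defect p c z"
    unfolding diagR_diagS_squares[symmetric] by (simp add: popov_defect_def power2_eq_square algebra_simps)
  also have "(\<lambda>n. p * z\<^sup>2 * (2 * (-4) ^ n * z ^ (4 * n + 2) / fact (4 * n + 1))
     + c * z\<^sup>2 * (2 * 2 ^ (4 * n + 2) * z ^ (4 * n + 2) / fact (4 * n + 2))
     - 4 * (-4) ^ n * z ^ (4 * n + 4) / fact (4 * n + 3)) = (\<lambda>n. z ^ 4 * (defect_coeff p c n * (z ^ 4) ^ n))"
  proof
    fix n
    have "z\<^sup>2 * z ^ (4 * n + 2) = z ^ 4 * (z ^ 4) ^ n" "z ^ (4 * n + 4) = z ^ 4 * (z ^ 4) ^ n"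
      by (simp_all add: power_add power_mult power2_eq_square power4_eq_xxxx)
    moreover have "(2::real) ^ (4 * n + 2) = 4 * 16 ^ n" by (simp add: power_add power_mult)
    moreover have "p * Z2 * (2 * E * Z / f1) + c * Z2 * (2 * (4 * H) * Z / f2) - 4 * E * W / f3
      = ZZ * (2 * p * E / f1 + 8 * c * H / f2 - 4 * E / f3)" if "Z2 * Z = ZZ" "W = ZZ" for Z2 Z ZZ W E H f1 f2 f3 :: real
      unfolding that(2) by (simp add: that(1)[symmetric] algebra_simps)
    ultimately have "p * z\<^sup>2 * (2 * (-4) ^ n * z ^ (4 * n + 2) / fact (4 * n + 1))
     + c * z\<^sup>2 * (2 * 2 ^ (4 * n + 2) * z ^ (4 * n + 2) / fact (4 * n + 2))
     - 4 * (-4) ^ n * z ^ (4 * n + 4) / fact (4 * n + 3) = z ^ 4 * (z ^ 4) ^ n * defect_coeff p c n"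
      unfolding defect_coeff_def by metis
    then show "p * z\<^sup>2 * (2 * (-4) ^ n * z ^ (4 * n + 2) / fact (4 * n + 1))
     + c * z\<^sup>2 * (2 * 2 ^ (4 * n + 2) * z ^ (4 * n + 2) / fact (4 * n + 2))
     - 4 * (-4) ^ n * z ^ (4 * n + 4) / fact (4 * n + 3) = z ^ 4 * (defect_coeff p c n * (z ^ 4) ^ n)"
      by (simp only: mult_ac)
  qed
  finally show ?thesis .
qed

lemma power_above_tangent:
  fixes x a :: real
  assumes "x \<ge> 0" "a \<ge> 0"
  shows "real n * a ^ (n - 1) * (x - a) \<le> x ^ n - a ^ n"
proof (induction n)
  case (Suc n)
  show ?case
  proof (cases n)
    case (Suc m)
    have "x ^ Suc n - a ^ Suc n - real (Suc n) * a ^ n * (x - a) =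
      x * (x ^ n - a ^ n - real n * a ^ (n - 1) * (x - a)) + real n * a ^ (n - 1) * (x - a)\<^sup>2"
      unfolding Suc by (simp add: power2_eq_square algebra_simps)
    also have "\<dots> \<ge> 0"
      using Suc.IH assms by (intro add_nonneg_nonneg mult_nonneg_nonneg) auto
    finally show ?thesis by simp
  qed simp
qed simp

text \<open>
  The terms of order \<open>0\<close> and \<open>1\<close> coincide with their tangents, whatever their sign, and the others
  are convex.
\<close>

lemma power_series_above_tangent:
  fixes q :: "nat \<Rightarrow> real"
  assumes q: "\<And>n. n \<ge> 2 \<Longrightarrow> q n \<ge> 0" and s: "\<And>x. x \<ge> 0 \<Longrightarrow> summable (\<lambda>n. q n * x ^ n)"
    and xa: "x \<ge> 0" "a \<ge> 0"
  shows "(\<Sum>n. diffs q n * a ^ n) * (x - a) \<le> (\<Sum>n. q n * x ^ n) - (\<Sum>n. q n * a ^ n)"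
proof -
  have "summable (\<lambda>n. diffs q n * a ^ n)"
  proof (rule termdiff_converges)
    show "norm a < a + 1" using xa by simp
    show "summable (\<lambda>n. q n * y ^ n)" if "norm y < a + 1" for y
      by (rule powser_inside[OF s[of "a + 1"]]) (use that xa in auto)
  qed
  then have "(\<lambda>n. real n * q n * a ^ (n - Suc 0)) sums (\<Sum>n. diffs q n * a ^ n)"
    by (rule diffs_equiv)
  then have 1: "(\<lambda>n. real n * q n * a ^ (n - Suc 0) * (x - a)) sums ((\<Sum>n. diffs q n * a ^ n) * (x - a))"
    by (rule sums_mult2)
  have 2: "(\<lambda>n. q n * x ^ n - q n * a ^ n) sums ((\<Sum>n. q n * x ^ n) - (\<Sum>n. q n * a ^ n))"
    by (intro sums_diff summable_sums s xa)
  show ?thesis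
  proof (rule sums_le[OF _ 1 2])
    fix n :: nat
    consider "n = 0" | "n = 1" | "n \<ge> 2" by linarith
    then show "real n * q n * a ^ (n - Suc 0) * (x - a) \<le> q n * x ^ n - q n * a ^ n"
    proof cases
      case 3
      then show ?thesis
        using mult_left_mono[OF power_above_tangent[OF xa, of n] q[OF 3]] by (simp add: algebra_simps)
    qed (simp_all add: algebra_simps)
  qed
qed

text \<open>
  The function increases on \<open>[0, \<pi>/2]\<close> and decreases on \<open>[\<pi>/2, \<pi>]\<close>; it is positive at \<open>3\<pi>/4\<close>,
  where it equals \<open>exp (- 3\<pi>/4) / \<surd>2\<close>, and negative at \<open>\<pi>\<close>.
\<close>

lemma diagS_first_zero:
  obtains z0 where "3 * pi / 4 < z0" "z0 < pi" "diagS z0 = 0" "\<And>z. 0 < z \<Longrightarrow> z < z0 \<Longrightarrow> diagS z > 0"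
proof -
  have "diagS (3 * pi / 4) > 0"
  proof -
    have "cos (3 * pi / 4) = - cos (pi / 4)" "sin (3 * pi / 4) = sin (pi / 4)"
      using cos_pi_minus[of "pi / 4"] sin_pi_minus[of "pi / 4"] by (simp_all add: field_simps)
    then have "diagS (3 * pi / 4) = sqrt 2 / 2 * (cosh (3 * pi / 4) - sinh (3 * pi / 4))"
      by (simp add: diagS_def cos_45 sin_45 algebra_simps)
    also have "\<dots> = sqrt 2 / 2 * exp (- (3 * pi / 4))" by (simp only: cosh_minus_sinh)
    also have "\<dots> > 0" by simp
    finally show ?thesis .
  qed
  moreover have pi: "diagS pi < 0" by (simp add: diagS_def)
  moreover have "continuous_on {3 * pi / 4..pi} diagS"
    by (rule DERIV_continuous_on[OF has_field_derivative_at_within[OF diagS_deriv]])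
  ultimately obtain z0 where z0: "3 * pi / 4 \<le> z0" "z0 \<le> pi" "diagS z0 = 0"
    using IVT2'[of diagS pi 0 "3 * pi / 4"] by auto
  have dec: "diagS z > diagS z0" if z: "pi / 2 < z" "z < z0" for z
  proof (rule DERIV_neg_imp_decreasing[OF z(2)])
    fix x assume x: "z \<le> x" "x \<le> z0"
    have "- cos x = sin (x - pi / 2)" by (simp add: sin_diff)
    also have "\<dots> > 0" by (rule sin_gt_zero) (use x z z0 in auto)
    finally have "2 * cos x * cosh x < 0" by (simp add: mult_neg_pos)
    then show "\<exists>y. (diagS has_real_derivative y) (at x) \<and> y < 0" using diagS_deriv by blast
  qed
  show thesis
  proof (rule that)
    show "3 * pi / 4 < z0" using z0 \<open>diagS (3 * pi / 4) > 0\<close> by (cases "z0 = 3 * pi / 4") auto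
    show "z0 < pi" using z0 pi by (cases "z0 = pi") auto
    show "diagS z > 0" if z: "0 < z" "z < z0" for z
    proof (cases "z > pi / 2")
      case True then show ?thesis using dec[of z] z z0 by simp
    next
      case False
      have "sin z > 0" "cos z \<ge> 0" using z False by (auto intro!: sin_gt_zero cos_ge_zero)
      then show ?thesis using z unfolding diagS_def by (intro add_pos_nonneg) auto
    qed
  qed (rule z0)
qed

text \<open>
  For even \<open>n\<close> the first summand dominates the third one. For odd \<open>n \<ge> 3\<close> the first summand is
  negative, and the second one, which grows by a factor \<open>16\<close> instead of \<open>4\<close>, dominates it from
  \<open>n = 3\<close> on. For \<open>n = 1\<close> the coefficient may be negative.
\<close>

lemma defect_coeff_nonneg:
  assumes p: "1 / 55 \<le> p" and c: "14 * p \<le> 256 * c" and n: "n \<ge> 2"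
  shows "defect_coeff p c n \<ge> 0"
proof -
  have c0: "c \<ge> 0" using p c by simp
  have f: "fact (4 * n + 3) = (4 * real n + 3) * fact (4 * n + 2)" "fact (4 * n + 2) = (4 * real n + 2) * fact (4 * n + 1)"
    by (simp_all add: fact_reduce numeral_3_eq_3 numeral_2_eq_2)
  have nz: "4 * real n + 2 \<noteq> 0" "4 * real n + 3 \<noteq> 0" by linarith+
  define F :: real where "F = fact (4 * n + 3)"
  have F: "F > 0" by (simp add: F_def)
  have "defect_coeff p c n = (2 * p * (-4) ^ n * ((4 * real n + 2) * (4 * real n + 3)) + 8 * c * 16 ^ n * (4 * real n + 3) - 4 * (-4) ^ n) / F"
  proof -
    have "u / g + v / (A * g) - w / (B * (A * g)) = (u * (A * B) + v * B - w) / (B * (A * g))"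
      if "A \<noteq> 0" "B \<noteq> 0" "g \<noteq> 0" for u v w A B g :: real
      using that by (simp add: field_simps)
    then show ?thesis unfolding defect_coeff_def F_def f by (simp only: fact_nonzero not_False_eq_True nz)
  qed
  also have "2 * p * (-4) ^ n * ((4 * real n + 2) * (4 * real n + 3)) + 8 * c * 16 ^ n * (4 * real n + 3) - 4 * (-4) ^ n
    = (-4) ^ n * (2 * p * (4 * real n + 2) * (4 * real n + 3) - 4) + 8 * c * 16 ^ n * (4 * real n + 3)"
    by (simp add: algebra_simps)
  also have "\<dots> / F \<ge> 0"
  proof (rule divide_nonneg_pos[OF _ F])
    have nn: "real n \<ge> 2" using n by simp
    have "(1/55) * (10 * 11) \<le> p * ((4 * real n + 2) * (4 * real n + 3))"
      using p nn by (intro mult_mono) auto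
    then have P: "2 * p * (4 * real n + 2) * (4 * real n + 3) - 4 \<ge> 0" by (simp add: mult.assoc)
    show "(-4) ^ n * (2 * p * (4 * real n + 2) * (4 * real n + 3) - 4) + 8 * c * 16 ^ n * (4 * real n + 3) \<ge> 0"
    proof (cases "even n")
      case True
      then show ?thesis using P c0 by (intro add_nonneg_nonneg mult_nonneg_nonneg) (auto simp: zero_le_even_power)
    next
      case False
      then have "n \<ge> 3" using n by (cases "n = 2") auto
      then have ind: "p * (4 * real n + 2) \<le> 4 * c * 4 ^ n"
      proof (induction n rule: dec_induct)
        case base
        then show ?case using c by simp
      next
        case (step n)
        have "p * (4 * real (Suc n) + 2) \<le> 4 * (p * (4 * real n + 2))"
          using p by (simp add: algebra_simps)
        also have "\<dots> \<le> 4 * (4 * c * 4 ^ n)" using step.IH by simp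
        finally show ?case by simp
      qed
      have "2 * p * (4 * real n + 2) * (4 * real n + 3) - 4 \<le> 2 * (4 * real n + 3) * (p * (4 * real n + 2))"
        by (simp add: algebra_simps)
      also have "\<dots> \<le> 2 * (4 * real n + 3) * (4 * c * 4 ^ n)" by (intro mult_left_mono ind) auto
      finally have "4 ^ n * (2 * p * (4 * real n + 2) * (4 * real n + 3) - 4) \<le> 4 ^ n * (2 * (4 * real n + 3) * (4 * c * 4 ^ n))"
        by (intro mult_left_mono) auto
      also have "\<dots> = 8 * c * 16 ^ n * (4 * real n + 3)"
        by (simp add: algebra_simps power_mult_distrib[symmetric])
      finally show ?thesis using False by (simp add: power_minus_odd)
    qed
  qed
  finally show ?thesis .
qed

text \<open>
  The choice of \<open>c\<close> makes the defect vanish at \<open>z0\<close>, and \<open>p\<close> is chosen such that its derivative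
  vanishes there as well. Then the power series in \<open>z\<^sup>4\<close> has the axis as its tangent at \<open>z0\<^sup>4\<close> and lies
  above it by convexity.
\<close>

lemma popov_defect_nonneg:
  assumes z0: "3 * pi / 4 < z0" "z0 < pi" "diagS z0 = 0"
  obtains p where "p > 0" "\<And>z. z > 0 \<Longrightarrow> popov_defect p (1 / (z0 * diagR z0)) z \<ge> 0"
proof -
  define c where "c = 1 / (z0 * diagR z0)"
  define th where "th = sinh z0 / cosh z0"
  \<comment> \<open>The solution of the linear equation for \<open>p\<close> that expresses vanishing of the derivative at \<open>z0\<close>.\<close>
  define p where "p = th * (th + 1 / z0) / z0\<^sup>2"
  have "pi > 3.14" "pi < 3.15" using pi_approx by simp_all
  then have z235: "z0 > 2.35" and zpi: "z0 < 3.15" using z0 by simp_all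
  have sc: "sin z0 = - cos z0 * th" "sin z0 > 0"
    using z0 z235 by (auto simp: diagS_def th_def field_simps intro!: sin_gt_zero)
  have R0: "diagR z0 = 2 * sin z0 * cosh z0" using z0(3) by (simp add: diagR_def diagS_def)
  have Rpos: "diagR z0 > 0" unfolding R0 using sc(2) by (intro mult_pos_pos) auto
  have th: "0.6 \<le> th" "th < 1"
  proof -
    have "exp (2 * z0) \<ge> 1 + 2 * z0" by (rule exp_ge_add_one_self)
    moreover have "z0 \<ge> 2" using z235 by simp
    ultimately have "exp (2 * z0) \<ge> 4" by linarith
    then have e: "exp z0 * exp z0 \<ge> 4" by (simp add: exp_add[symmetric])
    have "0.6 * cosh z0 \<le> sinh z0"
      using mult_left_mono[OF e, of "exp (- z0)"] 
      by (simp add: cosh_field_def sinh_field_def exp_minus field_simps)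
    then show "0.6 \<le> th" by (simp add: th_def field_simps)
    show "th < 1" by (simp add: th_def sinh_less_cosh_real)
  qed
  have p: "1 / 55 \<le> p"
  proof -
    have "z0 * z0 \<le> 3.15 * 3.15" using zpi z235 by (intro mult_mono) auto
    then have "0.36 / 10 \<le> 0.6 * 0.6 / z0\<^sup>2"
      using z235 by (simp add: power2_eq_square field_simps)
    also have "\<dots> \<le> p" unfolding p_def
      using th z235 by (intro divide_right_mono mult_mono) (auto intro: add_increasing2)
    finally show ?thesis by simp
  qed
  have pc: "14 * p \<le> 256 * c"
  proof -
    have "exp (z0 - 3) \<le> 1.2"
    proof -
      define d where "d = z0 - 3"
      have "1 - d \<le> exp (- d)" using exp_ge_add_one_self[of "- d"] by simp
      then have "0.85 \<le> exp (- d)" using zpi by (simp add: d_def)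
      then show ?thesis unfolding d_def[symmetric] by (simp add: exp_minus field_simps)
    qed
    moreover have "exp 3 = exp (1::real) ^ 3" using exp_of_nat_mult[of 3 "1::real"] by simp
    moreover have "exp (1::real) ^ 3 \<le> 2.72 ^ 3" using e_less_272 by (intro power_mono) auto
    ultimately have "exp 3 * exp (z0 - 3) \<le> 2.72 ^ 3 * 1.2" by (intro mult_mono) auto
    also have "exp 3 * exp (z0 - 3) = exp z0" unfolding exp_add[symmetric] by simp
    finally have e: "exp z0 \<le> 25" by (simp add: power3_eq_cube)
    have "diagR z0 \<le> 2 * 1 * cosh z0" unfolding R0 by (intro mult_right_mono mult_left_mono) auto
    also have "\<dots> = exp z0 + exp (- z0)" by (simp add: cosh_field_def)
    also have "\<dots> \<le> 25 + 1" using e z235 by (intro add_mono) auto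
    finally have R26: "diagR z0 \<le> 26" by simp
    have "p * z0 = th * (th + 1 / z0) / z0" using z235 by (simp add: p_def power2_eq_square)
    also have "\<dots> \<le> 1 * (1 + 1 / 2.35) / 2.35"
      using th z235 by (intro frac_le mult_mono add_mono divide_left_mono) auto
    finally have "p * z0 * diagR z0 \<le> (1 + 1 / 2.35) / 2.35 * 26"
      using R26 Rpos p z235 by (intro mult_mono) auto
    then have "14 * p * (z0 * diagR z0) \<le> 256" by (simp add: mult.assoc)
    then show ?thesis using Rpos z235 by (simp add: c_def field_simps)
  qed
  define Q where "Q x = (\<Sum>n. defect_coeff p c n * x ^ n)" for x
  have sums: "(\<lambda>n. defect_coeff p c n * (z ^ 4) ^ n) sums (popov_defect p c z / z ^ 3)" if "z > 0" for z
  proof -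
    have "(\<lambda>n. z ^ 4 * (defect_coeff p c n * (z ^ 4) ^ n) / z ^ 4) sums (z * popov_defect p c z / z ^ 4)"
      by (rule sums_divide[OF popov_defect_sums])
    then show ?thesis using that by (simp add: power4_eq_xxxx power3_eq_cube)
  qed
  have s: "summable (\<lambda>n. defect_coeff p c n * x ^ n)" if "x \<ge> 0" for x
  proof (cases "x = 0")
    case True then show ?thesis using summable_0_powser[of "defect_coeff p c"] by simp
  next
    case False
    then have "(root 4 x) ^ 4 = x" "root 4 x > 0" using that by auto
    then show ?thesis using sums[of "root 4 x"] by (auto simp: sums_iff)
  qed
  have NQ: "popov_defect p c z = z ^ 3 * Q (z ^ 4)" if "z > 0" for z
    using sums_unique[OF sums[OF that]] that by (simp add: Q_def field_simps)
  define Q' where "Q' = (\<Sum>n. diffs (defect_coeff p c) n * (z0 ^ 4) ^ n)"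
  have dQ: "(Q has_real_derivative Q') (at (z0 ^ 4))"
    unfolding Q_def Q'_def
    by (rule termdiffs_strong[OF s[of "z0 ^ 4 + 1"]]) auto
  have cR: "c * z0 * diagR z0 = 1" using Rpos z235 by (simp add: c_def)
  have N0: "popov_defect p c z0 = 0" using cR z0(3) by (simp add: popov_defect_def power2_eq_square)
  then have Q0: "Q (z0 ^ 4) = 0" using NQ[of z0] z235 by simp
  have "(popov_defect p c has_real_derivative (p * (2 * z0) * diagS z0 + p * z0\<^sup>2 * (2 * cos z0 * cosh z0)
     + c * ((diagR z0)\<^sup>2 + (diagS z0)\<^sup>2) + c * z0 * (2 * diagR z0 * (2 * sin z0 * sinh z0) + 2 * diagS z0 * (2 * cos z0 * cosh z0))
     - 2 * sin z0 * sinh z0)) (at z0)"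
    unfolding popov_defect_def
    by (auto intro!: derivative_eq_intros diagR_deriv diagS_deriv simp: algebra_simps)
  also have "(p * (2 * z0) * diagS z0 + p * z0\<^sup>2 * (2 * cos z0 * cosh z0)
     + c * ((diagR z0)\<^sup>2 + (diagS z0)\<^sup>2) + c * z0 * (2 * diagR z0 * (2 * sin z0 * sinh z0) + 2 * diagS z0 * (2 * cos z0 * cosh z0))
     - 2 * sin z0 * sinh z0) = p * z0\<^sup>2 * (2 * cos z0 * cosh z0) + diagR z0 / z0 + 2 * sin z0 * sinh z0"
  proof -
    have "c * (diagR z0)\<^sup>2 = (c * z0 * diagR z0) * diagR z0 / z0" using z235 by (simp add: power2_eq_square)
    then have 1: "c * (diagR z0)\<^sup>2 = diagR z0 / z0" using cR by simp
    have "c * z0 * (2 * diagR z0 * (2 * sin z0 * sinh z0)) = (c * z0 * diagR z0) * (4 * sin z0 * sinh z0)" by simp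
    then have 2: "c * z0 * (2 * diagR z0 * (2 * sin z0 * sinh z0)) = 4 * sin z0 * sinh z0" using cR by simp
    show ?thesis using 1 2 z0(3) by simp
  qed
  also have "p * z0\<^sup>2 * (2 * cos z0 * cosh z0) + diagR z0 / z0 + 2 * sin z0 * sinh z0 = 0"
  proof -
    have ch: "sinh z0 = th * cosh z0" by (simp add: th_def)
    have pz: "p * z0\<^sup>2 = th * (th + 1 / z0)" using z235 by (simp add: p_def)
    show ?thesis unfolding R0 pz ch sc(1) by (simp add: algebra_simps)
  qed
  finally have dN: "(popov_defect p c has_real_derivative 0) (at z0)" .
  have "((\<lambda>z. z ^ 3 * Q (z ^ 4)) has_real_derivative (z0 ^ 3 * (Q' * (4 * z0 ^ 3)))) (at z0)"
  proof -
    have 4: "((\<lambda>z. z ^ 4) has_real_derivative 4 * z0 ^ 3) (at z0)"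
      by (auto intro!: derivative_eq_intros)
    have 3: "((\<lambda>z. z ^ 3) has_real_derivative 3 * z0 ^ 2) (at z0)"
      by (auto intro!: derivative_eq_intros)
    show ?thesis
      using DERIV_mult[OF 3 DERIV_chain2[OF dQ 4]] Q0 by (simp add: mult.commute)
  qed
  then have "(popov_defect p c has_real_derivative (z0 ^ 3 * (Q' * (4 * z0 ^ 3)))) (at z0)"
    by (rule has_field_derivative_transform_within_open[where S = "{0<..}"]) (use z235 NQ in auto)
  then have "z0 ^ 3 * (Q' * (4 * z0 ^ 3)) = 0" using dN DERIV_unique by blast
  then have Q'0: "Q' = 0" using z235 by simp
  have "Q x \<ge> 0" if "x \<ge> 0" for x
    using power_series_above_tangent[of "defect_coeff p c" x "z0 ^ 4", OF defect_coeff_nonneg[OF p pc] s that] Q'0 Q0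
    by (simp add: Q_def Q'_def)
  then have "popov_defect p c z \<ge> 0" if "z > 0" for z using NQ[OF that] that by simp
  then show thesis using that[of p] p by (simp add: c_def)
qed

lemma char_fun_eq:
  assumes "\<omega> > 0"
  defines "z \<equiv> pi * sqrt (\<omega> / 2)"
  shows "char_fun \<omega> = Complex (z * diagR z / pi) (z * diagS z / pi)"
proof -
  have 1: "csqrt (\<i> * \<omega>) = Complex (z / pi) (z / pi)"
    using assms by (simp add: complex_eq_iff norm_mult)
  have 2: "Complex (z / pi) (z / pi) * pi = Complex z z" by (simp add: complex_eq_iff)
  have 3: "sin (Complex z z) = Complex (sin z * cosh z) (cos z * sinh z)"
    by (simp add: complex_eq_iff Re_sin Im_sin cosh_def sinh_def field_simps)
  show ?thesis
    unfolding char_fun_def 1 2 3 by (simp add: complex_eq_iff diagR_def diagS_def field_simps)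
qed

text \<open>
  In the variable \<open>z = \<pi> \<surd>(\<omega>/2)\<close> the condition that defines \<open>\<omega>\<^sub>0\<close> is \<open>diagS z = 0\<close> with
  \<open>diagR z > 0\<close>, and the second part holds automatically at the first zero.
\<close>

lemma beta0_eq:
  assumes z0: "0 < z0" "z0 < pi" "diagS z0 = 0" "\<And>z. 0 < z \<Longrightarrow> z < z0 \<Longrightarrow> diagS z > 0"
  shows "beta0 = z0 * diagR z0 / pi" "diagR z0 > 0"
proof -
  have R0: "diagR z0 = 2 * sin z0 * cosh z0" using z0(3) by (simp add: diagR_def diagS_def)
  show Rpos: "diagR z0 > 0" using z0 by (simp add: R0 sin_gt_zero)
  define w where "w = 2 * (z0 / pi)\<^sup>2"
  have w: "w > 0" "pi * sqrt (w / 2) = z0" using z0 by (auto simp: w_def)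
  have ow: "omega0 = w"
    unfolding omega0_def
  proof (rule Least_equality)
    show "w > 0 \<and> char_fun w \<in> complex_of_real ` {0<..}"
      using w z0 Rpos unfolding char_fun_eq[OF w(1)] w(2)
      by (auto intro!: image_eqI[of _ _ "z0 * diagR z0 / pi"] simp: complex_eq_iff)
    fix v assume v: "v > 0 \<and> char_fun v \<in> complex_of_real ` {0<..}"
    define z where "z = pi * sqrt (v / 2)"
    have z: "z > 0" using v by (simp add: z_def)
    have "z * diagS z / pi = 0" using v char_fun_eq[of v] by (auto simp: z_def complex_eq_iff)
    then have "diagS z = 0" using z by simp
    then have "z0 \<le> z" using z0(4)[of z] z by force
    then have "sqrt (w / 2) \<le> sqrt (v / 2)" unfolding w(2)[symmetric] z_def by simp
    then show "w \<le> v" by simp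
  qed
  show "beta0 = z0 * diagR z0 / pi"
    by (simp only: beta0_def ow char_fun_eq[OF w(1)] w(2) complex.sel)
qed

theorem popov_inequality:
  obtains p where "p > 0" "beta0 > 0" "\<And>z. z > 0 \<Longrightarrow> popov_defect p (1 / (pi * beta0)) z \<ge> 0"
proof -
  obtain z0 where z0: "3 * pi / 4 < z0" "z0 < pi" "diagS z0 = 0" "\<And>z. 0 < z \<Longrightarrow> z < z0 \<Longrightarrow> diagS z > 0"
    using diagS_first_zero by blast
  have "0 < z0" using z0(1) pi_gt_zero by linarith
  note b = beta0_eq[OF this z0(2-4)]
  obtain p where "p > 0" "\<And>z. z > 0 \<Longrightarrow> popov_defect p (1 / (z0 * diagR z0)) z \<ge> 0"
    using popov_defect_nonneg[OF z0(1-3)] by blast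
  moreover have "pi * beta0 = z0 * diagR z0" "beta0 > 0" using b(2) \<open>0 < z0\<close> by (simp_all add: b(1))
  ultimately show thesis using that[of p] by simp
qed

section \<open>Quadratic forms of convolution operators\<close>

lemma integral_cos_std_normal: "(LINT x|std_normal_distribution. cos (t * x)) = exp (- t\<^sup>2 / 2)"
proof -
  interpret prob_space std_normal_distribution by (rule prob_space_normal_density) simp
  have "exp (- t\<^sup>2 / 2) = Re (char std_normal_distribution t)"
    by (simp add: char_std_normal_distribution)
  also have "\<dots> = (LINT x|std_normal_distribution. Re (iexp (t * x)))"
    unfolding char_def
    by (rule integral_Re[symmetric]) (auto intro!: integrable_const_bound[of _ 1])
  also have "\<dots> = (LINT x|std_normal_distribution. cos (t * x))"
    by (simp add: Re_exp)
  finally show ?thesis by simp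
qed

text \<open>
  The signals to which the frequency condition is applied: restrictions to \<open>(0,T)\<close> of continuous
  functions. Discontinuities at the end points are unavoidable, hence the exceptional set.
\<close>

locale bounded_signal =
  fixes W :: "real \<Rightarrow> real" and T B :: real and X :: "real set"
  assumes W_measurable[measurable]: "W \<in> borel_measurable borel"
    and W_bound: "\<And>t. \<bar>W t\<bar> \<le> B"
    and W_support: "\<And>t. t \<notin> {0..T} \<Longrightarrow> W t = 0"
    and X_finite: "finite X"
    and W_cont: "\<And>t. t \<notin> X \<Longrightarrow> isCont W t"
begin

text \<open>
  The autocorrelation function.
\<close>

definition "acf u = (LINT t|lborel. W t * W (t - u))"

lemma B_nonneg: "B \<ge> 0" using W_bound[of 0] by simp

lemma acf_integrand_le: "\<bar>W t * W (t - u)\<bar> \<le> B\<^sup>2 * indicator {0..T} t"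
  using W_support[of t] mult_mono[OF W_bound[of t] W_bound[of "t - u"] B_nonneg]
  by (cases "t \<in> {0..T}") (auto simp: abs_mult power2_eq_square)

lemma integrable_box: "integrable lborel (\<lambda>t. C * indicator {0..T} t :: real)"
proof -
  have "integrable lborel (indicator {0..T} :: real \<Rightarrow> real)"
    by (rule integrable_real_indicator) (auto simp: emeasure_lborel_Icc_eq)
  then show ?thesis by simp
qed

lemma W_integrable: "integrable lborel W"
  by (rule Bochner_Integration.integrable_bound[OF integrable_box[of B]])
     (use W_bound W_support B_nonneg in \<open>auto simp: indicator_def\<close>)

lemma acf_integrand_integrable: "integrable lborel (\<lambda>t. W t * W (t - u))"
  by (rule Bochner_Integration.integrable_bound[OF integrable_box[of "B\<^sup>2"]])
     (use acf_integrand_le in \<open>auto intro: order_trans[OF acf_integrand_le]\<close>)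

lemma acf_measurable[measurable]: "acf \<in> borel_measurable borel"
  unfolding acf_def by measurable

lemma acf_isCont: "isCont acf u"
  unfolding continuous_at_sequentially comp_def
proof (intro allI impI)
  fix v assume v: "v \<longlonglongrightarrow> u"
  show "(\<lambda>n. acf (v n)) \<longlonglongrightarrow> acf u"
    unfolding acf_def
  proof (rule integral_dominated_convergence[OF _ _ integrable_box[of "B\<^sup>2"]])
    have "AE t in lborel. t \<notin> (\<lambda>x. x + u) ` X"
      by (rule AE_not_in) (use X_finite in \<open>auto intro!: finite_imp_null_set_lborel\<close>)
    then show "AE t in lborel. (\<lambda>n. W t * W (t - v n)) \<longlonglongrightarrow> W t * W (t - u)"
    proof eventually_elim
      case (elim t)
      then have "t - u \<notin> X" by (auto intro: image_eqI[of _ _ "t - u"])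
      then have "isCont W (t - u)" by (rule W_cont)
      moreover have "(\<lambda>n. t - v n) \<longlonglongrightarrow> t - u" by (intro tendsto_intros v)
      ultimately have "(\<lambda>n. W (t - v n)) \<longlonglongrightarrow> W (t - u)" by (rule isCont_tendsto_compose)
      then show ?case by (intro tendsto_intros)
    qed
  qed (use acf_integrand_le in auto)
qed

lemma acf_bound: "\<bar>acf u\<bar> \<le> (LINT t|lborel. B\<^sup>2 * indicator {0..T} t)"
proof -
  have "norm (acf u) \<le> (LINT t|lborel. norm (W t * W (t - u)))"
    unfolding acf_def by (rule integral_norm_bound)
  also have "\<dots> \<le> (LINT t|lborel. B\<^sup>2 * indicator {0..T} t)"
    by (rule integral_mono) (use acf_integrand_integrable integrable_box acf_integrand_le in auto)
  finally show ?thesis by simp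
qed

lemma acf_even: "acf (- u) = acf u"
  unfolding acf_def
  by (subst lborel_integral_real_affine[of 1 _ "- u"]) (simp_all add: mult.commute)

lemma acf_support: "\<bar>u\<bar> > T \<Longrightarrow> acf u = 0"
proof -
  assume u: "\<bar>u\<bar> > T"
  have "t \<notin> {0..T} \<or> t - u \<notin> {0..T}" for t using u by auto
  then have "W t * W (t - u) = 0" for t
    using W_support[of t] W_support[of "t - u"] by (metis mult_eq_0_iff)
  then show ?thesis by (simp only: acf_def Bochner_Integration.integral_zero)
qed

lemma acf_integrable: "integrable lborel acf"
proof (rule Bochner_Integration.integrable_bound)
  let ?C = "LINT t|lborel. B\<^sup>2 * indicator {0..T} t"
  have "integrable lborel (indicator {-T..T} :: real \<Rightarrow> real)"
    by (rule integrable_real_indicator) (auto simp: emeasure_lborel_Icc_eq)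
  then show "integrable lborel (\<lambda>u. ?C * indicator {-T..T} u)" by simp
  show "AE u in lborel. norm (acf u) \<le> norm (?C * indicator {-T..T} u)"
  proof (rule AE_I2)
    fix u show "norm (acf u) \<le> norm (?C * indicator {-T..T} u)"
      using acf_bound[of u] acf_support[of u] by (cases "\<bar>u\<bar> > T") (auto simp: indicator_def)
  qed
qed simp

text \<open>
  The easy half of the Wiener-Khinchin theorem: the transform of the autocorrelation is the squared
  modulus of the transform of the signal, hence nonnegative.
\<close>

lemma acf_cos_transform:
  "(LINT v|lborel. acf v * cos (w * v)) = (LINT t|lborel. W t * cos (w * t))\<^sup>2 + (LINT t|lborel. W t * sin (w * t))\<^sup>2"
proof -
  let ?c = "LINT t|lborel. W t * cos (w * t)" and ?s = "LINT t|lborel. W t * sin (w * t)"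
  have ic: "integrable lborel (\<lambda>t. W t * cos (w * t))" "integrable lborel (\<lambda>t. W t * sin (w * t))"
    by (auto intro!: integrable_mult_bounded[OF W_integrable, of _ 1])
  have in1: "integrable lborel (\<lambda>v. W (t - v) * cos (w * v))" for t
    using lborel_integrable_real_affine[OF W_integrable, of "-1" t]
    by (auto intro!: integrable_mult_bounded[of lborel "\<lambda>v. W (t - v)" _ 1])
  have inner: "(LINT v|lborel. W (t - v) * cos (w * v)) = cos (w * t) * ?c + sin (w * t) * ?s" for t
  proof -
    have "(LINT v|lborel. W (t - v) * cos (w * v)) = (LINT s|lborel. W s * cos (w * (t - s)))"
      by (subst lborel_integral_real_affine[of "-1" _ t]) simp_all
    also have "\<dots> = (LINT s|lborel. cos (w * t) * (W s * cos (w * s)) + sin (w * t) * (W s * sin (w * s)))"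
      by (intro Bochner_Integration.integral_cong refl) (simp add: right_diff_distrib cos_diff algebra_simps)
    also have "\<dots> = cos (w * t) * ?c + sin (w * t) * ?s"
      using ic by simp
    finally show ?thesis .
  qed
  have int: "integrable (lborel \<Otimes>\<^sub>M lborel) (\<lambda>(t, v). W t * W (t - v) * cos (w * v))"
  proof (rule lborel_pair.Fubini_integrable)
    have 1: "(LINT v|lborel. \<bar>W (t - v)\<bar>) = (LINT v|lborel. \<bar>W v\<bar>)" for t
      by (subst lborel_integral_real_affine[of "-1" _ t]) simp_all
    show "integrable lborel (\<lambda>t. LINT v|lborel. norm (case (t, v) of (t, v) \<Rightarrow> W t * W (t - v) * cos (w * v)))"
    proof (rule Bochner_Integration.integrable_bound)
      show "integrable lborel (\<lambda>t. W t * (LINT v|lborel. \<bar>W v\<bar>))" using W_integrable by simp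
      have "norm (LINT v|lborel. norm (W t * W (t - v) * cos (w * v))) \<le> norm (W t * (LINT v|lborel. \<bar>W v\<bar>))" for t
      proof -
        have "norm (LINT v|lborel. norm (W t * W (t - v) * cos (w * v))) = (LINT v|lborel. norm (W t * W (t - v) * cos (w * v)))"
          by (simp add: integral_nonneg_AE)
        also have "\<dots> \<le> (LINT v|lborel. \<bar>W t\<bar> * \<bar>W (t - v)\<bar>)"
        proof (rule integral_mono)
          show "integrable lborel (\<lambda>v. norm (W t * W (t - v) * cos (w * v)))"
            using integrable_mult_right[OF in1[of t], of "W t"] by (simp add: mult.assoc)
          show "integrable lborel (\<lambda>v. \<bar>W t\<bar> * \<bar>W (t - v)\<bar>)"
            using lborel_integrable_real_affine[OF W_integrable, of "-1" t] by simp
        qed (simp add: abs_mult mult_left_le)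
        also have "\<dots> = norm (W t * (LINT v|lborel. \<bar>W v\<bar>))" by (simp add: 1 abs_mult integral_nonneg_AE)
        finally show ?thesis .
      qed
      then show "AE t in lborel. norm (LINT v|lborel. norm (case (t, v) of (t, v) \<Rightarrow> W t * W (t - v) * cos (w * v)))
        \<le> norm (W t * (LINT v|lborel. \<bar>W v\<bar>))" by simp
    qed measurable
    show "AE t in lborel. integrable lborel (\<lambda>v. case (t, v) of (t, v) \<Rightarrow> W t * W (t - v) * cos (w * v))"
      using integrable_mult_right[OF in1] by (simp add: mult.assoc)
  qed measurable
  have "(LINT v|lborel. acf v * cos (w * v)) = (LINT v|lborel. LINT t|lborel. W t * W (t - v) * cos (w * v))"
    by (simp add: acf_def)
  also have "\<dots> = (LINT t|lborel. LINT v|lborel. W t * W (t - v) * cos (w * v))"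
    using int by (rule lborel_pair.Fubini_integral)
  also have "\<dots> = (LINT t|lborel. W t * (LINT v|lborel. W (t - v) * cos (w * v)))"
    by (simp only: mult.assoc integral_mult_right_zero)
  also have "\<dots> = (LINT t|lborel. ?c * (W t * cos (w * t)) + ?s * (W t * sin (w * t)))"
    unfolding inner by (intro Bochner_Integration.integral_cong refl) (simp add: algebra_simps)
  also have "\<dots> = ?c\<^sup>2 + ?s\<^sup>2" using ic by (simp add: power2_eq_square)
  finally show ?thesis .
qed

text \<open>
  The substitution \<open>v = r - s / n\<close> turns the convolution with a narrow Gaussian into an average of \<open>acf\<close>
  near \<open>r\<close>.
\<close>

lemma acf_smoothing:
  assumes "n > 0"
  shows "(LINT v|lborel. acf v * exp (- (n * (r - v))\<^sup>2 / 2)) = sqrt (2 * pi) / n * (LINT s|lborel. acf (r - s / n) * std_normal_density s)"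
proof -
  have "(LINT v|lborel. acf v * exp (- (n * (r - v))\<^sup>2 / 2)) = (1 / n) * (LINT s|lborel. acf (r - s / n) * exp (- s\<^sup>2 / 2))"
    using assms by (subst lborel_integral_real_affine[of "- 1 / n" _ r]) simp_all
  also have "(\<lambda>s. acf (r - s / n) * exp (- s\<^sup>2 / 2)) = (\<lambda>s. sqrt (2 * pi) * (acf (r - s / n) * std_normal_density s))"
    by (simp add: std_normal_density_def)
  finally show ?thesis by simp
qed

text \<open>
  A substitute for Plancherel's theorem. The product of \<open>C(\<omega>) + c\<close>, where \<open>C\<close> is the cosine
  transform of \<open>K\<close>, with the nonnegative transform of the autocorrelation is averaged over a normal
  distribution of standard deviation \<open>n\<close>. Fubini's theorem turns the average into the claim with the
  autocorrelation replaced by a smoothed version, which converges as \<open>n\<close> tends to infinity.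
\<close>

theorem quadratic_form_lower_bound:
  fixes K :: "real \<Rightarrow> real"
  assumes K: "integrable lborel K"
    and freq: "\<And>w. w \<noteq> 0 \<Longrightarrow> (LINT r|lborel. K r * cos (w * r)) \<ge> - c"
  shows "(LINT r|lborel. K r * acf r) + c * acf 0 \<ge> 0"
proof -
  let ?N = std_normal_distribution
  interpret N: prob_space ?N by (rule prob_space_normal_density) simp
  define S where "S w = (LINT v|lborel. acf v * cos (w * v))" for w
  define C where "C w = (LINT r|lborel. K r * cos (w * r))" for w
  define G where "G n u = exp (- (n * u)\<^sup>2 / 2)" for n u :: real
  define \<psi> where "\<psi> n r = (LINT s|lborel. acf (r - s / n) * std_normal_density s)" for n r
  note [measurable] = borel_measurable_integrable[OF K]
  have S0: "S w \<ge> 0" for w by (simp add: S_def acf_cos_transform)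
  have Sm[measurable]: "S \<in> borel_measurable borel" unfolding S_def by measurable
  have Cm[measurable]: "C \<in> borel_measurable borel" unfolding C_def by measurable
  define SB where "SB = (LINT v|lborel. \<bar>acf v\<bar>)"
  define CB where "CB = (LINT v|lborel. \<bar>K v\<bar>)"
  have transform_bound: "\<bar>LINT v|lborel. h v * cos (w * v)\<bar> \<le> (LINT v|lborel. \<bar>h v\<bar>)" if h: "integrable lborel h" for h :: "real \<Rightarrow> real" and w
  proof -
    note [measurable] = borel_measurable_integrable[OF h]
    have i: "integrable lborel (\<lambda>v. h v * cos (w * v))"
      by (auto intro!: integrable_mult_bounded[OF h, of _ 1])
    have "\<bar>LINT v|lborel. h v * cos (w * v)\<bar> \<le> (LINT v|lborel. \<bar>h v * cos (w * v)\<bar>)"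
      using integral_norm_bound[of lborel "\<lambda>v. h v * cos (w * v)"] by simp
    also have "\<dots> \<le> (LINT v|lborel. \<bar>h v\<bar>)"
      by (rule integral_mono[OF integrable_abs[OF i] integrable_abs[OF h]]) (simp add: abs_mult mult_left_le)
    finally show ?thesis .
  qed
  have SB: "\<bar>S w\<bar> \<le> SB" for w unfolding S_def SB_def by (rule transform_bound[OF acf_integrable])
  have CB: "\<bar>C w\<bar> \<le> CB" for w unfolding C_def CB_def by (rule transform_bound[OF K])
  have i1: "integrable ?N (\<lambda>x. S (n * x))" for n
    by (rule N.integrable_const_bound[of _ SB]) (use SB in auto)
  have i2: "integrable ?N (\<lambda>x. C (n * x) * S (n * x))" for n
  proof (rule N.integrable_const_bound[of _ "CB * SB"])
    have "\<bar>C w\<bar> * \<bar>S w\<bar> \<le> CB * SB" for w using CB[of w] SB[of w] by (intro mult_mono) auto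
    then show "AE x in ?N. norm (C (n * x) * S (n * x)) \<le> CB * SB" by (simp add: abs_mult)
  qed auto
  have cc: "(LINT x|?N. cos (n * x * r) * cos (n * x * v)) = (G n (r - v) + G n (r + v)) / 2" for n r v
  proof -
    have "(LINT x|?N. cos (n * x * r) * cos (n * x * v)) = (LINT x|?N. (cos (n * (r - v) * x) + cos (n * (r + v) * x)) / 2)"
      by (intro Bochner_Integration.integral_cong refl, subst cos_times_cos) (simp add: algebra_simps)
    also have "\<dots> = (exp (- (n * (r - v))\<^sup>2 / 2) + exp (- (n * (r + v))\<^sup>2 / 2)) / 2"
    proof -
      have "integrable ?N (\<lambda>x. cos (a * x))" for a
        by (rule N.integrable_const_bound[of _ 1]) auto
      then show ?thesis
        by (simp only: integral_divide_zero Bochner_Integration.integral_add integral_cos_std_normal)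
    qed
    finally show ?thesis by (simp add: G_def)
  qed
  have GS: "(LINT v|lborel. acf v * ((G n (r - v) + G n (r + v)) / 2)) = sqrt (2 * pi) / n * \<psi> n r" if n: "n > 0" for n r
  proof -
    have ig: "integrable lborel (\<lambda>v. acf v * G n (r + a * v))" for a
      by (auto simp: G_def intro!: integrable_mult_bounded[OF acf_integrable, of _ 1])
    have "(LINT v|lborel. acf v * G n (r + v)) = (LINT v|lborel. acf v * G n (r - v))"
      by (subst lborel_integral_real_affine[of "-1" _ 0]) (simp_all add: acf_even)
    moreover have "(LINT v|lborel. acf v * ((G n (r - v) + G n (r + v)) / 2))
        = ((LINT v|lborel. acf v * G n (r - v)) + (LINT v|lborel. acf v * G n (r + v))) / 2"
      using ig[of 1] ig[of "-1"] by (simp add: distrib_left)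
    ultimately have "(LINT v|lborel. acf v * ((G n (r - v) + G n (r + v)) / 2)) = (LINT v|lborel. acf v * G n (r - v))" by simp
    also have "\<dots> = sqrt (2 * pi) / n * \<psi> n r"
      unfolding G_def \<psi>_def by (rule acf_smoothing[OF n])
    finally show ?thesis .
  qed
  have inner: "(LINT x|?N. cos (n * x * r) * S (n * x)) = sqrt (2 * pi) / n * \<psi> n r" if n: "n > 0" for n r
  proof -
    have "(LINT x|?N. cos (n * x * r) * S (n * x)) = (LINT x|?N. LINT v|lborel. acf v * (cos (n * x * r) * cos (n * x * v)))"
      unfolding S_def by (intro Bochner_Integration.integral_cong refl)
        (simp only: integral_mult_right_zero[symmetric] mult.left_commute)
    also have "\<dots> = (LINT v|lborel. acf v * (LINT x|?N. cos (n * x * r) * cos (n * x * v)))"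
      by (rule Fubini_bounded_factor[OF N.finite_measure_axioms lborel.sigma_finite_measure_axioms acf_integrable, of _ 1])
         (auto simp: abs_mult intro!: mult_le_one)
    finally show ?thesis by (simp only: cc GS[OF n])
  qed
  \<comment> \<open>The Gaussian average of the nonnegative function \<open>(C + c) S\<close>, rewritten in time. The frequency \<open>0\<close> is a
    null set for the normal distribution.\<close>
  have key: "(LINT r|lborel. K r * \<psi> n r) + c * \<psi> n 0 \<ge> 0" if n: "n > 0" for n
  proof -
    have "0 \<le> (LINT x|?N. C (n * x) * S (n * x) + c * S (n * x))"
    proof (rule integral_nonneg_AE)
      have "AE x in lborel. x \<noteq> (0::real)"
        by (rule AE_lborel_singleton)
      then have "AE x in ?N. x \<noteq> 0"
        by (subst AE_density) (auto elim: eventually_mono)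
      then show "AE x in ?N. 0 \<le> C (n * x) * S (n * x) + c * S (n * x)"
      proof eventually_elim
        case (elim x)
        then have "C (n * x) \<ge> - c" unfolding C_def using n by (intro freq) auto
        then have "0 \<le> (C (n * x) + c) * S (n * x)" using S0 by (intro mult_nonneg_nonneg) auto
        then show ?case by (simp add: distrib_right)
      qed
    qed
    also have "\<dots> = (LINT x|?N. C (n * x) * S (n * x)) + c * (LINT x|?N. cos (n * x * 0) * S (n * x))"
      using i1 i2 by simp
    also have "(LINT x|?N. C (n * x) * S (n * x)) = (LINT x|?N. LINT r|lborel. K r * (cos (n * x * r) * S (n * x)))"
      unfolding C_def by (simp only: integral_mult_left_zero[symmetric] mult.assoc[of "K _"])
    also have "\<dots> = (LINT r|lborel. K r * (LINT x|?N. cos (n * x * r) * S (n * x)))"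
    proof (rule Fubini_bounded_factor[OF N.finite_measure_axioms lborel.sigma_finite_measure_axioms K, of _ SB])
      have "\<bar>cos y\<bar> * \<bar>S x\<bar> \<le> 1 * SB" for x y using SB[of x] by (intro mult_mono) auto
      then show "\<bar>cos (n * x * r) * S (n * x)\<bar> \<le> SB" for x r by (simp add: abs_mult)
    qed measurable
    also have "\<dots> = (LINT r|lborel. sqrt (2 * pi) / n * (K r * \<psi> n r))" by (simp only: inner[OF n] mult.left_commute)
    also have "\<dots> = sqrt (2 * pi) / n * (LINT r|lborel. K r * \<psi> n r)" by (rule integral_mult_right_zero)
    also have "(LINT x|?N. cos (n * x * 0) * S (n * x)) = sqrt (2 * pi) / n * \<psi> n 0" by (rule inner[OF n])
    finally have "0 \<le> sqrt (2 * pi) / n * ((LINT r|lborel. K r * \<psi> n r) + c * \<psi> n 0)" by (simp add: algebra_simps)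
    moreover have "sqrt (2 * pi) / n > 0" using n by simp
    ultimately show ?thesis by (metis zero_le_mult_iff not_le order.asym)
  qed
  let ?A = "LINT t|lborel. B\<^sup>2 * indicator {0..T} t"
  have sn: "integrable lborel (\<lambda>s. a * std_normal_density s)" for a by simp
  have \<psi>_lim: "(\<lambda>n. \<psi> (real (Suc n)) r) \<longlonglongrightarrow> acf r" for r
  proof -
    have "(\<lambda>n. LINT s|lborel. acf (r - s / real (Suc n)) * std_normal_density s) \<longlonglongrightarrow> (LINT s|lborel. acf r * std_normal_density s)"
    proof (rule integral_dominated_convergence[OF _ _ sn[of ?A]])
      show "AE s in lborel. (\<lambda>n. acf (r - s / real (Suc n)) * std_normal_density s) \<longlonglongrightarrow> acf r * std_normal_density s"
      proof (rule AE_I2)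
        fix s
        have "(\<lambda>n. s / real (Suc n)) \<longlonglongrightarrow> 0" by (rule LIMSEQ_Suc[OF lim_const_over_n])
        then have "(\<lambda>n. r - s / real (Suc n)) \<longlonglongrightarrow> r - 0" by (intro tendsto_intros)
        then have "(\<lambda>n. acf (r - s / real (Suc n))) \<longlonglongrightarrow> acf r"
          by (intro isCont_tendsto_compose[OF acf_isCont]) simp
        then show "(\<lambda>n. acf (r - s / real (Suc n)) * std_normal_density s) \<longlonglongrightarrow> acf r * std_normal_density s"
          by (rule tendsto_mult_right)
      qed
      show "AE s in lborel. norm (acf (r - s / real (Suc n)) * std_normal_density s) \<le> ?A * std_normal_density s" for n
        using acf_bound by (intro AE_I2) (simp add: abs_mult mult_right_mono)
    qed measurable
    then show ?thesis by (simp add: \<psi>_def)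
  qed
  have \<psi>m[measurable]: "\<psi> n \<in> borel_measurable borel" for n unfolding \<psi>_def by measurable
  have \<psi>_bound: "\<bar>\<psi> n r\<bar> \<le> ?A" for n r
  proof -
    have i: "integrable lborel (\<lambda>s. acf (r - s / n) * std_normal_density s)"
      by (rule Bochner_Integration.integrable_bound[OF sn[of ?A]])
         (use acf_bound in \<open>auto simp: abs_mult intro!: mult_right_mono order_trans[OF _ abs_ge_self]\<close>)
    have "\<bar>\<psi> n r\<bar> \<le> (LINT s|lborel. norm (acf (r - s / n) * std_normal_density s))"
      unfolding \<psi>_def using integral_norm_bound[of lborel "\<lambda>s. acf (r - s / n) * std_normal_density s"] by simp
    also have "\<dots> \<le> (LINT s|lborel. ?A * std_normal_density s)"
      by (rule integral_mono[OF integrable_norm[OF i] sn])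
         (use acf_bound in \<open>auto simp: abs_mult intro!: mult_right_mono\<close>)
    finally show ?thesis by simp
  qed
  have "(\<lambda>n. (LINT r|lborel. K r * \<psi> (real (Suc n)) r) + c * \<psi> (real (Suc n)) 0) \<longlonglongrightarrow> (LINT r|lborel. K r * acf r) + c * acf 0"
  proof (intro tendsto_add tendsto_mult tendsto_const \<psi>_lim)
    show "(\<lambda>n. LINT r|lborel. K r * \<psi> (real (Suc n)) r) \<longlonglongrightarrow> (LINT r|lborel. K r * acf r)"
    proof (rule integral_dominated_convergence[where w = "\<lambda>r. ?A * \<bar>K r\<bar>"])
      show "AE r in lborel. (\<lambda>n. K r * \<psi> (real (Suc n)) r) \<longlonglongrightarrow> K r * acf r"
        by (intro AE_I2 tendsto_mult tendsto_const \<psi>_lim)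
      show "AE r in lborel. norm (K r * \<psi> (real (Suc n)) r) \<le> ?A * \<bar>K r\<bar>" for n
        using \<psi>_bound by (intro AE_I2) (simp add: abs_mult mult.commute[of "\<bar>K _\<bar>"] mult_right_mono)
      show "integrable lborel (\<lambda>r. ?A * \<bar>K r\<bar>)" using K by simp
    qed measurable
  qed
  then show ?thesis by (rule LIMSEQ_le_const) (use key in auto)
qed

end

section \<open>The energy inequality for the kernel\<close>

text \<open>
  The left-hand side is \<open>Re ((1 + i\<omega>q) G(i\<omega>))\<close>: the pole of \<open>G\<close> at \<open>0\<close> has been split off with
  the constant \<open>1 / \<pi>\<close>, and contributes only the boundary term of \<open>dkern_cos_transform\<close>.
\<close>

lemma kernel_transform_closed_form:
  assumes w: "w > 0"
  defines "z \<equiv> pi * sqrt (w / 2)"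
  shows "(LINT t|lborel. indicator {0<..} t * ((kern t - 1 / pi) * cos (w * t)))
      + q * (LINT t|lborel. indicator {0<..} t * (dkern t * cos (w * t)))
    = pi * (q * w * diagS z - diagR z) / (z * ((diagR z)\<^sup>2 + (diagS z)\<^sup>2))"
proof -
  define s where "s = Complex (z / pi) (z / pi)"
  define D where "D = (diagR z)\<^sup>2 + (diagS z)\<^sup>2"
  let ?C = "LINT t|lborel. indicator {0<..} t * ((kern t - 1 / pi) * cos (w * t))"
  let ?S = "LINT t|lborel. indicator {0<..} t * ((kern t - 1 / pi) * sin (w * t))"
  have z: "z > 0" using w by (simp add: z_def)
  have "1 < cosh (2 * z)" using z cosh_real_strict_mono[of 0 "2 * z"] by simp
  then have D: "D > 0" unfolding D_def diagR_diagS_squares using cos_le_one[of "2 * z"] by linarith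
  have "z / pi * (z / pi) = w / 2" using w by (simp add: z_def)
  then have zw: "2 * (z / pi) * (z / pi) = w" by (simp only: mult.assoc)
  have s2: "s\<^sup>2 = \<i> * w"
    using zw by (simp add: s_def power2_eq_square complex_eq_iff)
  have spi: "s * pi = Complex z z" by (simp add: s_def complex_eq_iff)
  have "s = Complex z z / pi" by (simp add: s_def complex_eq_iff)
  then have ss: "s * sinh (s * pi) = Complex (- z * diagR z / pi) (z * diagS z / pi)"
  proof -
    have "s * sinh (s * pi) = Complex z z * sinh (Complex z z) / pi"
      unfolding spi by (simp only: \<open>s = Complex z z / pi\<close> times_divide_eq_left)
    then show ?thesis unfolding diag_mult_sinh by (simp add: complex_eq_iff)
  qed
  have nzss: "s * sinh (s * pi) \<noteq> 0"
  proof
    assume "s * sinh (s * pi) = 0"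
    then have "diagR z = 0" "diagS z = 0" unfolding ss using z by (auto simp: complex_eq_iff)
    then show False using D by (simp add: D_def)
  qed
  have inv: "1 / (s * sinh (s * pi)) = Complex (- (pi * diagR z) / (z * D)) (- (pi * diagS z) / (z * D))"
  proof -
    have "Complex (- (pi * diagR z) / (z * D)) (- (pi * diagS z) / (z * D)) * Complex (- z * diagR z / pi) (z * diagS z / pi)
      = Complex (((diagR z)\<^sup>2 + (diagS z)\<^sup>2) / D) 0"
      using z D by (simp add: complex_eq_iff power2_eq_square add_divide_distrib)
    also have "\<dots> = 1" unfolding D_def[symmetric] using D by (simp add: complex_eq_iff)
    finally show ?thesis using nzss unfolding ss by (simp add: divide_eq_eq)
  qed
  have tm: "complex_of_real (cos_weight n * (-1) ^ n) / ((of_nat n)\<^sup>2 + s\<^sup>2)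
      = Complex (kern_coeff n * ((real n)\<^sup>2 / (((real n)\<^sup>2)\<^sup>2 + w\<^sup>2))) (- (kern_coeff n * (w / (((real n)\<^sup>2)\<^sup>2 + w\<^sup>2))))" for n
  proof -
    have "((of_nat n)\<^sup>2 + s\<^sup>2) = Complex ((real n)\<^sup>2) w"
      unfolding s2 by (simp add: complex_eq_iff power2_eq_square)
    then show ?thesis
      by (simp add: kern_coeff_def complex_eq_iff Re_divide Im_divide)
  qed
  have nz: "(of_nat n)\<^sup>2 + s\<^sup>2 \<noteq> 0" for n
  proof -
    have "Im ((of_nat n)\<^sup>2 + s\<^sup>2) = w" unfolding s2 by (simp add: power2_eq_square)
    then show ?thesis using w by (metis less_irrefl zero_complex.sel(2))
  qed
  have sums: "(\<lambda>n. kern_coeff n * ((real n)\<^sup>2 / (((real n)\<^sup>2)\<^sup>2 + w\<^sup>2))) sums (- (pi * diagR z) / (z * D))"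
    "(\<lambda>n. - (kern_coeff n * (w / (((real n)\<^sup>2)\<^sup>2 + w\<^sup>2)))) sums (- (pi * diagS z) / (z * D))"
    using sinh_partial_fractions[OF nz nzss] unfolding tm inv sums_complex_iff by simp_all
  have k0: "kern_coeff 0 = 1 / pi" by (simp add: kern_coeff_def cos_weight_def)
  have C: "?C = - (pi * diagR z) / (z * D)"
  proof (rule sums_unique2[OF kern_transform(2)])
    show "(\<lambda>n. kern_coeff (Suc n) * ((real (Suc n))\<^sup>2 / (((real (Suc n))\<^sup>2)\<^sup>2 + w\<^sup>2))) sums (- (pi * diagR z) / (z * D))"
      using sums(1) by (subst sums_Suc_iff) simp
  qed
  have S: "?S = (pi * diagS z) / (z * D) - 1 / (pi * w)"
  proof (rule sums_unique2[OF kern_transform(3)])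
    have "(\<lambda>n. kern_coeff n * (w / (((real n)\<^sup>2)\<^sup>2 + w\<^sup>2))) sums ((pi * diagS z) / (z * D))"
      using sums_minus[OF sums(2)] by simp
    then show "(\<lambda>n. kern_coeff (Suc n) * (w / (((real (Suc n))\<^sup>2)\<^sup>2 + w\<^sup>2))) sums ((pi * diagS z) / (z * D) - 1 / (pi * w))"
      using w by (subst sums_Suc_iff) (simp add: k0 power2_eq_square)
  qed
  have "w * ?S = w * ((pi * diagS z) / (z * D)) - 1 / pi"
    unfolding S using w by (simp add: right_diff_distrib)
  then show ?thesis
    unfolding dkern_cos_transform C D_def[symmetric] by (simp add: diff_divide_distrib algebra_simps)
qed

text \<open>
  The integrable part of \<open>k + q k'\<close>, extended by zero to the negative half-line.
\<close>

definition popov_kernel :: "real \<Rightarrow> real \<Rightarrow> real" where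
  "popov_kernel q r = indicator {0<..} r * (kern r - 1 / pi) + q * (indicator {0<..} r * dkern r)"

lemma popov_kernel_integrable: "integrable lborel (popov_kernel q)"
  unfolding popov_kernel_def[abs_def]
  by (intro Bochner_Integration.integrable_add integrable_mult_right kern_transform(1) dkern_integrable)

theorem popov_frequency_condition:
  obtains q where "q > 0" "beta0 > 0"
    "\<And>w. w \<noteq> 0 \<Longrightarrow> (LINT r|lborel. popov_kernel q r * cos (w * r)) \<ge> - (1 / beta0)"
proof -
  obtain p where p: "p > 0" "beta0 > 0" "\<And>z. z > 0 \<Longrightarrow> popov_defect p (1 / (pi * beta0)) z \<ge> 0"
    using popov_inequality by blast
  define q where "q = p * pi\<^sup>2 / 2"
  have pos: "(LINT r|lborel. popov_kernel q r * cos (w * r)) \<ge> - (1 / beta0)" if w: "w > 0" for w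
  proof -
    define z where "z = pi * sqrt (w / 2)"
    define D where "D = (diagR z)\<^sup>2 + (diagS z)\<^sup>2"
    have z: "z > 0" using w by (simp add: z_def)
    have "1 < cosh (2 * z)" using z cosh_real_strict_mono[of 0 "2 * z"] by simp
    then have D: "D > 0" unfolding D_def diagR_diagS_squares using cos_le_one[of "2 * z"] by linarith
    have i1: "integrable lborel (\<lambda>t. indicator {0<..} t * ((kern t - 1 / pi) * cos (w * t)))"
      using integrable_mult_bounded[OF kern_transform(1), of "\<lambda>t. cos (w * t)" 1] by (simp add: mult.assoc)
    have i2: "integrable lborel (\<lambda>t. indicator {0<..} t * (dkern t * cos (w * t)))"
      using integrable_mult_bounded[OF dkern_integrable, of "\<lambda>t. cos (w * t)" 1] by (simp add: mult.assoc)
    have "(LINT r|lborel. popov_kernel q r * cos (w * r)) =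
       (LINT r|lborel. indicator {0<..} r * ((kern r - 1 / pi) * cos (w * r)) + q * (indicator {0<..} r * (dkern r * cos (w * r))))"
      by (simp add: popov_kernel_def algebra_simps)
    also have "\<dots> = (LINT r|lborel. indicator {0<..} r * ((kern r - 1 / pi) * cos (w * r)))
       + q * (LINT r|lborel. indicator {0<..} r * (dkern r * cos (w * r)))"
      using i1 i2 by simp
    also have "\<dots> = pi * (q * w * diagS z - diagR z) / (z * D)"
      unfolding kernel_transform_closed_form[OF w] z_def D_def ..
    also have "q * w = p * z\<^sup>2" using w by (simp add: q_def z_def power_mult_distrib)
    finally have eq: "(LINT r|lborel. popov_kernel q r * cos (w * r)) = pi * (p * z\<^sup>2 * diagS z - diagR z) / (z * D)" .
    have "p * z\<^sup>2 * diagS z - diagR z \<ge> - (z * D / (pi * beta0))"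
      using p(3)[OF z] by (simp add: popov_defect_def D_def)
    then have "pi * (p * z\<^sup>2 * diagS z - diagR z) / (z * D) \<ge> pi * (- (z * D / (pi * beta0))) / (z * D)"
      using z D by (intro divide_right_mono mult_left_mono) auto
    then show ?thesis unfolding eq using z D by simp
  qed
  show thesis
  proof (rule that)
    show "q > 0" using p(1) by (simp add: q_def)
    show "beta0 > 0" by (rule p)
    fix w :: real assume "w \<noteq> 0"
    then show "(LINT r|lborel. popov_kernel q r * cos (w * r)) \<ge> - (1 / beta0)"
      using pos[of w] pos[of "- w"] by (cases "w > 0") simp_all
  qed
qed

context bounded_signal
begin

text \<open>
  The autocorrelation is even and its integral is the square of the integral of the signal. This
  evaluates the contribution of the constant part \<open>1 / \<pi>\<close> of the kernel.
\<close>

lemma acf_halfline: "(LINT r|lborel. indicator {0<..} r * acf r) = (LINT t|lborel. W t)\<^sup>2 / 2"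
proof -
  have i: "integrable lborel (\<lambda>r. indicator A r * acf r)" if "A \<in> sets borel" for A
    using integrable_mult_bounded[OF acf_integrable, of "indicator A" 1] that by (simp add: mult.commute)
  have "(LINT r|lborel. indicator {..<0} r * acf r) = (LINT r|lborel. indicator {0<..} r * acf r)"
    by (subst lborel_integral_real_affine[of "-1" _ 0]) (auto simp: acf_even indicator_def intro!: Bochner_Integration.integral_cong)
  moreover have "(LINT r|lborel. indicator {..<0} r * acf r) + (LINT r|lborel. indicator {0<..} r * acf r)
      = (LINT r|lborel. indicator {..<0} r * acf r + indicator {0<..} r * acf r)"
    by (rule Bochner_Integration.integral_add[symmetric]) (auto intro!: i)
  moreover have "\<dots> = (LINT r|lborel. acf r)"
  proof (rule integral_cong_AE)
    have "AE r in lborel. r \<noteq> (0::real)" by (rule AE_lborel_singleton)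
    then show "AE r in lborel. indicator {..<0} r * acf r + indicator {0<..} r * acf r = acf r"
      by eventually_elim (auto simp: indicator_def)
  qed auto
  moreover have "(LINT r|lborel. acf r) = (LINT t|lborel. W t)\<^sup>2" using acf_cos_transform[of 0] by simp
  ultimately show ?thesis by simp
qed

lemma convolution_energy:
  assumes h: "integrable lborel h"
  shows "(LINT t|lborel. W t * (LINT r|lborel. h r * W (t - r))) = (LINT r|lborel. h r * acf r)"
proof -
  let ?M = "restrict_space lborel {0..T}"
  have fin: "finite_measure ?M"
    by (rule finite_measureI) (simp add: space_restrict_space emeasure_restrict_space emeasure_lborel_Icc_eq)
  have id: "(\<lambda>t. t) \<in> borel_measurable ?M" by (rule measurable_restrict_space1) simp
  have restr: "(LINT t|?M. W t * g t) = (LINT t|lborel. W t * g t)" for g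
  proof -
    have "(LINT t|?M. W t * g t) = (LINT t|lborel. indicator {0..T} t *\<^sub>R (W t * g t))"
      by (rule integral_restrict_space) simp
    also have "\<dots> = (LINT t|lborel. W t * g t)"
    proof (intro Bochner_Integration.integral_cong refl)
      fix t show "indicator {0..T} t *\<^sub>R (W t * g t) = W t * g t"
        using W_support[of t] by (cases "t \<in> {0..T}") auto
    qed
    finally show ?thesis .
  qed
  have m: "(\<lambda>(t, r). W t * W (t - r)) \<in> borel_measurable (?M \<Otimes>\<^sub>M lborel)"
  proof -
    have 1: "(\<lambda>(t, r). W t * W (t - r)) \<in> borel_measurable (borel \<Otimes>\<^sub>M borel)" by measurable
    have 2: "(\<lambda>p. p) \<in> ?M \<Otimes>\<^sub>M lborel \<rightarrow>\<^sub>M borel \<Otimes>\<^sub>M borel"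
      using id by (subst measurable_pair_iff) (auto simp: comp_def intro: measurable_compose[OF measurable_fst])
    show ?thesis by (rule measurable_compose[OF 2 1])
  qed
  have "\<bar>W t * W (t - r)\<bar> \<le> B * B" for t r
    unfolding abs_mult using W_bound B_nonneg by (intro mult_mono) auto
  from Fubini_bounded_factor[OF fin lborel.sigma_finite_measure_axioms h m this]
  have "(LINT t|?M. LINT r|lborel. h r * (W t * W (t - r))) = (LINT r|lborel. h r * (LINT t|?M. W t * W (t - r)))" .
  also have "\<dots> = (LINT r|lborel. h r * acf r)" unfolding restr acf_def ..
  also have "(LINT t|?M. LINT r|lborel. h r * (W t * W (t - r))) = (LINT t|?M. W t * (LINT r|lborel. h r * W (t - r)))"
    by (simp only: mult.left_commute[of "h _"] integral_mult_right_zero)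
  finally show ?thesis unfolding restr .
qed

text \<open>
  On signals supported in \<open>[0,T]\<close> only the values of the kernel on \<open>(0,T]\<close> matter, so the kernel can be
  cut off at \<open>T\<close> to become integrable.
\<close>

theorem popov_energy_inequality:
  assumes freq: "\<And>w. w \<noteq> 0 \<Longrightarrow> (LINT r|lborel. popov_kernel q r * cos (w * r)) \<ge> - c"
  shows "(LINT t|lborel. W t * (LINT r|lborel. (indicator {0<..T} r * kern r + q * (indicator {0<..} r * dkern r)) * W (t - r)))
    \<ge> (LINT t|lborel. W t)\<^sup>2 / (2 * pi) - c * (LINT t|lborel. (W t)\<^sup>2)"
proof -
  let ?h = "\<lambda>r. indicator {0<..T} r * kern r + q * (indicator {0<..} r * dkern r)"
  have oi: "integrable lborel (\<lambda>r. indicator {0<..T} r :: real)"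
    by (rule integrable_real_indicator[OF _ emeasure_bounded_finite]) auto
  have hi: "integrable lborel ?h"
  proof -
    have "integrable lborel (\<lambda>r. indicator {0<..} r * (kern r - 1 / pi) * indicator {0<..T} r + 1 / pi * indicator {0<..T} r
       + q * (indicator {0<..} r * dkern r))"
      by (intro Bochner_Integration.integrable_add integrable_mult_right dkern_integrable oi
          integrable_mult_bounded[OF kern_transform(1), of _ 1]) auto
    moreover have "indicator {0<..} r * (kern r - 1 / pi) * indicator {0<..T} r + 1 / pi * indicator {0<..T} r
       + q * (indicator {0<..} r * dkern r) = ?h r" for r
      by (auto simp: indicator_def)
    ultimately show ?thesis by simp
  qed
  have eq: "?h r * acf r = popov_kernel q r * acf r + 1 / pi * (indicator {0<..} r * acf r)" for r
    using acf_support[of r] by (cases "r > T") (auto simp: popov_kernel_def indicator_def algebra_simps)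
  have am: "\<bar>acf r\<bar> \<le> (LINT t|lborel. B\<^sup>2 * indicator {0..T} t)" for r by (rule acf_bound)
  have i1: "integrable lborel (\<lambda>r. popov_kernel q r * acf r)"
    by (rule integrable_mult_bounded[OF popov_kernel_integrable _ am]) simp
  have i2: "integrable lborel (\<lambda>r. indicator {0<..} r * acf r)"
    using integrable_mult_bounded[OF acf_integrable, of "indicator {0<..}" 1] by (simp add: mult.commute)
  have "(LINT t|lborel. W t * (LINT r|lborel. ?h r * W (t - r))) = (LINT r|lborel. ?h r * acf r)"
    by (rule convolution_energy[OF hi])
  also have "\<dots> = (LINT r|lborel. popov_kernel q r * acf r) + 1 / pi * (LINT r|lborel. indicator {0<..} r * acf r)"
    unfolding eq using i1 i2 by simp
  also have "1 / pi * (LINT r|lborel. indicator {0<..} r * acf r) = (LINT t|lborel. W t)\<^sup>2 / (2 * pi)"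
    unfolding acf_halfline by simp
  finally have "(LINT t|lborel. W t * (LINT r|lborel. ?h r * W (t - r)))
     = (LINT r|lborel. popov_kernel q r * acf r) + (LINT t|lborel. W t)\<^sup>2 / (2 * pi)" .
  moreover have "(LINT r|lborel. popov_kernel q r * acf r) + c * acf 0 \<ge> 0"
    by (rule quadratic_form_lower_bound[OF popov_kernel_integrable freq])
  moreover have "acf 0 = (LINT t|lborel. (W t)\<^sup>2)" by (simp add: acf_def power2_eq_square)
  ultimately show ?thesis by simp
qed

end

section \<open>Solutions of the Volterra equation\<close>

lemma tanh_square_le: "(tanh u)\<^sup>2 \<le> u * tanh u" for u :: real
proof -
  have pos: "tanh v \<le> v" if "v \<ge> 0" for v :: real
  proof -
    have "v - tanh v \<ge> 0 - tanh 0"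
    proof (rule DERIV_nonneg_imp_nondecreasing[OF that])
      fix x :: real
      have "((\<lambda>v. v - tanh v) has_real_derivative 1 - (1 - (tanh x)\<^sup>2)) (at x)"
        by (auto intro!: derivative_eq_intros)
      then show "\<exists>y. ((\<lambda>v. v - tanh v) has_real_derivative y) (at x) \<and> 0 \<le> y" by force
    qed
    then show ?thesis by simp
  qed
  show ?thesis
  proof (cases "u \<ge> 0")
    case True
    then show ?thesis using mult_right_mono[OF pos[OF True], of "tanh u"] by (simp add: power2_eq_square)
  next
    case False
    then have "tanh (- u) * tanh (- u) \<le> - u * tanh (- u)" by (intro mult_right_mono pos) auto
    then show ?thesis by (simp add: power2_eq_square)
  qed
qed

text \<open>
  A value of modulus at least \<open>e\<close> forces modulus at least \<open>e / 2\<close> on a following interval of fixed length, and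
  this contributes a fixed amount to the integral; late in time only small amounts are left.
\<close>

lemma square_integrable_Lipschitz_tendsto_zero:
  fixes w :: "real \<Rightarrow> real"
  assumes lip: "\<And>s t. 1 \<le> s \<Longrightarrow> s \<le> t \<Longrightarrow> \<bar>w t - w s\<bar> \<le> L * (t - s)"
    and m: "(\<lambda>t. indicator {0<..} t * w t) \<in> borel_measurable borel"
    and w1: "\<And>t. t > 0 \<Longrightarrow> \<bar>w t\<bar> \<le> 1"
    and C: "\<And>T. T > 0 \<Longrightarrow> (LINT t|lborel. (indicator {0<..<T} t * w t)\<^sup>2) \<le> C"
  shows "(w \<longlongrightarrow> 0) at_top"
proof -
  define F where "F T = (LINT t|lborel. (indicator {0<..<T} t * w t)\<^sup>2)" for T
  have L0: "L \<ge> 0" using order_trans[OF abs_ge_zero lip[of 1 2]] by simp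
  have m': "(\<lambda>t. indicator {a..<b} t * w t) \<in> borel_measurable borel" if "a > 0" for a b
  proof -
    have "(\<lambda>t. indicator {a..<b} t * (indicator {0<..} t * w t)) \<in> borel_measurable borel" using m by measurable
    moreover have "indicator {a..<b} t * (indicator {0<..} t * w t) = indicator {a..<b} t * w t" for t
      using that by (auto simp: indicator_def)
    ultimately show ?thesis by simp
  qed
  have m0: "(\<lambda>t. indicator {0<..<b} t * w t) \<in> borel_measurable borel" for b
  proof -
    have "(\<lambda>t. indicator {0<..<b} t * (indicator {0<..} t * w t)) \<in> borel_measurable borel" using m by measurable
    moreover have "indicator {0<..<b} t * (indicator {0<..} t * w t) = indicator {0<..<b} t * w t" for t
      by (auto simp: indicator_def)
    ultimately show ?thesis by simp
  qed
  have ib: "integrable lborel (\<lambda>t. (indicator A t * w t)\<^sup>2)"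
    if A: "(\<lambda>t. indicator A t * w t) \<in> borel_measurable borel" "A \<subseteq> {0<..<b}" for A b
  proof (rule Bochner_Integration.integrable_bound)
    show "integrable lborel (\<lambda>t. indicator {0<..<b} t :: real)"
      by (rule integrable_real_indicator[OF _ emeasure_bounded_finite]) auto
    show "AE t in lborel. norm ((indicator A t * w t)\<^sup>2) \<le> norm (indicator {0<..<b} t :: real)"
    proof (rule AE_I2)
      fix t
      show "norm ((indicator A t * w t)\<^sup>2) \<le> norm (indicator {0<..<b} t :: real)"
        using A(2) w1[of t] by (cases "t \<in> A") (auto simp: abs_square_le_1)
    qed
  qed (use A in auto)
  have diff: "F b - F a = (LINT t|lborel. (indicator {a..<b} t * w t)\<^sup>2)" if ab: "0 < a" "a \<le> b" for a b
  proof -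
    have "(LINT t|lborel. (indicator {0<..<b} t * w t)\<^sup>2) =
      (LINT t|lborel. (indicator {0<..<a} t * w t)\<^sup>2 + (indicator {a..<b} t * w t)\<^sup>2)"
      using ab by (intro Bochner_Integration.integral_cong refl) (auto simp: indicator_def)
    also have "\<dots> = (LINT t|lborel. (indicator {0<..<a} t * w t)\<^sup>2) + (LINT t|lborel. (indicator {a..<b} t * w t)\<^sup>2)"
      by (intro Bochner_Integration.integral_add ib[OF m0, of _ a] ib[OF m', of a b b]) (use ab in auto)
    finally show ?thesis by (simp add: F_def)
  qed
  have mono: "F a \<le> F b" if "0 < a" "a \<le> b" for a b
  proof -
    have "0 \<le> (LINT t|lborel. (indicator {a..<b} t * w t)\<^sup>2)" by (auto intro: integral_nonneg_AE)
    then show ?thesis using diff[OF that] by linarith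
  qed
  have "\<exists>N. \<forall>t\<ge>N. \<bar>w t\<bar> < e" if e: "e > 0" for e
  proof -
    \<comment> \<open>On an interval of length \<open>\<delta>\<close> the function varies by at most \<open>e / 2\<close>.\<close>
    define \<delta> where "\<delta> = e / (2 * (L + 1))"
    have \<delta>: "\<delta> > 0" using e L0 by (simp add: \<delta>_def)
    have Ld: "L * \<delta> \<le> e / 2"
    proof -
      have "L * \<delta> \<le> (L + 1) * \<delta>" using \<delta> by (intro mult_right_mono) auto
      also have "\<dots> = e / 2" using L0 by (simp add: \<delta>_def field_simps)
      finally show ?thesis .
    qed
    define \<eta> where "\<eta> = (e / 2)\<^sup>2 * \<delta>"
    have \<eta>: "\<eta> > 0" using e \<delta> by (simp add: \<eta>_def)
    define S where "S = (SUP T\<in>{0<..}. F T)"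
    have "F T \<le> C" if "T \<in> {0<..}" for T using C[of T] that by (simp add: F_def)
    then have bdd: "bdd_above (F ` {0<..})" by (rule bdd_aboveI2)
    obtain N where N: "N > 0" "F N > S - \<eta>"
      using less_cSUP_iff[OF _ bdd, of "S - \<eta>"] \<eta> unfolding S_def[symmetric] by force
    show ?thesis
    proof (intro exI allI impI)
      fix t assume t: "t \<ge> max N 1"
      show "\<bar>w t\<bar> < e"
      proof (rule ccontr)
        assume "\<not> \<bar>w t\<bar> < e"
        then have we: "\<bar>w t\<bar> \<ge> e" by simp
        have ws: "(e / 2)\<^sup>2 \<le> (w s)\<^sup>2" if s: "t \<le> s" "s < t + \<delta>" for s
        proof -
          have "\<bar>w s - w t\<bar> \<le> L * (s - t)" using lip[of t s] s t by simp
          also have "\<dots> \<le> L * \<delta>" using s L0 by (intro mult_left_mono) auto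
          finally have "\<bar>w s - w t\<bar> \<le> e / 2" using Ld by simp
          then have "e / 2 \<le> \<bar>w s\<bar>" using we by linarith
          then have "(e / 2)\<^sup>2 \<le> \<bar>w s\<bar>\<^sup>2" using e by (intro power_mono) auto
          then show ?thesis by simp
        qed
        have "\<eta> = (LINT s|lborel. (e / 2)\<^sup>2 * indicator {t..<t + \<delta>} s)"
          using \<delta> by (simp add: \<eta>_def)
        also have "\<dots> \<le> (LINT s|lborel. (indicator {t..<t + \<delta>} s * w s)\<^sup>2)"
        proof (rule integral_mono)
          have "integrable lborel (\<lambda>s. indicator {t..<t + \<delta>} s :: real)"
            by (rule integrable_real_indicator[OF _ emeasure_bounded_finite]) auto
          then show "integrable lborel (\<lambda>s. (e / 2)\<^sup>2 * indicator {t..<t + \<delta>} s)" by simp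
          show "integrable lborel (\<lambda>s. (indicator {t..<t + \<delta>} s * w s)\<^sup>2)"
            by (rule ib[OF m', of _ _ "t + \<delta>"]) (use t in auto)
          show "(e / 2)\<^sup>2 * indicator {t..<t + \<delta>} s \<le> (indicator {t..<t + \<delta>} s * w s)\<^sup>2" for s
            using ws[of s] by (auto simp: indicator_def)
        qed
        also have "\<dots> = F (t + \<delta>) - F t" using t \<delta> by (intro diff[symmetric]) auto
        finally have "\<eta> \<le> F (t + \<delta>) - F t" .
        moreover have "F (t + \<delta>) \<le> S" unfolding S_def using t \<delta> bdd by (intro cSUP_upper) auto
        moreover have "F t \<ge> F N" using mono[of N t] N t by simp
        ultimately show False using N by linarith
      qed
    qed
  qed
  then show ?thesis
    by (auto simp: tendsto_iff eventually_at_top_linorder dist_real_def)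
qed

text \<open>
  The integral equation with \<open>f\<close> and \<open>a\<close> replaced by their series; \<open>f_of_series\<close> provides the
  coefficients \<open>b\<close>.
\<close>

locale volterra_solution =
  fixes \<beta> Y :: real and b :: "nat \<Rightarrow> real" and y :: "real \<Rightarrow> real"
  assumes beta: "0 < \<beta>" "\<beta> < beta0"
    and y_cont: "continuous_on {0<..} y" and y_bound: "\<And>t. t > 0 \<Longrightarrow> \<bar>y t\<bar> \<le> Y"
    and b_summable: "summable (\<lambda>n. \<bar>b n\<bar>)"
    and y_eq: "\<And>t. t > 0 \<Longrightarrow> y t = (\<Sum>n. b n * exp (- (real n)\<^sup>2 * t))
       - (LINT \<tau>|lborel. indicator {0<..<t} \<tau> * (kern (t - \<tau>) * tanh (\<beta> * y \<tau>)))"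
begin

definition "w t = tanh (\<beta> * y t)"
text \<open>
  Both factors of the convolution \<open>H = k' * w\<close> are extended by zero, so that \<open>H\<close> is an integral over the
  line with translations.
\<close>

definition "w0 t = indicator {0<..} t * w t"
definition "dk r = indicator {0<..} r * dkern r"
definition "H t = (LINT r|lborel. dk r * w0 (t - r))"
definition "c t = (LINT \<tau>|lborel. indicator {0<..<t} \<tau> * (kern (t - \<tau>) * w \<tau>))"
definition "f t = (\<Sum>n. b n * exp (- (real n)\<^sup>2 * t))"
definition "f' t = (\<Sum>n. - ((real n)\<^sup>2 * b n * exp (- (real n)\<^sup>2 * t)))"

lemma y_isCont: "t > 0 \<Longrightarrow> isCont y t"
  using y_cont by (simp add: continuous_on_eq_continuous_at)

lemma w_isCont: "t > 0 \<Longrightarrow> isCont w t"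
  unfolding w_def by (intro continuous_intros y_isCont) auto

lemma w_bound: "\<bar>w t\<bar> \<le> 1"
  using tanh_real_lt_1[of "\<beta> * y t"] tanh_real_gt_neg1[of "\<beta> * y t"] by (simp add: w_def abs_le_iff)

lemma w0_measurable[measurable]: "w0 \<in> borel_measurable borel"
  unfolding w0_def[abs_def] by (rule borel_measurable_halfline[OF w_isCont])

lemma w0_bound: "\<bar>w0 t\<bar> \<le> 1"
  using w_bound[of t] by (simp add: w0_def indicator_def)

lemma w0_isCont: "t \<noteq> 0 \<Longrightarrow> isCont w0 t"
proof -
  assume "t \<noteq> 0"
  then consider "t < 0" | "t > 0" by linarith
  then show ?thesis
  proof cases
    case 1
    then have "\<forall>\<^sub>F s in nhds t. w0 s = 0"
      by (intro eventually_nhds_in_open[THEN eventually_mono, of "{..<0}"]) (auto simp: w0_def)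
    then show ?thesis by (subst isCont_cong) auto
  next
    case 2
    then have "\<forall>\<^sub>F s in nhds t. w0 s = w s"
      by (intro eventually_nhds_in_open[THEN eventually_mono, of "{0<..}"]) (auto simp: w0_def)
    then show ?thesis using w_isCont[OF 2] by (subst isCont_cong) auto
  qed
qed

lemma dk_integrable: "integrable lborel dk"
  unfolding dk_def[abs_def] by (rule dkern_integrable)

lemma dk_measurable[measurable]: "dk \<in> borel_measurable borel"
  using borel_measurable_integrable[OF dk_integrable] by simp

lemma dk_w0_integrable: "integrable lborel (\<lambda>r. dk r * w0 (t - r))"
  by (rule integrable_mult_bounded[OF dk_integrable _ w0_bound]) simp

lemma H_bound: "\<bar>H t\<bar> \<le> (LINT r|lborel. \<bar>dk r\<bar>)"
proof -
  have "\<bar>H t\<bar> \<le> (LINT r|lborel. \<bar>dk r * w0 (t - r)\<bar>)"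
    unfolding H_def using integral_norm_bound[of lborel "\<lambda>r. dk r * w0 (t - r)"] by simp
  also have "\<dots> \<le> (LINT r|lborel. \<bar>dk r\<bar>)"
    by (rule integral_mono[OF integrable_abs[OF dk_w0_integrable] integrable_abs[OF dk_integrable]])
       (simp add: abs_mult mult_left_le w0_bound)
  finally show ?thesis .
qed

lemma H_isCont: "isCont H t"
  unfolding continuous_at_sequentially comp_def
proof (intro allI impI)
  fix v assume v: "v \<longlonglongrightarrow> t"
  show "(\<lambda>n. H (v n)) \<longlonglongrightarrow> H t"
    unfolding H_def
  proof (rule integral_dominated_convergence[OF _ _ integrable_abs[OF dk_integrable]])
    have "AE r in lborel. r \<noteq> t" by (rule AE_lborel_singleton)
    then show "AE r in lborel. (\<lambda>n. dk r * w0 (v n - r)) \<longlonglongrightarrow> dk r * w0 (t - r)"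
    proof eventually_elim
      case (elim r)
      then have "isCont w0 (t - r)" by (intro w0_isCont) simp
      moreover have "(\<lambda>n. v n - r) \<longlonglongrightarrow> t - r" by (intro tendsto_intros v)
      ultimately have "(\<lambda>n. w0 (v n - r)) \<longlonglongrightarrow> w0 (t - r)" by (rule isCont_tendsto_compose)
      then show ?case by (intro tendsto_intros)
    qed
    show "AE r in lborel. norm (dk r * w0 (v n - r)) \<le> \<bar>dk r\<bar>" for n
      by (intro AE_I2) (simp add: abs_mult mult_left_le w0_bound)
  qed measurable
qed

lemma H_cont: "continuous_on A H"
  by (intro continuous_at_imp_continuous_on ballI H_isCont)

text \<open>
  The derivative of \<open>k * w\<close> is \<open>k' * w\<close>, in integrated form. Since \<open>k\<close> is the integral of \<open>k'\<close> from \<open>0\<close>, it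
  follows by exchanging integrals, without differentiating the signal.
\<close>

lemma convolution_eq_integral:
  assumes t: "t > 0"
  shows "c t = integral {0..t} H"
proof -
  let ?M = "restrict_space lborel {0<..<t}"
  have fin: "finite_measure ?M"
    by (rule finite_measureI) (use t in \<open>simp add: space_restrict_space emeasure_restrict_space\<close>)
  have id: "(\<lambda>t. t) \<in> borel_measurable ?M" by (rule measurable_restrict_space1) simp
  have to_borel: "(\<lambda>p. p) \<in> ?M \<Otimes>\<^sub>M lborel \<rightarrow>\<^sub>M borel \<Otimes>\<^sub>M borel"
    using id by (subst measurable_pair_iff) (auto simp: comp_def intro: measurable_compose[OF measurable_fst])
  have restr: "(LINT s|?M. g s) = (LINT s|lborel. indicator {0<..<t} s * g s)" for g :: "real \<Rightarrow> real"
    by (subst integral_restrict_space) simp_all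
  have "(LINT \<tau>|?M. H \<tau>) = (LINT \<tau>|?M. LINT r|lborel. dk r * w0 (\<tau> - r))" by (simp only: H_def)
  also have "\<dots> = (LINT r|lborel. dk r * (LINT \<tau>|?M. w0 (\<tau> - r)))"
  proof (rule Fubini_bounded_factor[OF fin lborel.sigma_finite_measure_axioms dk_integrable _ w0_bound])
    have 1: "(\<lambda>(\<tau>, r). w0 (\<tau> - r)) \<in> borel_measurable (borel \<Otimes>\<^sub>M borel)" by measurable
    show "(\<lambda>(\<tau>, r). w0 (\<tau> - r)) \<in> borel_measurable (?M \<Otimes>\<^sub>M lborel)" by (rule measurable_compose[OF to_borel 1])
  qed
  also have "\<dots> = (LINT r|lborel. dk r * (LINT \<sigma>|?M. w0 \<sigma> * indicator {..<t} (\<sigma> + r)))"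
  proof (intro Bochner_Integration.integral_cong refl)
    fix r
    show "dk r * (LINT \<tau>|?M. w0 (\<tau> - r)) = dk r * (LINT \<sigma>|?M. w0 \<sigma> * indicator {..<t} (\<sigma> + r))"
    proof (cases "r > 0")
      case True
      have "(LINT \<tau>|?M. w0 (\<tau> - r)) = (LINT \<sigma>|lborel. indicator {0<..<t} (r + 1 * \<sigma>) * w0 (r + 1 * \<sigma> - r))"
        unfolding restr by (subst lborel_integral_real_affine[of 1 _ r]) simp_all
      also have "\<dots> = (LINT \<sigma>|lborel. indicator {0<..<t} \<sigma> * (w0 \<sigma> * indicator {..<t} (\<sigma> + r)))"
        using True by (intro Bochner_Integration.integral_cong refl) (auto simp: indicator_def w0_def)
      finally show ?thesis unfolding restr by simp
    qed (simp add: dk_def)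
  qed
  also have "\<dots> = (LINT \<sigma>|?M. LINT r|lborel. dk r * (w0 \<sigma> * indicator {..<t} (\<sigma> + r)))"
  proof (rule Fubini_bounded_factor[OF fin lborel.sigma_finite_measure_axioms dk_integrable, symmetric])
    have "(\<lambda>(\<sigma>, r). w0 \<sigma> * (if \<sigma> + r < t then 1 else 0)) \<in> borel_measurable (borel \<Otimes>\<^sub>M borel)" by measurable
    moreover have "(\<lambda>(\<sigma>, r). w0 \<sigma> * (if \<sigma> + r < t then 1 else 0)) = (\<lambda>(\<sigma>, r). w0 \<sigma> * indicator {..<t} (\<sigma> + r))"
      by (auto simp: indicator_def)
    ultimately have 1: "(\<lambda>(\<sigma>, r). w0 \<sigma> * indicator {..<t} (\<sigma> + r)) \<in> borel_measurable (borel \<Otimes>\<^sub>M borel)" by simp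
    show "(\<lambda>(\<sigma>, r). w0 \<sigma> * indicator {..<t} (\<sigma> + r)) \<in> borel_measurable (?M \<Otimes>\<^sub>M lborel)" by (rule measurable_compose[OF to_borel 1])
    show "\<bar>w0 \<sigma> * indicator {..<t} (\<sigma> + r)\<bar> \<le> 1" for \<sigma> r using w0_bound[of \<sigma>] by (simp add: indicator_def)
  qed
  also have "\<dots> = (LINT \<sigma>|lborel. indicator {0<..<t} \<sigma> * (kern (t - \<sigma>) * w \<sigma>))"
    unfolding restr
  proof (intro Bochner_Integration.integral_cong refl)
    fix \<sigma>
    show "indicator {0<..<t} \<sigma> * (LINT r|lborel. dk r * (w0 \<sigma> * indicator {..<t} (\<sigma> + r)))
       = indicator {0<..<t} \<sigma> * (kern (t - \<sigma>) * w \<sigma>)"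
    proof (cases "\<sigma> \<in> {0<..<t}")
      case True
      have "(LINT r|lborel. dk r * (w0 \<sigma> * indicator {..<t} (\<sigma> + r))) = (LINT r|lborel. w \<sigma> * (indicator {0<..<t - \<sigma>} r * dkern r))"
        using True by (intro Bochner_Integration.integral_cong refl) (auto simp: indicator_def w0_def dk_def)
      also have "\<dots> = w \<sigma> * kern (t - \<sigma>)"
        using True kern_eq_integral[of "t - \<sigma>"] by simp
      finally show ?thesis by (simp add: mult.commute)
    qed simp
  qed
  finally have "c t = (LINT s|lborel. indicator {0<..<t} s * H s)" unfolding restr c_def ..
  also have "\<dots> = (LINT s:{0<..<t}|lborel. H s)" by (simp add: set_lebesgue_integral_def)
  also have "\<dots> = integral {0<..<t} H"
  proof (rule set_borel_integral_eq_integral)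
    have "integrable lborel (\<lambda>s. indicator {0<..<t} s * H s)"
    proof (rule integrable_mult_bounded[OF _ _ H_bound])
      show "integrable lborel (indicator {0<..<t} :: real \<Rightarrow> real)"
        by (rule integrable_real_indicator[OF _ emeasure_bounded_finite]) auto
      show "H \<in> borel_measurable lborel" using H_cont[of UNIV] by (simp add: borel_measurable_continuous_onI)
    qed
    then show "set_integrable lborel {0<..<t} H" by (simp add: set_integrable_def)
  qed
  also have "\<dots> = integral {0..t} H" by (simp add: integral_open_interval_real)
  finally show ?thesis .
qed

lemma y_f_c: "t > 0 \<Longrightarrow> y t = f t - c t"
  using y_eq[of t] by (simp add: f_def c_def w_def)

lemma b_bounded: "\<bar>b n\<bar> \<le> (\<Sum>n. \<bar>b n\<bar>)"
  using sum_le_suminf[OF b_summable, of "{n}"] by simp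

lemma f_deriv: "t > 0 \<Longrightarrow> (f has_real_derivative f' t) (at t)"
  and f'_isCont: "t > 0 \<Longrightarrow> isCont f' t"
  using exp_squares_series_C1[of b, OF b_bounded] unfolding f_def[abs_def] f'_def[abs_def] by auto

lemma y_deriv:
  assumes t: "t > 0"
  shows "(y has_real_derivative f' t - H t) (at t)"
proof -
  have "((\<lambda>s. integral {0..s} H) has_real_derivative H t) (at t within {0..t + 1})"
    by (rule integral_has_real_derivative[OF H_cont]) (use t in auto)
  moreover have "at t within {0..t + 1} = at t" by (rule at_within_interior) (use t in auto)
  ultimately have "((\<lambda>s. integral {0..s} H) has_real_derivative H t) (at t)" by simp
  then have "((\<lambda>s. f s - integral {0..s} H) has_real_derivative f' t - H t) (at t)"
    by (intro DERIV_diff f_deriv t)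
  then show ?thesis
    by (rule has_field_derivative_transform_within_open[where S = "{0<..}"])
       (use t y_f_c convolution_eq_integral in auto)
qed

text \<open>
  Absolute summability of the coefficients of \<open>f\<close> is just what makes \<open>f'\<close> integrable up to \<open>0\<close>,
  because \<open>n\<^sup>2 exp (- n\<^sup>2 t)\<close> has integral \<open>1\<close>.
\<close>

lemma f_integrable:
  "integrable lborel (\<lambda>t. indicator {0<..} t * (f t - b 0))"
  "integrable lborel (\<lambda>t. indicator {0<..} t * f' t)"
proof -
  define B where "B = (\<Sum>n. \<bar>b n\<bar>)"
  have bB: "\<bar>b n\<bar> \<le> B" for n unfolding B_def by (rule b_bounded)
  define c1 where "c1 n = (if n = 0 then 0 else b n)" for n
  have s1: "summable (\<lambda>n. \<bar>c1 n\<bar> / (real n)\<^sup>2)"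
  proof (rule summable_comparison_test'[OF b_summable])
    fix n show "norm (\<bar>c1 n\<bar> / (real n)\<^sup>2) \<le> \<bar>b n\<bar>"
    proof (cases "n = 0")
      case False
      then have "\<bar>b n\<bar> / (real n)\<^sup>2 \<le> \<bar>b n\<bar> / 1" by (intro divide_left_mono) auto
      then show ?thesis using False by (simp add: c1_def)
    qed (simp add: c1_def)
  qed
  have p1: "summable (\<lambda>n. \<bar>c1 n\<bar> * exp (- (real n)\<^sup>2 * t))" if "t > 0" for t
    by (rule summable_comparison_test'[OF summable_mult[OF summable_exp_squares[OF that], of B]])
       (use bB bB[of 0] in \<open>auto simp: c1_def intro: mult_right_mono\<close>)
  have f1: "(\<Sum>n. c1 n * exp (- (real n)\<^sup>2 * t)) = f t - b 0" if "t > 0" for t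
  proof -
    have "summable (\<lambda>n. c1 n * exp (- (real n)\<^sup>2 * t))"
      by (rule summable_rabs_cancel) (use p1[OF that] in \<open>simp add: abs_mult\<close>)
    then have "(\<lambda>n. c1 n * exp (- (real n)\<^sup>2 * t) + (if n = 0 then b 0 else 0)) sums
        ((\<Sum>n. c1 n * exp (- (real n)\<^sup>2 * t)) + b 0)"
      by (intro sums_add summable_sums sums_single)
    moreover have "c1 n * exp (- (real n)\<^sup>2 * t) + (if n = 0 then b 0 else 0) = b n * exp (- (real n)\<^sup>2 * t)" for n
      by (simp add: c1_def)
    ultimately show ?thesis by (simp add: f_def sums_iff)
  qed
  have eq1: "indicator {0<..} t * ((\<Sum>n. c1 n * exp (- (real n)\<^sup>2 * t)) * 1) = indicator {0<..} t * (f t - b 0)" for t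
    using f1[of t] by (cases "t > 0") auto
  have c10: "c1 0 = 0" by (simp add: c1_def)
  show "integrable lborel (\<lambda>t. indicator {0<..} t * (f t - b 0))"
    unfolding eq1[symmetric] by (rule exp_squares_series_halfline(1)[OF c10 s1 p1]) auto
  define c2 where "c2 n = - ((real n)\<^sup>2 * b n)" for n
  have s2: "summable (\<lambda>n. \<bar>c2 n\<bar> / (real n)\<^sup>2)"
    by (rule summable_comparison_test'[OF b_summable]) (simp add: c2_def abs_mult)
  have p2: "summable (\<lambda>n. \<bar>c2 n\<bar> * exp (- (real n)\<^sup>2 * t))" if "t > 0" for t
  proof (rule summable_comparison_test'[OF summable_mult[OF summable_square_exp_squares[OF that], of B]])
    fix n
    have "\<bar>b n\<bar> * ((real n)\<^sup>2 * exp (- (real n)\<^sup>2 * t)) \<le> B * ((real n)\<^sup>2 * exp (- (real n)\<^sup>2 * t))"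
      by (rule mult_right_mono[OF bB]) simp
    then show "norm (\<bar>c2 n\<bar> * exp (- (real n)\<^sup>2 * t)) \<le> B * ((real n)\<^sup>2 * exp (- (real n)\<^sup>2 * t))"
      by (simp add: c2_def abs_mult mult_ac)
  qed
  have eq2: "indicator {0<..} t * ((\<Sum>n. c2 n * exp (- (real n)\<^sup>2 * t)) * 1) = indicator {0<..} t * f' t" for t
    by (simp add: c2_def f'_def)
  have c20: "c2 0 = 0" by (simp add: c2_def)
  show "integrable lborel (\<lambda>t. indicator {0<..} t * f' t)"
    unfolding eq2[symmetric] by (rule exp_squares_series_halfline(1)[OF c20 s2 p2]) auto
qed

text \<open>
  Before time \<open>T\<close> neither the cut-off of the kernel nor that of the signal is noticed.
\<close>

lemma inner_convolution:
  assumes t: "0 < t" "t < T"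
  shows "(LINT r|lborel. (indicator {0<..T} r * kern r + q * (indicator {0<..} r * dkern r)) * (indicator {0<..<T} (t - r) * w (t - r)))
    = c t + q * H t"
proof -
  let ?W = "\<lambda>t. indicator {0<..<T} t * w t"
  have Wm: "?W \<in> borel_measurable borel"
  proof -
    have "(\<lambda>t. indicator {0<..<T} t * w0 t) \<in> borel_measurable borel" by measurable
    moreover have "(\<lambda>t. indicator {0<..<T} t * w0 t) = ?W" by (auto simp: indicator_def w0_def fun_eq_iff)
    ultimately show ?thesis by simp
  qed
  have W1: "\<bar>?W t\<bar> \<le> 1" for t using w_bound[of t] by (simp add: indicator_def)
  have oi: "integrable lborel (\<lambda>r. indicator {0<..T} r :: real)"
    by (rule integrable_real_indicator[OF _ emeasure_bounded_finite]) auto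
  have ki: "integrable lborel (\<lambda>r. indicator {0<..T} r * kern r)"
  proof -
    have "integrable lborel (\<lambda>r. indicator {0<..} r * (kern r - 1 / pi) * indicator {0<..T} r + 1 / pi * indicator {0<..T} r)"
      by (intro Bochner_Integration.integrable_add integrable_mult_right oi
          integrable_mult_bounded[OF kern_transform(1), of _ 1]) auto
    moreover have "indicator {0<..} r * (kern r - 1 / pi) * indicator {0<..T} r + 1 / pi * indicator {0<..T} r = indicator {0<..T} r * kern r" for r
      by (auto simp: indicator_def)
    ultimately show ?thesis by simp
  qed
  have Wtm: "(\<lambda>r. ?W (t - r)) \<in> borel_measurable lborel" using Wm by measurable
  have i1: "integrable lborel (\<lambda>r. indicator {0<..T} r * kern r * ?W (t - r))"
    by (rule integrable_mult_bounded[OF ki Wtm W1])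
  have eqH: "dk r * ?W (t - r) = dk r * w0 (t - r)" for r
    using t by (auto simp: dk_def w0_def indicator_def)
  have "(LINT r|lborel. (indicator {0<..T} r * kern r + q * (indicator {0<..} r * dkern r)) * ?W (t - r))
     = (LINT r|lborel. indicator {0<..T} r * kern r * ?W (t - r) + q * (dk r * w0 (t - r)))"
    unfolding eqH[symmetric] by (intro Bochner_Integration.integral_cong refl) (simp add: dk_def algebra_simps)
  also have "\<dots> = (LINT r|lborel. indicator {0<..T} r * kern r * ?W (t - r)) + q * H t"
    using i1 dk_w0_integrable by (simp add: H_def)
  also have "(LINT r|lborel. indicator {0<..T} r * kern r * ?W (t - r))
     = (LINT \<sigma>|lborel. indicator {0<..T} (t + (-1) * \<sigma>) * kern (t + (-1) * \<sigma>) * ?W (t - (t + (-1) * \<sigma>)))"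
    by (subst lborel_integral_real_affine[of "-1" _ t]) simp_all
  also have "\<dots> = c t"
    unfolding c_def using t by (intro Bochner_Integration.integral_cong refl) (auto simp: indicator_def)
  finally show ?thesis .
qed

text \<open>
  The Popov estimate explained at the beginning. \<open>F1\<close>, \<open>F2\<close> and \<open>G\<close> bound the contributions of
  \<open>f - b 0\<close>, of \<open>f'\<close>, and of the initial value of the potential \<open>\<Gamma>\<close> of the nonlinearity.
\<close>

lemma w_square_integral_bounded: "\<exists>C. \<forall>T>0. (LINT t|lborel. (indicator {0<..<T} t * w t)\<^sup>2) \<le> C"
proof -
  obtain q where q: "q > 0" and b0: "beta0 > 0"
    and freq: "\<And>v. v \<noteq> 0 \<Longrightarrow> (LINT r|lborel. popov_kernel q r * cos (v * r)) \<ge> - (1 / beta0)"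
    using popov_frequency_condition by blast
  define F1 where "F1 = (LINT t|lborel. \<bar>indicator {0<..} t * (f t - b 0)\<bar>)"
  define F2 where "F2 = (LINT t|lborel. \<bar>indicator {0<..} t * f' t\<bar>)"
  define G where "G = ln (cosh (\<beta> * Y)) / \<beta>"
  define \<Gamma> where "\<Gamma> x = ln (cosh (\<beta> * x)) / \<beta>" for x
  define g where "g = 1 / \<beta> - 1 / beta0"
  have g: "g > 0" using beta b0 by (simp add: g_def frac_less2)
  have \<Gamma>0: "\<Gamma> x \<ge> 0" for x unfolding \<Gamma>_def using beta cosh_real_ge_1 by (intro divide_nonneg_pos ln_ge_zero) auto
  have \<Gamma>G: "\<Gamma> (y t) \<le> G" if "t > 0" for t
  proof -
    have "\<bar>\<beta> * y t\<bar> \<le> \<bar>\<beta> * Y\<bar>"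
      unfolding abs_mult using y_bound[OF that] by (intro mult_left_mono) auto
    then have "cosh \<bar>\<beta> * y t\<bar> \<le> cosh \<bar>\<beta> * Y\<bar>" by (subst cosh_real_nonneg_le_iff) auto
    then have "cosh (\<beta> * y t) \<le> cosh (\<beta> * Y)" by simp
    then show ?thesis unfolding \<Gamma>_def G_def using beta by (intro divide_right_mono) auto
  qed
  have d\<Gamma>: "((\<lambda>t. \<Gamma> (y t)) has_real_derivative w t * (f' t - H t)) (at t)" if "t > 0" for t
  proof -
    have "(\<Gamma> has_real_derivative tanh (\<beta> * y t)) (at (y t))"
      unfolding \<Gamma>_def using beta
      by (auto intro!: derivative_eq_intros simp: tanh_def)
    from DERIV_chain2[OF this y_deriv[OF that]] show ?thesis by (simp add: w_def)
  qed
  have bound: "(LINT t|lborel. (indicator {0<..<T} t * w t)\<^sup>2) \<le> (F1 + q * F2 + q * G + pi * (b 0)\<^sup>2 / 2) / g" if T: "T > 0" for T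
  proof -
    define W where "W t = indicator {0<..<T} t * w t" for t
    have Ww0: "W t = indicator {0<..<T} t * w0 t" for t by (auto simp: W_def w0_def indicator_def)
    have Wm[measurable]: "W \<in> borel_measurable borel"
      unfolding Ww0[abs_def] by measurable
    have W1: "\<bar>W t\<bar> \<le> 1" for t using w_bound[of t] by (simp add: W_def indicator_def)
    interpret bounded_signal W T 1 "{0, T}"
    proof
      show "W \<in> borel_measurable borel" by (rule Wm)
      show "\<bar>W t\<bar> \<le> 1" for t by (rule W1)
      show "W t = 0" if "t \<notin> {0..T}" for t using that by (cases "t \<in> {0<..<T}") (auto simp: W_def)
      show "isCont W t" if t: "t \<notin> {0, T}" for t
      proof -
        consider "t < 0" | "0 < t" "t < T" | "t > T" using t by force
        then show ?thesis
        proof cases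
          case 1
          then have "\<forall>\<^sub>F s in nhds t. W s = 0"
            by (intro eventually_nhds_in_open[THEN eventually_mono, of "{..<0}"]) (auto simp: W_def)
          then show ?thesis by (subst isCont_cong) auto
        next
          case 2
          then have "\<forall>\<^sub>F s in nhds t. W s = w s"
            by (intro eventually_nhds_in_open[THEN eventually_mono, of "{0<..<T}"]) (auto simp: W_def)
          then show ?thesis using w_isCont[OF 2(1)] by (subst isCont_cong) auto
        next
          case 3
          then have "\<forall>\<^sub>F s in nhds t. W s = 0"
            by (intro eventually_nhds_in_open[THEN eventually_mono, of "{T<..}"]) (auto simp: W_def)
          then show ?thesis by (subst isCont_cong) auto
        qed
      qed
    qed simp
    define S where "S = (LINT t|lborel. W t)"
    define Q where "Q = (LINT t|lborel. (W t)\<^sup>2)"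
    have "(LINT t|lborel. W t * (LINT r|lborel. (indicator {0<..T} r * kern r + q * (indicator {0<..} r * dkern r)) * W (t - r)))
      = (LINT t|lborel. W t * (c t + q * H t))"
    proof (intro Bochner_Integration.integral_cong refl)
      fix t
      show "W t * (LINT r|lborel. (indicator {0<..T} r * kern r + q * (indicator {0<..} r * dkern r)) * W (t - r)) = W t * (c t + q * H t)"
      proof (cases "t \<in> {0<..<T}")
        case True
        then show ?thesis using inner_convolution[of t T q] by (simp add: W_def)
      qed (simp add: W_def)
    qed
    with popov_energy_inequality[OF freq]
    have energy: "(LINT t|lborel. W t * (c t + q * H t)) \<ge> S\<^sup>2 / (2 * pi) - 1 / beta0 * Q"
      by (simp add: S_def Q_def)
    define P1 where "P1 = (LINT t|lborel. indicator {0<..} t * (f t - b 0) * W t)"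
    define P2 where "P2 = (LINT t|lborel. indicator {0<..} t * f' t * W t)"
    define P3 where "P3 = (LINT t|lborel. W t * y t)"
    define P4 where "P4 = (LINT t|lborel. W t * (f' t - H t))"
    have i1: "integrable lborel (\<lambda>t. indicator {0<..} t * (f t - b 0) * W t)"
      by (rule integrable_mult_bounded[OF f_integrable(1) _ W1]) simp
    have i2: "integrable lborel (\<lambda>t. indicator {0<..} t * f' t * W t)"
      by (rule integrable_mult_bounded[OF f_integrable(2) _ W1]) simp
    have i3: "integrable lborel (\<lambda>t. W t * y t)"
    proof -
      have "integrable lborel (\<lambda>t. W t * (indicator {0<..} t * y t))"
      proof (rule integrable_mult_bounded[OF W_integrable])
        show "(\<lambda>t. indicator {0<..} t * y t) \<in> borel_measurable lborel"
          using borel_measurable_halfline[OF y_isCont] by simp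
        show "\<bar>indicator {0<..} t * y t\<bar> \<le> \<bar>Y\<bar>" for t
          using y_bound[of t] by (auto simp: indicator_def)
      qed
      moreover have "W t * (indicator {0<..} t * y t) = W t * y t" for t by (auto simp: W_def indicator_def)
      ultimately show ?thesis by simp
    qed
    have i5: "integrable lborel (\<lambda>t. W t * H t)"
      by (rule integrable_mult_bounded[OF W_integrable _ H_bound])
         (use H_cont[of UNIV] in \<open>simp add: borel_measurable_continuous_onI\<close>)
    have eq2: "W t * (f' t - H t) = indicator {0<..} t * f' t * W t - W t * H t" for t
      by (auto simp: W_def indicator_def algebra_simps)
    have i4: "integrable lborel (\<lambda>t. W t * (f' t - H t))"
      unfolding eq2 by (intro Bochner_Integration.integrable_diff i2 i5)
    have "W t * (c t + q * H t) = indicator {0<..} t * (f t - b 0) * W t + b 0 * W t - W t * y t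
       + q * (indicator {0<..} t * f' t * W t) - q * (W t * (f' t - H t))" for t
    proof (cases "t \<in> {0<..<T}")
      case True
      then have c: "c t = f t - y t" using y_f_c[of t] by simp
      show ?thesis unfolding c using True by (simp add: algebra_simps)
    qed (simp add: W_def)
    then have split: "(LINT t|lborel. W t * (c t + q * H t)) = P1 + b 0 * S - P3 + q * P2 - q * P4"
      using i1 i2 i3 i4 W_integrable by (simp add: P1_def P2_def P3_def P4_def S_def)
    have bp: "\<bar>LINT t|lborel. h t * W t\<bar> \<le> (LINT t|lborel. \<bar>h t\<bar>)" if h: "integrable lborel h" for h :: "real \<Rightarrow> real"
    proof -
      have i: "integrable lborel (\<lambda>t. h t * W t)" by (rule integrable_mult_bounded[OF h _ W1]) simp
      have "\<bar>LINT t|lborel. h t * W t\<bar> \<le> (LINT t|lborel. \<bar>h t * W t\<bar>)"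
        using integral_norm_bound[of lborel "\<lambda>t. h t * W t"] by simp
      also have "\<dots> \<le> (LINT t|lborel. \<bar>h t\<bar>)"
        by (rule integral_mono[OF integrable_abs[OF i] integrable_abs[OF h]]) (simp add: abs_mult mult_left_le W1)
      finally show ?thesis .
    qed
    have P1: "P1 \<le> F1" using bp[OF f_integrable(1)] unfolding P1_def F1_def by linarith
    have P2: "P2 \<le> F2" using bp[OF f_integrable(2)] unfolding P2_def F2_def by linarith
    have P3: "P3 \<ge> 1 / \<beta> * Q"
    proof -
      have "1 / \<beta> * Q = (LINT t|lborel. 1 / \<beta> * (W t)\<^sup>2)" by (simp add: Q_def)
      also have "\<dots> \<le> P3"
        unfolding P3_def
      proof (rule integral_mono)
        show "integrable lborel (\<lambda>t. 1 / \<beta> * (W t)\<^sup>2)"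
          using integrable_mult_bounded[OF W_integrable _ W1] by (simp add: power2_eq_square)
        show "integrable lborel (\<lambda>t. W t * y t)" by (rule i3)
        fix t
        show "1 / \<beta> * (W t)\<^sup>2 \<le> W t * y t"
          using tanh_square_le[of "\<beta> * y t"] beta by (auto simp: W_def w_def indicator_def field_simps)
      qed
      finally show ?thesis .
    qed
    have P4: "P4 \<ge> - G"
    proof -
      \<comment> \<open>The potential is differentiable along \<open>y\<close> only for positive times, so the lower limit of
        integration is approached from the right.\<close>
      define e where "e n = T / real (n + 2)" for n
      have e: "0 < e n" "e n < T" for n
      proof -
        show "0 < e n" using T by (simp add: e_def)
        have "T / real (n + 2) < T / 1" using T by (intro divide_strict_left_mono) auto
        then show "e n < T" by (simp add: e_def)
      qed
      have elim0: "e \<longlonglongrightarrow> 0" unfolding e_def by (rule LIMSEQ_ignore_initial_segment[OF lim_const_over_n])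
      have ge: "(LINT t|lborel. indicator {e n..T} t * (w t * (f' t - H t))) \<ge> - G" for n
      proof -
        have "(LINT t|lborel. (w t * (f' t - H t)) * indicator {e n..T} t) = \<Gamma> (y T) - \<Gamma> (y (e n))"
        proof (rule integral_FTC_Icc_real)
          fix t assume "e n \<le> t"
          then have t: "t > 0" using e(1)[of n] by linarith
          show "((\<lambda>t. \<Gamma> (y t)) has_real_derivative w t * (f' t - H t)) (at t)" by (rule d\<Gamma>[OF t])
          show "isCont (\<lambda>t. w t * (f' t - H t)) t" by (intro continuous_intros w_isCont f'_isCont H_isCont t)
        qed (use e[of n] in simp)
        also have "\<dots> \<ge> - G" using \<Gamma>0[of "y T"] \<Gamma>G[OF e(1)[of n]] by linarith
        finally show ?thesis by (simp add: mult.commute)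
      qed
      have "(\<lambda>n. LINT t|lborel. indicator {e n..T} t * (w t * (f' t - H t))) \<longlonglongrightarrow> (LINT t|lborel. W t * (f' t - H t))"
      proof (rule integral_dominated_convergence)
        have T': "AE t in lborel. t \<noteq> T" by (rule AE_lborel_singleton)
        show "integrable lborel (\<lambda>t. \<bar>W t * (f' t - H t)\<bar>)" by (rule integrable_abs[OF i4])
        show "(\<lambda>t. W t * (f' t - H t)) \<in> borel_measurable lborel" by (rule borel_measurable_integrable[OF i4])
        show "(\<lambda>t. indicator {e n..T} t * (w t * (f' t - H t))) \<in> borel_measurable lborel" for n
        proof -
          have "(\<lambda>t. indicator {0<..} t * (w t * (f' t - H t))) \<in> borel_measurable borel"
            by (rule borel_measurable_halfline) (intro continuous_intros w_isCont f'_isCont H_isCont; simp)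
          then have "(\<lambda>t. indicator {e n..T} t * (indicator {0<..} t * (w t * (f' t - H t)))) \<in> borel_measurable borel" by measurable
          moreover have "indicator {e n..T} t * (indicator {0<..} t * (w t * (f' t - H t))) = indicator {e n..T} t * (w t * (f' t - H t))" for t
            using e(1)[of n] by (auto simp: indicator_def)
          ultimately show ?thesis by simp
        qed
        show "AE t in lborel. norm (indicator {e n..T} t * (w t * (f' t - H t))) \<le> \<bar>W t * (f' t - H t)\<bar>" for n
          using T'
        proof eventually_elim
          case (elim t)
          then show ?case using e(1)[of n] by (auto simp: W_def indicator_def)
        qed
        show "AE t in lborel. (\<lambda>n. indicator {e n..T} t * (w t * (f' t - H t))) \<longlonglongrightarrow> W t * (f' t - H t)"
          using T'
        proof eventually_elim
          case (elim t)
          show ?case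
          proof (cases "0 < t \<and> t < T")
            case True
            then have "\<forall>\<^sub>F n in sequentially. e n < t" using order_tendstoD(2)[OF elim0] by simp
            then have "\<forall>\<^sub>F n in sequentially. indicator {e n..T} t * (w t * (f' t - H t)) = W t * (f' t - H t)"
              by eventually_elim (use True in \<open>simp add: W_def\<close>)
            then show ?thesis by (rule tendsto_eventually)
          next
            case False
            then have "t \<le> 0 \<or> t > T" using elim by auto
            then have "indicator {e n..T} t * (w t * (f' t - H t)) = 0" "W t = 0" for n
              using e(1)[of n] T by (auto simp: W_def indicator_def)
            then show ?thesis by (simp only: mult_zero_left tendsto_const)
          qed
        qed
      qed
      then show ?thesis unfolding P4_def by (rule LIMSEQ_le_const) (use ge in auto)
    qed
    \<comment> \<open>The square of the integral of \<open>w\<close> absorbs the contribution of the limit \<open>b 0\<close> of \<open>f\<close>, which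
      need not vanish.\<close>
    have sq: "b 0 * S - S\<^sup>2 / (2 * pi) \<le> pi * (b 0)\<^sup>2 / 2"
    proof -
      have "0 \<le> (S - pi * b 0)\<^sup>2 / (2 * pi)" by simp
      also have "\<dots> = S\<^sup>2 / (2 * pi) - b 0 * S + pi * (b 0)\<^sup>2 / 2"
        by (simp add: power2_eq_square field_simps)
      finally show ?thesis by simp
    qed
    have "g * Q \<le> F1 + q * F2 + q * G + pi * (b 0)\<^sup>2 / 2"
    proof -
      have "q * P2 \<le> q * F2" by (rule mult_left_mono[OF P2]) (use q in simp)
      moreover have "q * (- G) \<le> q * P4" by (rule mult_left_mono[OF P4]) (use q in simp)
      ultimately show ?thesis
        using energy P1 P3 sq unfolding split g_def by (simp add: left_diff_distrib)
    qed
    then have "Q \<le> (F1 + q * F2 + q * G + pi * (b 0)\<^sup>2 / 2) / g" using g by (simp add: field_simps)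
    then show ?thesis by (simp add: Q_def W_def)
  qed
  then show ?thesis by blast
qed

text \<open>
  The derivative of \<open>w\<close> is bounded on \<open>[1,\<infinity>)\<close> since \<open>k'\<close> is integrable and \<open>|w| \<le> 1\<close>.
\<close>

theorem tendsto_zero: "(y \<longlongrightarrow> 0) at_top"
proof -
  obtain C where C: "\<And>T. T > 0 \<Longrightarrow> (LINT t|lborel. (indicator {0<..<T} t * w t)\<^sup>2) \<le> C"
    using w_square_integral_bounded by blast
  obtain D where D: "\<And>t. t \<ge> 1 \<Longrightarrow> \<bar>f' t\<bar> \<le> D * exp (- t)"
    using exp_squares_series_decay[of b, OF b_bounded] unfolding f'_def by blast
  define L where "L = \<beta> * (\<bar>D\<bar> + (LINT r|lborel. \<bar>dk r\<bar>))"
  have "(w \<longlongrightarrow> 0) at_top"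
  proof (rule square_integrable_Lipschitz_tendsto_zero[where L = L])
    fix s t :: real assume st: "1 \<le> s" "s \<le> t"
    have dw: "(w has_real_derivative (1 - (tanh (\<beta> * y x))\<^sup>2) * (\<beta> * (f' x - H x))) (at x)" if "x > 0" for x
      unfolding w_def[abs_def] by (auto intro!: derivative_eq_intros y_deriv that)
    have "norm (w t - w s) \<le> L * norm (t - s)"
    proof (rule field_differentiable_bound[of "{s..t}"])
      fix x assume x: "x \<in> {s..t}"
      then have x1: "x \<ge> 1" using st by simp
      show "(w has_field_derivative (1 - (tanh (\<beta> * y x))\<^sup>2) * (\<beta> * (f' x - H x))) (at x within {s..t})"
        by (rule has_field_derivative_at_within[OF dw]) (use x1 in simp)
      have "\<bar>f' x\<bar> \<le> \<bar>D\<bar>"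
      proof -
        have "\<bar>f' x\<bar> \<le> D * exp (- x)" by (rule D[OF x1])
        also have "\<dots> \<le> \<bar>D\<bar> * 1" using x1 by (intro mult_mono) auto
        finally show ?thesis by simp
      qed
      then have "\<bar>f' x - H x\<bar> \<le> \<bar>D\<bar> + (LINT r|lborel. \<bar>dk r\<bar>)" using H_bound[of x] by linarith
      moreover have "\<bar>1 - (tanh (\<beta> * y x))\<^sup>2\<bar> \<le> 1"
        using w_bound[of x] by (simp add: w_def abs_square_le_1)
      ultimately have "\<bar>1 - (tanh (\<beta> * y x))\<^sup>2\<bar> * (\<beta> * \<bar>f' x - H x\<bar>) \<le> 1 * L"
        unfolding L_def using beta by (intro mult_mono) auto
      then show "norm ((1 - (tanh (\<beta> * y x))\<^sup>2) * (\<beta> * (f' x - H x))) \<le> L"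
        using beta by (simp add: abs_mult)
    qed (use st in auto)
    then show "\<bar>w t - w s\<bar> \<le> L * (t - s)" using st by simp
  next
    show "(\<lambda>t. indicator {0<..} t * w t) \<in> borel_measurable borel" by (rule borel_measurable_halfline[OF w_isCont])
  qed (use w_bound C in auto)
  then have "((\<lambda>t. artanh (w t)) \<longlongrightarrow> artanh 0) at_top" by (rule tendsto_artanh) auto
  then have "((\<lambda>t. \<beta> * y t) \<longlongrightarrow> 0) at_top" by (simp add: w_def artanh_tanh_real)
  then have "((\<lambda>t. 1 / \<beta> * (\<beta> * y t)) \<longlongrightarrow> 1 / \<beta> * 0) at_top" by (intro tendsto_intros)
  then show ?thesis using beta by simp
qed

end

theorem proposition4p1:
  fixes \<beta> :: real and u\<^sub>0 :: h1 and y :: "real \<Rightarrow> real"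
    and T :: "real \<Rightarrow> hm1 \<Rightarrow>\<^sub>L hm1"
  assumes "generated_by_minus_A_N T"
    and "0 < \<beta>" and "\<beta> < beta0"
    and "continuous_on {0<..} y" and "bounded (y ` {0<..})"
    and "\<And>t. t > 0 \<Longrightarrow>
      y t = f_of T u\<^sub>0 t + (LBINT \<tau>:{0<..<t}. a_of T (t - \<tau>) * g_of \<beta> (y \<tau>))"
  shows "(y \<longlongrightarrow> 0) at_top"
proof -
  obtain b where b: "summable (\<lambda>n. \<bar>b n\<bar>)"
    "\<And>t. t > 0 \<Longrightarrow> (\<lambda>n. b n * exp (- (real n)\<^sup>2 * t)) sums f_of T u\<^sub>0 t"
    using f_of_series[OF assms(1)] by blast
  obtain Y where Y: "\<And>t. t > 0 \<Longrightarrow> \<bar>y t\<bar> \<le> Y"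
    using assms(5) by (auto simp: bounded_iff)
  have a: "a_of T t = - kern t" if "t > 0" for t
    using sums_unique[OF a_of_series[OF assms(1) that]] by (simp add: kern_def)
  interpret volterra_solution \<beta> Y b y
  proof
    fix t :: real assume t: "t > 0"
    have "(LBINT \<tau>:{0<..<t}. a_of T (t - \<tau>) * g_of \<beta> (y \<tau>))
      = (LINT \<tau>|lborel. - (indicator {0<..<t} \<tau> * (kern (t - \<tau>) * tanh (\<beta> * y \<tau>))))"
      unfolding set_lebesgue_integral_def
      by (intro Bochner_Integration.integral_cong refl) (auto simp: indicator_def a g_of_def)
    then show "y t = (\<Sum>n. b n * exp (- (real n)\<^sup>2 * t))
       - (LINT \<tau>|lborel. indicator {0<..<t} \<tau> * (kern (t - \<tau>) * tanh (\<beta> * y \<tau>)))"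
      using assms(6)[OF t] sums_unique[OF b(2)[OF t]] by simp
  qed (use assms Y b in auto)
  show ?thesis by (rule tendsto_zero)
qed

end
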